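(* Let $(X,w)$ be an $(r+1)$-partite weighted simplicial complex with $n=|X(0)|$ vertices ($r\ge1$), and let $R$ be an (additive) abelian group. Suppose that we are given a subgroup $R_x$ of $R$ for every nonempty $x\in X$, and set $R_\emptyset=\{0_R\}$. Define a subsheaf $\mathcal{G}$ of the constant sheaf $R_X$ by $\mathcal{G}(x)=\sum_{y\subseteq x}R_y$ ($x\in X$), and put $$t=\max\Big\{\tfrac{w(e)}{w(x)} : x\in X(0),\ e\in X(1),\ e\supseteq x\Big\},\qquad s=\max\{w(e): e\in X(1)\}.$$ Suppose that: (1) for every subgraph $Y$ of $X$ which is either a cycle of length $\leq\lceil\frac23 n\rceil$ or a path of length $\leq 2$, the subgroups $\{R_y\}_{y\in Y}$ are linearly disjoint in $R$; and (2) for every distinct $u,v\in X(0)$, the subgroups $R_u$ and $R_v$ are linearly disjoint. If $(X,w)$ is an $(r+1)$-partite $[\mu,\lambda]$-expander with $\lambda\geq-\frac1r$, then $$\mathrm{cbe}_0(X,w,R_X/\mathcal{G})\;\geq\;\frac{2r-4r\lambda-4r^2\max\{|\lambda|,|\mu|\}-(5r+2)t-2rs}{5r+2-2r\lambda}.$$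
   Context: Simplicial complexes are finite, nonempty families of finite sets closed under taking subsets (so $\emptyset\in X$); $X(i)$ is the set of faces of dimension $i$ (cardinality $i+1$). An $(r+1)$-partite weighted simplicial complex consists of a simplicial complex $X$ that is pure of dimension $r$ (every face is contained in an $r$-face), a partition $V_0,\dots,V_r$ of its vertex set into nonempty parts such that every face has at most one vertex in each $V_i$, and a weight function $w:X\to[0,\infty)$ satisfying $\sum_{y\in X(r)}w(y)=1$, $w(x)=\binom{r+1}{\dim x+1}^{-1}\sum_{y\in X(r),\,y\supseteq x}w(y)$ for all $x\in X$ with $\dim x<r$, and $w(v)>0$ for all $v\in X(0)$. For $A\subseteq X$, $w(A)=\sum_{a\in A}w(a)$. $X_{\{i\}}$ is the set of $0$-faces whose vertex is in $V_i$. A subgraph of $X$ is a subcomplex of dimension at most $1$ (it contains $\emptyset$). A cycle of length $\ell\ge 3$ is a subgraph isomorphic to the cycle graph on $\ell$ vertices; a path of length $\ell$ is a subgraph consisting of $\ell$ distinct consecutive edges, their vertices and $\emptyset$ (so a path of length $\le 2$ is a single vertex, an edge with its two vertices, or two distinct edges sharing a vertex together with their three vertices, in each case along with $\emptyset$). A finite family of subgroups $\{R_i\}_{i\in I}$ of $R$ is linearly disjoint if $(r_i)_i\mapsto\sum_i r_i:\bigoplus_{i\in I}R_i\to R$ is injective. Partite spectral expansion: on functions $f:X(0)\to\mathbb{R}$ with inner product $\langle f,g\rangle=\sum_{v}w(v)f(v)g(v)$, the weighted adjacency operator is $(\mathcal{A}f)(v)=\sum_{e\in X(1),\,e\supseteq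 v}\frac{w(e)}{2w(v)}f(e-v)$, where $e-v$ is the other vertex of $e$. It is self-adjoint, and preserves the span $L$ of the indicator functions $1_{X_{\{0\}}},\dots,1_{X_{\{r\}}}$ and hence $C^0_\diamond(X,\mathbb{R}):=L^\perp$. For real numbers $\mu\le\lambda$, $(X,w)$ is an $(r+1)$-partite $[\mu,\lambda]$-expander if all eigenvalues of $\mathcal{A}$ on $C^0_\diamond(X,\mathbb{R})$ lie in $[\mu,\lambda]$. Sheaves: a sheaf $\mathcal{F}$ on $X$ assigns an abelian group $\mathcal{F}(x)$ to each $x\in X$ (including $\emptyset$) and homomorphisms $\mathrm{res}_{y\leftarrow x}:\mathcal{F}(x)\to\mathcal{F}(y)$ for $x\subsetneq y$ with $\mathrm{res}_{z\leftarrow y}\circ\mathrm{res}_{y\leftarrow x}=\mathrm{res}_{z\leftarrow x}$. The constant sheaf $R_X$ has $R_X(x)=R$ for all $x$ and identity restriction maps. A subsheaf $\mathcal{G}\subseteq R_X$ is a choice of subgroups $\mathcal{G}(x)\subseteq R$ with $\mathcal{G}(x)\subseteq\mathcal{G}(y)$ for $x\subseteq y$; the quotient sheaf $R_X/\mathcal{G}$ has $(R_X/\mathcal{G})(x)=R/\mathcal{G}(x)$ with the induced restriction maps. Coboundary expansion: fix a linear order on the vertices and let $e^+,e^-$ be the larger and smaller vertex of an edge $e$. Put $C^i=\prod_{x\in X(i)}\mathcal{F}(x)$, $(d_{-1}f)(v)=\mathrm{res}_{v\leftarrow\emptyset}f(\emptyset)$, $(d_0f)(e)=\mathrm{res}_{e\leftarrow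 e^+}f(e^+)-\mathrm{res}_{e\leftarrow e^-}f(e^-)$, $B^0=\mathrm{im}\,d_{-1}$. For $f\in C^i$, $\|f\|_w=w(\{x\in X(i):f(x)\ne0\})$; $\mathrm{dist}_w(f,B^0)=\min_{g\in B^0}\|f-g\|_w$. $\mathrm{cbe}_0(X,w,\mathcal{F})$ is the supremum of all $\varepsilon\in[0,\infty)$ with $\|d_0f\|_w\ge\varepsilon\,\mathrm{dist}_w(f,B^0)$ for all $f\in C^0$.
   Formalization: The formal theorem also assumes 5r+2-2rλ>0 (automatic for λ≤1); otherwise the bound is undefined or false, e.g. for a single edge with r=1, R=Z, all R_x=0, μ=λ=4, it claims cbe_0≥46 while cbe_0≤2. *)

theory Defs
  imports "HOL-Algebra.FiniteProduct" "HOL-Algebra.Product_Groups" "HOL-Library.Indicator_Function" "HOL-Library.Extended_Real"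
begin

section \<open>Partite weighted simplicial complexes\<close>

definition simplicial_complex :: "'v set set \<Rightarrow> bool" where
  "simplicial_complex X \<longleftrightarrow>
     finite X \<and> X \<noteq> {} \<and> (\<forall>x\<in>X. finite x) \<and> (\<forall>x\<in>X. \<forall>y. y \<subseteq> x \<longrightarrow> y \<in> X)"

definition simplex_dim :: "'v set \<Rightarrow> int" where
  "simplex_dim x = int (card x) - 1"

text \<open>The dimension is an integer, so that the empty face is the only face of dimension \<open>-1\<close>.
  The \<open>0\<close>-faces are singletons; the vertex set proper is \<open>\<Union>X\<close>.\<close>

definition faces :: "'v set set \<Rightarrow> int \<Rightarrow> 'v set set" where
  "faces X i = {x \<in> X. simplex_dim x = i}"

locale partite_weighted_complex =
  fixes r :: nat and X :: "'v set set" and V :: "nat \<Rightarrow> 'v set" and w :: "'v set \<Rightarrow> real"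
  assumes complex: "simplicial_complex X"
    and pure: "\<And>x. x \<in> X \<Longrightarrow> \<exists>y\<in>faces X (int r). x \<subseteq> y"
    and parts_nonempty: "\<And>i. i \<le> r \<Longrightarrow> V i \<noteq> {}"
    and parts_disjoint: "disjoint_family_on V {..r}"
    and parts_cover: "(\<Union>i\<le>r. V i) = \<Union>X"
    and partite: "\<And>x i. x \<in> X \<Longrightarrow> i \<le> r \<Longrightarrow> card (x \<inter> V i) \<le> 1"
    and weight_nonneg: "\<And>x. x \<in> X \<Longrightarrow> 0 \<le> w x"
    and weight_top: "(\<Sum>y\<in>faces X (int r). w y) = 1"
    and weight_lower: "\<And>x. x \<in> X \<Longrightarrow> simplex_dim x < int r \<Longrightarrow>
          w x = inverse (real ((r + 1) choose (card x))) * (\<Sum>y | y \<in> faces X (int r) \<and> x \<subseteq> y. w y)"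
    and weight_vertex_pos: "\<And>v. v \<in> faces X 0 \<Longrightarrow> 0 < w v"


section \<open>Cycles and paths\<close>

definition subgraph :: "'v set set \<Rightarrow> 'v set set \<Rightarrow> bool" where
  "subgraph X Y \<longleftrightarrow> simplicial_complex Y \<and> Y \<subseteq> X \<and> (\<forall>y\<in>Y. simplex_dim y \<le> 1)"

definition complex_iso :: "'u set set \<Rightarrow> 'v set set \<Rightarrow> bool" where
  "complex_iso X Y \<longleftrightarrow> (\<exists>h. bij_betw h (\<Union>X) (\<Union>Y) \<and> Y = (\<lambda>x. h ` x) ` X)"

text \<open>The cycle on the vertices \<open>0, \<dots>, l - 1\<close> as a one-dimensional complex.\<close>

definition cycle_graph :: "nat \<Rightarrow> nat set set" where
  "cycle_graph l = {{}} \<union> {{i} | i. i < l} \<union> {{i, Suc i mod l} | i. i < l}"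

definition cycle_in :: "'v set set \<Rightarrow> nat \<Rightarrow> 'v set set \<Rightarrow> bool" where
  "cycle_in X l Y \<longleftrightarrow> 3 \<le> l \<and> subgraph X Y \<and> complex_iso (cycle_graph l) Y"

text \<open>Paths consist of \<open>l\<close> distinct consecutive edges. For \<open>l = 0\<close> this leaves a single vertex.\<close>

definition path_in :: "'v set set \<Rightarrow> nat \<Rightarrow> 'v set set \<Rightarrow> bool" where
  "path_in X l Y \<longleftrightarrow> subgraph X Y \<and>
     (\<exists>p :: nat \<Rightarrow> 'v.
        (\<forall>i<l. {p i, p (Suc i)} \<in> faces X 1) \<and>
        inj_on (\<lambda>i. {p i, p (Suc i)}) {..<l} \<and>
        Y = {{}} \<union> {{p i} | i. i \<le> l} \<union> {{p i, p (Suc i)} | i. i < l})"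


section \<open>Partite spectral expansion\<close>

text \<open>Functions on the \<open>0\<close>-faces are total functions whose values elsewhere are never consulted.\<close>

definition weighted_inner ::
    "'v set set \<Rightarrow> ('v set \<Rightarrow> real) \<Rightarrow> ('v set \<Rightarrow> real) \<Rightarrow> ('v set \<Rightarrow> real) \<Rightarrow> real" where
  "weighted_inner X w f g = (\<Sum>v\<in>faces X 0. w v * f v * g v)"

text \<open>For a \<open>0\<close>-face \<open>v\<close> of an edge \<open>e\<close>, the set difference \<open>e - v\<close> is the other \<open>0\<close>-face of \<open>e\<close>.\<close>

definition adjacency ::
    "'v set set \<Rightarrow> ('v set \<Rightarrow> real) \<Rightarrow> ('v set \<Rightarrow> real) \<Rightarrow> 'v set \<Rightarrow> real" where
  "adjacency X w f v = (\<Sum>e | e \<in> faces X 1 \<and> v \<subseteq> e. w e / (2 * w v) * f (e - v))"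

definition part_faces :: "'v set set \<Rightarrow> (nat \<Rightarrow> 'v set) \<Rightarrow> nat \<Rightarrow> 'v set set" where
  "part_faces X V i = {x \<in> faces X 0. x \<subseteq> V i}"

definition part_span :: "nat \<Rightarrow> 'v set set \<Rightarrow> (nat \<Rightarrow> 'v set) \<Rightarrow> ('v set \<Rightarrow> real) set" where
  "part_span r X V =
     {(\<lambda>v. \<Sum>i\<le>r. c i * indicator (part_faces X V i) v) | c :: nat \<Rightarrow> real. True}"

definition C0_diamond ::
    "nat \<Rightarrow> 'v set set \<Rightarrow> (nat \<Rightarrow> 'v set) \<Rightarrow> ('v set \<Rightarrow> real) \<Rightarrow> ('v set \<Rightarrow> real) set" where
  "C0_diamond r X V w = {f. \<forall>g\<in>part_span r X V. weighted_inner X w f g = 0}"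

definition diamond_eigenvalue ::
    "nat \<Rightarrow> 'v set set \<Rightarrow> (nat \<Rightarrow> 'v set) \<Rightarrow> ('v set \<Rightarrow> real) \<Rightarrow> real \<Rightarrow> bool" where
  "diamond_eigenvalue r X V w k \<longleftrightarrow>
     (\<exists>f\<in>C0_diamond r X V w. (\<exists>v\<in>faces X 0. f v \<noteq> 0) \<and>
        (\<forall>v\<in>faces X 0. adjacency X w f v = k * f v))"

definition partite_expander ::
    "nat \<Rightarrow> 'v set set \<Rightarrow> (nat \<Rightarrow> 'v set) \<Rightarrow> ('v set \<Rightarrow> real) \<Rightarrow> real \<Rightarrow> real \<Rightarrow> bool" where
  "partite_expander r X V w mu lam \<longleftrightarrow>
     (\<forall>k. diamond_eigenvalue r X V w k \<longrightarrow> mu \<le> k \<and> k \<le> lam)"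


section \<open>Sums of subgroups and linear disjointness\<close>

text \<open>Abelian groups are commutative groups of \<open>HOL-Algebra\<close> and hence written multiplicatively:
  \<open>finprod\<close> is the sum over a finite index set, and \<open>\<one>\<close> is the zero element.\<close>

definition subgroup_sum :: "('a, 'b) monoid_scheme \<Rightarrow> 'i set \<Rightarrow> ('i \<Rightarrow> 'a set) \<Rightarrow> 'a set" where
  "subgroup_sum R I H =
     (\<lambda>a. finprod R a I) ` carrier (sum_group I (\<lambda>i. R\<lparr>carrier := H i\<rparr>))"

definition linearly_disjoint :: "('a, 'b) monoid_scheme \<Rightarrow> 'i set \<Rightarrow> ('i \<Rightarrow> 'a set) \<Rightarrow> bool" where
  "linearly_disjoint R I H \<longleftrightarrow>
     inj_on (\<lambda>a. finprod R a I) (carrier (sum_group I (\<lambda>i. R\<lparr>carrier := H i\<rparr>)))"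


section \<open>Sheaves\<close>

text \<open>\<open>res F y x\<close> is the restriction map from the group at \<open>x\<close> to the group at \<open>y\<close>.\<close>

record ('v, 'g) sheaf =
  stalk :: "'v set \<Rightarrow> 'g monoid"
  res :: "'v set \<Rightarrow> 'v set \<Rightarrow> 'g \<Rightarrow> 'g"

definition sheaf_on :: "'v set set \<Rightarrow> ('v, 'g) sheaf \<Rightarrow> bool" where
  "sheaf_on X F \<longleftrightarrow>
     (\<forall>x\<in>X. comm_group (stalk F x)) \<and>
     (\<forall>x\<in>X. \<forall>y\<in>X. x \<subset> y \<longrightarrow> res F y x \<in> hom (stalk F x) (stalk F y)) \<and>
     (\<forall>x\<in>X. \<forall>y\<in>X. \<forall>z\<in>X. x \<subset> y \<longrightarrow> y \<subset> z \<longrightarrow>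
        (\<forall>a\<in>carrier (stalk F x). res F z y (res F y x a) = res F z x a))"

definition subsheaf_on :: "'v set set \<Rightarrow> ('v, 'g) sheaf \<Rightarrow> ('v set \<Rightarrow> 'g set) \<Rightarrow> bool" where
  "subsheaf_on X F G \<longleftrightarrow>
     (\<forall>x\<in>X. subgroup (G x) (stalk F x)) \<and>
     (\<forall>x\<in>X. \<forall>y\<in>X. x \<subset> y \<longrightarrow> res F y x ` G x \<subseteq> G y)"

definition constant_sheaf :: "'a monoid \<Rightarrow> ('v, 'a) sheaf" where
  "constant_sheaf R = \<lparr>stalk = (\<lambda>_. R), res = (\<lambda>_ _ a. a)\<rparr>"

text \<open>Elements of the quotient are cosets. The induced restriction map sends the coset of \<open>a\<close>
  modulo \<open>G x\<close> to the coset of \<open>res F y x a\<close> modulo \<open>G y\<close>, which as a set is the product of \<open>G y\<close>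
  with the image of the first coset; see \<open>res_quotient_constant_sheaf\<close> below.\<close>

definition quotient_sheaf :: "('v, 'g) sheaf \<Rightarrow> ('v set \<Rightarrow> 'g set) \<Rightarrow> ('v, 'g set) sheaf" where
  "quotient_sheaf F G =
     \<lparr>stalk = (\<lambda>x. stalk F x Mod G x),
      res = (\<lambda>y x C. G y <#>\<^bsub>stalk F y\<^esub> (res F y x ` C))\<rparr>"

definition sum_subsheaf :: "'a monoid \<Rightarrow> ('v set \<Rightarrow> 'a set) \<Rightarrow> 'v set \<Rightarrow> 'a set" where
  "sum_subsheaf R H x = subgroup_sum R (Pow x) H"


section \<open>Coboundary expansion in dimension zero\<close>

definition cochains :: "'v set set \<Rightarrow> ('v, 'g) sheaf \<Rightarrow> int \<Rightarrow> ('v set \<Rightarrow> 'g) monoid" where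
  "cochains X F i = product_group (faces X i) (stalk F)"

definition larger_vertex :: "'v rel \<Rightarrow> 'v set \<Rightarrow> 'v" where
  "larger_vertex ord e = (THE u. u \<in> e \<and> (\<forall>v\<in>e. (v, u) \<in> ord))"

definition smaller_vertex :: "'v rel \<Rightarrow> 'v set \<Rightarrow> 'v" where
  "smaller_vertex ord e = (THE u. u \<in> e \<and> (\<forall>v\<in>e. (u, v) \<in> ord))"

definition coboundary_minus1 ::
    "'v set set \<Rightarrow> ('v, 'g) sheaf \<Rightarrow> ('v set \<Rightarrow> 'g) \<Rightarrow> 'v set \<Rightarrow> 'g" where
  "coboundary_minus1 X F f = (\<lambda>v\<in>faces X 0. res F v {} (f {}))"

definition coboundary_0 ::
    "'v rel \<Rightarrow> 'v set set \<Rightarrow> ('v, 'g) sheaf \<Rightarrow> ('v set \<Rightarrow> 'g) \<Rightarrow> 'v set \<Rightarrow> 'g" where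
  "coboundary_0 ord X F f =
     (\<lambda>e\<in>faces X 1.
        res F e {larger_vertex ord e} (f {larger_vertex ord e}) \<otimes>\<^bsub>stalk F e\<^esub>
        inv\<^bsub>stalk F e\<^esub> (res F e {smaller_vertex ord e} (f {smaller_vertex ord e})))"

definition coboundaries_0 :: "'v set set \<Rightarrow> ('v, 'g) sheaf \<Rightarrow> ('v set \<Rightarrow> 'g) set" where
  "coboundaries_0 X F = coboundary_minus1 X F ` carrier (cochains X F (-1))"

definition cochain_norm ::
    "'v set set \<Rightarrow> ('v set \<Rightarrow> real) \<Rightarrow> ('v, 'g) sheaf \<Rightarrow> int \<Rightarrow> ('v set \<Rightarrow> 'g) \<Rightarrow> real" where
  "cochain_norm X w F i f = sum w {x \<in> faces X i. f x \<noteq> \<one>\<^bsub>stalk F x\<^esub>}"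

text \<open>\<open>Min\<close> is applied to a finite set even if there are infinitely many coboundaries, because a norm
  is the weight of one of the finitely many sets of \<open>0\<close>-faces.\<close>

definition dist_B0 ::
    "'v set set \<Rightarrow> ('v set \<Rightarrow> real) \<Rightarrow> ('v, 'g) sheaf \<Rightarrow> ('v set \<Rightarrow> 'g) \<Rightarrow> real" where
  "dist_B0 X w F f =
     Min ((\<lambda>g. cochain_norm X w F 0 (f \<otimes>\<^bsub>cochains X F 0\<^esub> inv\<^bsub>cochains X F 0\<^esub> g))
            ` coboundaries_0 X F)"

text \<open>The supremum is infinite exactly when every \<open>0\<close>-cochain has distance zero, hence \<open>ereal\<close>.\<close>

definition cbe0 ::
    "'v rel \<Rightarrow> 'v set set \<Rightarrow> ('v set \<Rightarrow> real) \<Rightarrow> ('v, 'g) sheaf \<Rightarrow> ereal" where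
  "cbe0 ord X w F =
     (SUP c \<in> {c :: real. 0 \<le> c \<and>
        (\<forall>f\<in>carrier (cochains X F 0).
           cochain_norm X w F 1 (coboundary_0 ord X F f) \<ge> c * dist_B0 X w F f)}. ereal c)"


section \<open>Well-definedness\<close>

lemma sheaf_on_constant_sheaf: "comm_group R \<Longrightarrow> sheaf_on X (constant_sheaf R)"
  by (auto simp: sheaf_on_def constant_sheaf_def hom_def)

lemma res_quotient_constant_sheaf:
  assumes "comm_group R" and "subsheaf_on X (constant_sheaf R) G"
    and "x \<in> X" "y \<in> X" "x \<subset> y" and a: "a \<in> carrier R"
  shows "res (quotient_sheaf (constant_sheaf R) G) y x (G x #>\<^bsub>R\<^esub> a) = G y #>\<^bsub>R\<^esub> a"
proof -
  interpret comm_group R by fact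
  have sx: "subgroup (G x) R" and sy: "subgroup (G y) R" and le: "G x \<subseteq> G y"
    using assms by (auto simp: subsheaf_on_def constant_sheaf_def)
  have "G y <#>\<^bsub>R\<^esub> (G x #>\<^bsub>R\<^esub> a) = (G y <#>\<^bsub>R\<^esub> G x) #>\<^bsub>R\<^esub> a"
    using setmult_rcos_assoc[of "G y" "G x" a] sx sy a subgroup.subset by blast
  moreover have "G y <#>\<^bsub>R\<^esub> G x = G y"
  proof
    show "G y <#>\<^bsub>R\<^esub> G x \<subseteq> G y"
      using le subgroup.m_closed[OF sy] by (auto simp: set_mult_def)
    show "G y \<subseteq> G y <#>\<^bsub>R\<^esub> G x"
    proof
      fix b assume b: "b \<in> G y"
      then have "b = b \<otimes>\<^bsub>R\<^esub> \<one>\<^bsub>R\<^esub>"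
        using subgroup.mem_carrier[OF sy] by simp
      then show "b \<in> G y <#>\<^bsub>R\<^esub> G x"
        using b subgroup.one_closed[OF sx] unfolding set_mult_def by blast
    qed
  qed
  ultimately show ?thesis
    by (simp add: quotient_sheaf_def constant_sheaf_def)
qed

lemma sheaf_on_quotient_constant_sheaf:
  assumes R: "comm_group R" and G: "subsheaf_on X (constant_sheaf R) G"
  shows "sheaf_on X (quotient_sheaf (constant_sheaf R) G)"
proof -
  interpret comm_group R by fact
  let ?Q = "quotient_sheaf (constant_sheaf R) G"
  have stalk: "stalk ?Q x = R Mod G x" for x
    by (simp add: quotient_sheaf_def constant_sheaf_def)
  have sub: "subgroup (G x) R" if "x \<in> X" for x
    using G that by (auto simp: subsheaf_on_def constant_sheaf_def)
  have car: "carrier (R Mod G x) = {G x #>\<^bsub>R\<^esub> a | a. a \<in> carrier R}" for x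
    by (auto simp: FactGroup_def RCOSETS_def)
  have mult: "(G x #>\<^bsub>R\<^esub> a) \<otimes>\<^bsub>R Mod G x\<^esub> (G x #>\<^bsub>R\<^esub> b) = G x #>\<^bsub>R\<^esub> (a \<otimes>\<^bsub>R\<^esub> b)"
    if "x \<in> X" "a \<in> carrier R" "b \<in> carrier R" for x a b
    using normal.rcos_sum[OF subgroup_imp_normal[OF sub]] that by (simp add: FactGroup_def)
  note res = res_quotient_constant_sheaf[OF R G]
  show ?thesis
    unfolding sheaf_on_def stalk
  proof (intro conjI ballI impI)
    fix x assume "x \<in> X"
    then show "comm_group (R Mod G x)"
      by (rule abelian_FactGroup[OF sub])
  next
    fix x y assume xy: "x \<in> X" "y \<in> X" "x \<subset> y"
    show "res ?Q y x \<in> hom (R Mod G x) (R Mod G y)"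
    proof (rule homI)
      fix C assume "C \<in> carrier (R Mod G x)"
      then show "res ?Q y x C \<in> carrier (R Mod G y)"
        unfolding car using res[OF xy] by blast
    next
      fix C D assume "C \<in> carrier (R Mod G x)" "D \<in> carrier (R Mod G x)"
      then obtain a b where "a \<in> carrier R" "b \<in> carrier R"
        "C = G x #>\<^bsub>R\<^esub> a" "D = G x #>\<^bsub>R\<^esub> b"
        unfolding car by blast
      then show "res ?Q y x (C \<otimes>\<^bsub>R Mod G x\<^esub> D) =
          res ?Q y x C \<otimes>\<^bsub>R Mod G y\<^esub> res ?Q y x D"
        by (simp only: mult xy res m_closed)
    qed
  next
    fix x y z C
    assume *: "x \<in> X" "y \<in> X" "z \<in> X" "x \<subset> y" "y \<subset> z" and "C \<in> carrier (R Mod G x)"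
    then obtain a where a: "a \<in> carrier R" and C: "C = G x #>\<^bsub>R\<^esub> a"
      unfolding car by blast
    have "x \<subset> z" using * by blast
    then show "res ?Q z y (res ?Q y x C) = res ?Q z x C"
      unfolding C by (simp only: res * a)
  qed
qed

lemma carrier_sum_group_subgroups:
  assumes "group R" and "finite I" and "\<And>i. i \<in> I \<Longrightarrow> subgroup (H i) R"
  shows "carrier (sum_group I (\<lambda>i. R\<lparr>carrier := H i\<rparr>)) = Pi\<^sub>E I H"
  using assms by (subst carrier_sum_group) (auto intro: subgroup.subgroup_is_group)

lemma subgroup_subgroup_sum:
  assumes "comm_group R" and "finite I" and sub: "\<And>i. i \<in> I \<Longrightarrow> subgroup (H i) R"
  shows "subgroup (subgroup_sum R I H) R"
proof -
  interpret comm_group R by fact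
  have eq: "subgroup_sum R I H = (\<lambda>a. finprod R a I) ` Pi\<^sub>E I H"
    using assms by (simp add: subgroup_sum_def carrier_sum_group_subgroups)
  have car: "a \<in> I \<rightarrow> carrier R" if "a \<in> Pi\<^sub>E I H" for a
    using that sub subgroup.mem_carrier by fastforce
  show ?thesis
  proof (rule subgroupI)
    show "subgroup_sum R I H \<subseteq> carrier R"
      unfolding eq using car by auto
    have "(\<lambda>i\<in>I. \<one>\<^bsub>R\<^esub>) \<in> Pi\<^sub>E I H"
      using sub subgroup.one_closed by fastforce
    then show "subgroup_sum R I H \<noteq> {}"
      unfolding eq by blast
  next
    fix g assume "g \<in> subgroup_sum R I H"
    then obtain a where a: "a \<in> Pi\<^sub>E I H" and g: "g = finprod R a I"
      unfolding eq by blast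
    let ?b = "\<lambda>i\<in>I. inv\<^bsub>R\<^esub> (a i)"
    have b: "?b \<in> Pi\<^sub>E I H"
      using a sub subgroup.m_inv_closed by fastforce
    have "g \<otimes>\<^bsub>R\<^esub> finprod R ?b I = finprod R (\<lambda>i. a i \<otimes>\<^bsub>R\<^esub> ?b i) I"
      unfolding g using finprod_multf[OF car[OF a] car[OF b]] by simp
    also have "\<dots> = \<one>\<^bsub>R\<^esub>"
      using car[OF a] by (intro finprod_one_eqI) (auto simp: Pi_iff)
    finally have "inv\<^bsub>R\<^esub> g = finprod R ?b I"
      using finprod_closed[OF car[OF a]] finprod_closed[OF car[OF b]]
      unfolding g by (intro inv_equality) (simp_all add: m_comm)
    then show "inv\<^bsub>R\<^esub> g \<in> subgroup_sum R I H"
      unfolding eq using b by blast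
  next
    fix g h assume "g \<in> subgroup_sum R I H" "h \<in> subgroup_sum R I H"
    then obtain a b where a: "a \<in> Pi\<^sub>E I H" and b: "b \<in> Pi\<^sub>E I H"
      and gh: "g = finprod R a I" "h = finprod R b I"
      unfolding eq by blast
    let ?c = "\<lambda>i\<in>I. a i \<otimes>\<^bsub>R\<^esub> b i"
    have c: "?c \<in> Pi\<^sub>E I H"
      using a b sub subgroup.m_closed by fastforce
    have "g \<otimes>\<^bsub>R\<^esub> h = finprod R (\<lambda>i. a i \<otimes>\<^bsub>R\<^esub> b i) I"
      unfolding gh using finprod_multf[OF car[OF a] car[OF b]] by simp
    also have "\<dots> = finprod R ?c I"
      using car[OF a] car[OF b] by (intro finprod_cong') (auto simp: Pi_iff)
    finally show "g \<otimes>\<^bsub>R\<^esub> h \<in> subgroup_sum R I H"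
      unfolding eq using c by blast
  qed
qed

lemma subgroup_sum_mono:
  assumes "comm_group R" and J: "finite J" "I \<subseteq> J" and sub: "\<And>i. i \<in> J \<Longrightarrow> subgroup (H i) R"
  shows "subgroup_sum R I H \<subseteq> subgroup_sum R J H"
proof
  interpret comm_group R by fact
  have I: "finite I" using J finite_subset by blast
  have eq: "subgroup_sum R K H = (\<lambda>a. finprod R a K) ` Pi\<^sub>E K H" if "K \<subseteq> J" for K
    using that J finite_subset[OF that] sub
    by (simp add: subgroup_sum_def carrier_sum_group_subgroups subset_iff)
  fix g assume "g \<in> subgroup_sum R I H"
  then obtain a where a: "a \<in> Pi\<^sub>E I H" and g: "g = finprod R a I"
    unfolding eq[OF J(2)] by blast
  let ?b = "\<lambda>i\<in>J. if i \<in> I then a i else \<one>\<^bsub>R\<^esub>"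
  have b: "?b \<in> Pi\<^sub>E J H"
    using a sub subgroup.one_closed by fastforce
  have "finprod R a I = finprod R ?b J"
  proof (rule finprod_mono_neutral_cong_left[OF J])
    show "?b \<in> J \<rightarrow> carrier R"
      using b sub subgroup.mem_carrier by fastforce
  qed (use J in auto)
  then show "g \<in> subgroup_sum R J H"
    unfolding eq[OF order_refl] g using b by blast
qed

lemma subsheaf_on_sum_subsheaf:
  assumes "comm_group R" and X: "simplicial_complex X"
    and "\<And>x. x \<in> X \<Longrightarrow> subgroup (H x) R"
  shows "subsheaf_on X (constant_sheaf R) (sum_subsheaf R H)"
proof -
  have "finite x" "y \<in> X" if "x \<in> X" "y \<subseteq> x" for x y
    using X that by (auto simp: simplicial_complex_def)
  with assms have fin: "finite (Pow x)" and sub: "\<And>y. y \<in> Pow x \<Longrightarrow> subgroup (H y) R"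
    if "x \<in> X" for x
    using that by (metis finite_Pow_iff order_refl, metis PowD)
  have "subgroup (subgroup_sum R (Pow x) H) R" if "x \<in> X" for x
    using that assms(1) fin sub by (intro subgroup_subgroup_sum)
  moreover have "subgroup_sum R (Pow x) H \<subseteq> subgroup_sum R (Pow y) H"
    if "y \<in> X" "x \<subset> y" for x y
    using that assms(1) fin sub by (intro subgroup_sum_mono) auto
  ultimately show ?thesis
    by (simp add: subsheaf_on_def sum_subsheaf_def constant_sheaf_def)
qed

end

theory Submission
  imports Defs "HOL-Analysis.Function_Topology"
begin

text \<open>A \<open>0\<close>-cochain assigns to every vertex \<open>v\<close> a coset \<open>f v\<close> of \<open>R\<^sub>v\<close>. By condition (2), two vertices
  share at most one element, their colour. Along a cycle of edges on which the coboundary vanishes the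
  differences telescope, so if the cycle is short then condition (1) forces a colour common to all of
  its vertices. Choose among the edges with vanishing coboundary a set with the same monochromatic
  components but without monochromatic cycles. All of its cycles are longer than \<open>2 (n + 1) / 3\<close>, hence
  there is at most one, and its edges can be oriented such that every vertex is the head of at most one
  edge. The edges with vanishing coboundary thereby fall into blobs (monochromatic components, and
  single edges without a colour) that pairwise meet in at most one vertex and become disjoint after
  removal of a root from each.

  The upper spectral bound gives \<open>w(E(S)) \<le> p ((1 - L) p + L)\<close> for \<open>p = w(S)\<close> and
  \<open>L = max lam 0\<close>. If the monochromatic blobs are small, this bounds the weight of the edges with
  vanishing coboundary. If one of them has large weight \<open>p\<close>, then its colour is a constant
  cochain at distance at most \<open>1 - p\<close>; the edges leaving the blob have weight at least
  \<open>2 (1 - L) p (1 - p)\<close>, of which at most \<open>2 t (1 - p)\<close> have vanishing coboundary.\<close>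

section \<open>Cycles and orientations of graphs\<close>

text \<open>The obstacle is that overlapping blobs may have total weight above 1. The heads of the
  chosen edges inside a blob cover it up to the root, and they are never shared, so these parts have
  total weight at most 1. The price is the edges at the roots, each charged to its other end at rate
  \<open>t\<close>.

  The number two thirds arises as follows. A minimal edge set with two distinct cycles is a forest
  plus at most two edges, so it has at most \<open>n + 1\<close> edges. Two distinct cycles in it
  and a third one in their symmetric difference use every edge at most twice, so one of the three
  has length at most \<open>2 (n + 1) / 3\<close>. Cycles beyond this length may lack a common
  colour, but they do no harm to the orientation.

  The threshold \<open>p0\<close> between small and large blobs solves
  \<open>2 (1 - L) p0 - 2 t = c\<close>, which makes the large case yield the factor
  \<open>c\<close>. The small case then needs \<open>c + c / 2 + L + 2 t \<le> 1\<close>, that is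
  \<open>c \<le> 2 / 3 (1 - L) - 4 / 3 t\<close>, and the fraction in the theorem satisfies this
  whenever it is positive.\<close>

definition is_cycle :: "'v set set \<Rightarrow> nat \<Rightarrow> (nat \<Rightarrow> 'v) \<Rightarrow> bool" where
  "is_cycle E l c \<longleftrightarrow> 3 \<le> l \<and> inj_on c {..<l} \<and> (\<forall>i<l. {c i, c (Suc i mod l)} \<in> E)"

definition acyclic_edges :: "'v set set \<Rightarrow> bool" where
  "acyclic_edges E \<longleftrightarrow> \<not> (\<exists>l c. is_cycle E l c)"

text \<open>Rotations and reflections of \<open>c\<close> describe the same cycle; comparing edge
  sets identifies them.\<close>

definition cycle_edges :: "nat \<Rightarrow> (nat \<Rightarrow> 'v) \<Rightarrow> 'v set set" where
  "cycle_edges l c = (\<lambda>i. {c i, c (Suc i mod l)}) ` {..<l}"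

lemma is_cycle_mono: "is_cycle E l c \<Longrightarrow> E \<subseteq> F \<Longrightarrow> is_cycle F l c"
  unfolding is_cycle_def by blast

lemma is_cycle_iff_cycle_edges:
  "is_cycle E l c \<longleftrightarrow> 3 \<le> l \<and> inj_on c {..<l} \<and> cycle_edges l c \<subseteq> E"
  unfolding is_cycle_def cycle_edges_def by auto

lemma acyclic_edges_mono: "acyclic_edges F \<Longrightarrow> E \<subseteq> F \<Longrightarrow> acyclic_edges E"
  unfolding acyclic_edges_def using is_cycle_mono by blast

lemma Suc_mod_eq: "i < l \<Longrightarrow> Suc i mod l = (if Suc i = l then 0 else Suc i)"
  by auto

lemma bij_betw_Suc_mod: "0 < l \<Longrightarrow> bij_betw (\<lambda>i. Suc i mod l) {..<l} {..<l}"
proof -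
  assume l: "0 < l"
  have inj: "inj_on (\<lambda>i. Suc i mod l) {..<l}"
    by (auto simp: inj_on_def Suc_mod_eq split: if_splits)
  have "(\<lambda>i. Suc i mod l) ` {..<l} = {..<l}"
    by (rule endo_inj_surj[OF _ _ inj]) (use l in auto)
  with inj show ?thesis by (simp add: bij_betw_def)
qed

text \<open>A walk that starts at \<open>u\<close> and turns back at most at \<open>u\<close> must repeat a vertex; up to the first
  repetition it turns nowhere back, so it closes a cycle.\<close>

lemma exists_cycle:
  assumes fin: "finite E" and two: "\<And>e. e \<in> E \<Longrightarrow> card e = 2" and u: "u \<in> \<Union>E"
    and deg: "\<And>x e. x \<in> e \<Longrightarrow> e \<in> E \<Longrightarrow> x \<noteq> u \<Longrightarrow> \<exists>e'\<in>E. x \<in> e' \<and> e' \<noteq> e"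
  shows "\<exists>l c. is_cycle E l c"
proof -
  have edge: "\<exists>y. e = {x, y} \<and> y \<noteq> x" if "e \<in> E" "x \<in> e" for e x
    using two[OF that(1)] that(2) by (auto simp: card_2_iff)
  have finV: "finite (\<Union>E)"
    using fin two by (metis card.infinite finite_Union zero_neq_numeral)
  \<comment> \<open>A state is a directed edge, so the rule against turning back involves just two
    consecutive states.\<close>
  define st where "st = (\<lambda>p q :: 'a \<times> 'a. snd p = fst q \<and> {fst q, snd q} \<in> E
      \<and> (fst q \<noteq> u \<longrightarrow> snd q \<noteq> fst p))"
  have step: "\<exists>q. {fst q, snd q} \<in> E \<and> st p q" if p: "{fst p, snd p} \<in> E" for p
  proof -
    let ?x = "snd p" and ?e = "{fst p, snd p}"
    show ?thesis
    proof (cases "?x = u")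
      case True
      then show ?thesis
        using p by (intro exI[of _ "(snd p, fst p)"]) (simp add: st_def insert_commute)
    next
      case False
      then obtain e' where e': "e' \<in> E" "?x \<in> e'" "e' \<noteq> ?e"
        using deg[of ?x ?e] p by blast
      then obtain y where "e' = {?x, y}" using edge by blast
      with e' have "y \<noteq> fst p" by auto
      with \<open>e' = {?x, y}\<close> e' show ?thesis
        by (intro exI[of _ "(?x, y)"]) (simp add: st_def)
    qed
  qed
  obtain e0 x1 where e0: "{u, x1} \<in> E" using u edge by blast
  have "\<exists>q. \<forall>k. {fst (q k), snd (q k)} \<in> E \<and> (k = 0 \<longrightarrow> q k = (u, x1)) \<and> st (q k) (q (Suc k))"
  proof -
    have "\<exists>q. \<forall>k. ({fst (q k), snd (q k)} \<in> E \<and> (k = 0 \<longrightarrow> q k = (u, x1))) \<and> st (q k) (q (Suc k))"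
      by (rule dependent_nat_choice) (use e0 step in auto)
    then show ?thesis by blast
  qed
  then obtain q where q: "\<And>k. {fst (q k), snd (q k)} \<in> E" "q 0 = (u, x1)" "\<And>k. st (q k) (q (Suc k))"
    by blast
  define v where "v = (\<lambda>k. fst (q k))"
  have sq: "snd (q k) = v (Suc k)" for k using q(3)[of k] by (simp add: st_def v_def)
  have vE: "{v k, v (Suc k)} \<in> E" for k using q(1)[of k] sq[of k] by (simp add: v_def)
  have v0: "v 0 = u" by (simp add: v_def q)
  have nb: "v (Suc (Suc k)) \<noteq> v k" if "v (Suc k) \<noteq> u" for k
    using q(3)[of k] that sq[of "Suc k"] by (simp add: st_def v_def)
  have neq: "v (Suc k) \<noteq> v k" for k using two[OF vE[of k]] by (auto simp: card_2_iff)
  have "\<not> inj v"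
  proof
    assume "inj v"
    then have "infinite (range v)" using range_inj_infinite by blast
    moreover have "range v \<subseteq> \<Union>E" using vE by blast
    ultimately show False using finV finite_subset by blast
  qed
  then have ex: "\<exists>j. \<exists>i<j. v i = v j"
    unfolding inj_def by (metis linorder_neqE_nat)
  define j where "j = (LEAST j. \<exists>i<j. v i = v j)"
  obtain i where i: "i < j" "v i = v j" using LeastI_ex[OF ex] unfolding j_def by blast
  have dist: "v a \<noteq> v b" if "a < b" "b < j" for a b
    using not_less_Least[of b "\<lambda>j. \<exists>i<j. v i = v j"] that unfolding j_def by blast
  have "j \<noteq> Suc i" using neq[of i] i by auto
  \<comment> \<open>A repetition at distance two would mean turning back at
    \<open>v (Suc i)\<close>. This is allowed only at \<open>u = v 0\<close>, which does not recur
    before the first repetition.\<close>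
  moreover have "j \<noteq> Suc (Suc i)"
  proof
    assume j: "j = Suc (Suc i)"
    then have "v (Suc i) \<noteq> u" using dist[of 0 "Suc i"] v0 by simp
    then show False using nb[of i] i j by simp
  qed
  ultimately have l: "3 \<le> j - i" using i(1) by linarith
  have "is_cycle E (j - i) (\<lambda>k. v (i + k))"
    unfolding is_cycle_def
  proof (intro conjI allI impI l)
    show "inj_on (\<lambda>k. v (i + k)) {..<j - i}"
    proof (rule inj_onI)
      fix a b assume *: "a \<in> {..<j - i}" "b \<in> {..<j - i}" "v (i + a) = v (i + b)"
      show "a = b"
        using dist[of "i + a" "i + b"] dist[of "i + b" "i + a"] * by (cases a b rule: linorder_cases) (auto simp: less_diff_conv add.commute)
    qed
    fix k assume k: "k < j - i"
    show "{v (i + k), v (i + Suc k mod (j - i))} \<in> E"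
    proof (cases "Suc k = j - i")
      case True
      then have "v (i + Suc k mod (j - i)) = v (Suc (i + k))" using i
        by (metis True add_Suc_right le_add_diff_inverse less_imp_le mod_self add_0_right)
      then show ?thesis using vE by simp
    next
      case False
      then show ?thesis using vE[of "i + k"] k by simp
    qed
  qed
  then show ?thesis by blast
qed

section \<open>Injective choices of heads for forests\<close>

lemma inj_on_fun_upd_Diff:
  assumes "inj_on f (A - {a})" and "\<And>b. b \<in> A - {a} \<Longrightarrow> f b \<noteq> y"
  shows "inj_on (f(a := y)) A"
proof (rule inj_onI)
  fix b c assume *: "b \<in> A" "c \<in> A" "(f(a := y)) b = (f(a := y)) c"
  show "b = c"
  proof (cases "b = a \<or> c = a")
    case True
    then show ?thesis using * assms(2)[of b] assms(2)[of c] by (auto split: if_splits)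
  next
    case False
    then show ?thesis using * inj_onD[OF assms(1), of b c] by simp
  qed
qed

text \<open>Root the tree of \<open>u\<close> at \<open>u\<close> and orient all edges away from the
  roots. The induction removes an edge at a leaf other than \<open>u\<close> and makes the leaf its
  head. The free choice of \<open>u\<close> later leaves a head for one additional edge.\<close>

lemma acyclic_orientation:
  assumes "finite E" and "\<And>e. e \<in> E \<Longrightarrow> card e = 2" and "acyclic_edges E"
  shows "\<exists>\<phi>. inj_on \<phi> E \<and> (\<forall>e\<in>E. \<phi> e \<in> e \<and> \<phi> e \<noteq> u)"
  using assms
proof (induction "card E" arbitrary: E)
  case 0
  then show ?case by simp
next
  case (Suc k)
  have ne: "\<Union>E \<noteq> {}"
    using Suc.hyps(2) Suc.prems(2) by (metis Union_empty_conv card.empty card_0_eq Suc.prems(1) nat.distinct(1) zero_neq_numeral ex_in_conv)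
  \<comment> \<open>\<open>exists_cycle\<close> needs an exceptional vertex that lies on an edge. If
    \<open>u\<close> lies on none, any vertex serves, and the leaf differs from \<open>u\<close>
    anyway.\<close>
  define u' where "u' = (if u \<in> \<Union>E then u else (SOME x. x \<in> \<Union>E))"
  have u': "u' \<in> \<Union>E" unfolding u'_def using ne by (metis some_in_eq)
  obtain x e where x: "x \<in> e" "e \<in> E" "x \<noteq> u'" "\<And>e'. e' \<in> E \<Longrightarrow> x \<in> e' \<Longrightarrow> e' = e"
  proof -
    have "\<exists>x e. x \<in> e \<and> e \<in> E \<and> x \<noteq> u' \<and> (\<forall>e'\<in>E. x \<in> e' \<longrightarrow> e' = e)"
    proof (rule ccontr)
      assume "\<not> ?thesis"
      then have "\<exists>e'\<in>E. x \<in> e' \<and> e' \<noteq> e" if "x \<in> e" "e \<in> E" "x \<noteq> u'" for x e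
        using that by metis
      then have "\<exists>l c. is_cycle E l c"
        by (intro exists_cycle[OF Suc.prems(1,2) u'])
      then show False using Suc.prems(3) unfolding acyclic_edges_def by simp
    qed
    then show thesis using that by blast
  qed
  have xu: "x \<noteq> u" using x unfolding u'_def by (auto split: if_splits)
  have "k = card (E - {e})" using Suc.hyps(2) x(2) Suc.prems(1) by simp
  moreover have "acyclic_edges (E - {e})"
    using Suc.prems(3) by (rule acyclic_edges_mono) blast
  ultimately obtain \<phi> where
    \<phi>: "inj_on \<phi> (E - {e})" "\<forall>e\<in>E - {e}. \<phi> e \<in> e \<and> \<phi> e \<noteq> u"
    using Suc.hyps(1)[of "E - {e}"] Suc.prems(1,2) by (metis DiffD1 finite_Diff)
  have "inj_on (\<phi>(e := x)) E"
    by (rule inj_on_fun_upd_Diff[OF \<phi>(1)]) (use \<phi>(2) x(4) in blast)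
  then show ?case using \<phi>(2) x(1) xu by (intro exI[of _ "\<phi>(e := x)"]) auto
qed

text \<open>The heads of the edges are distinct vertices other than the root
  \<open>u\<close>.\<close>

lemma card_acyclic_edges:
  assumes "finite E" and "\<And>e. e \<in> E \<Longrightarrow> card e = 2" and "acyclic_edges E" and "\<Union>E \<subseteq> W" "finite W" "W \<noteq> {}"
  shows "card E < card W"
proof -
  obtain u where u: "u \<in> W" using assms by blast
  obtain \<phi> where \<phi>: "inj_on \<phi> E" "\<forall>e\<in>E. \<phi> e \<in> e \<and> \<phi> e \<noteq> u"
    using acyclic_orientation[OF assms(1-3)] by blast
  have "\<phi> ` E \<subseteq> W - {u}" using \<phi>(2) assms(4) by auto
  then have "card E \<le> card (W - {u})" using \<phi>(1) assms(5) by (metis card_image card_mono finite_Diff)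
  also have "\<dots> < card W" using u assms(5) by (meson card_Diff1_less)
  finally show ?thesis .
qed

section \<open>Edge sets of cycles and their symmetric differences\<close>

lemma inj_on_cycle_edges:
  assumes "3 \<le> l" "inj_on c {..<l}"
  shows "inj_on (\<lambda>i. {c i, c (Suc i mod l)}) {..<l}"
proof (rule inj_onI)
  fix i j assume ij: "i \<in> {..<l}" "j \<in> {..<l}" and eq: "{c i, c (Suc i mod l)} = {c j, c (Suc j mod l)}"
  have m: "Suc i mod l \<in> {..<l}" "Suc j mod l \<in> {..<l}" using assms by auto
  consider "c i = c j" | "c i = c (Suc j mod l)" "c (Suc i mod l) = c j"
    using eq by (auto simp: doubleton_eq_iff)
  then show "i = j"
  proof cases
    case 1 then show ?thesis using assms(2) ij by (simp add: inj_on_eq_iff)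
  next
    case 2
    \<comment> \<open>An edge traversed in both directions would give \<open>i = i + 2\<close>
      modulo \<open>l\<close>, impossible for \<open>l \<ge> 3\<close>.\<close>
    then have "i = Suc j mod l" "Suc i mod l = j"
      using inj_onD[OF assms(2) _ ij(1) m(2)] inj_onD[OF assms(2) _ m(1) ij(2)] by auto
    then show ?thesis using assms(1) ij by (auto simp: Suc_mod_eq split: if_splits)
  qed
qed

lemma card_cycle_edges: "3 \<le> l \<Longrightarrow> inj_on c {..<l} \<Longrightarrow> card (cycle_edges l c) = l"
  unfolding cycle_edges_def by (simp add: card_image inj_on_cycle_edges)

text \<open>Every vertex has degree 0 or 2. Only the parity is recorded, because parity survives
  symmetric differences.\<close>

lemma cycle_edges_degree:
  assumes "3 \<le> l" "inj_on c {..<l}"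
  shows "even (card {e \<in> cycle_edges l c. x \<in> e})"
proof (cases "x \<in> c ` {..<l}")
  case False
  then have "{e \<in> cycle_edges l c. x \<in> e} = {}"
    using assms unfolding cycle_edges_def by auto
  then show ?thesis by (simp only: card.empty even_zero)
next
  case True
  then obtain i where i: "i < l" "x = c i" by auto
  obtain j where j: "j < l" "Suc j mod l = i"
  proof -
    have "i \<in> (\<lambda>i. Suc i mod l) ` {..<l}"
      using bij_betw_imp_surj_on[OF bij_betw_Suc_mod[of l]] i by simp
    then show thesis using that by auto
  qed
  let ?e = "\<lambda>i. {c i, c (Suc i mod l)}"
  have ji: "j \<noteq> i" using j assms(1) i by (auto simp: Suc_mod_eq split: if_splits)
  have "x \<in> ?e k \<longleftrightarrow> k = i \<or> k = j" if k: "k < l" for k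
  proof -
    have m: "Suc k mod l < l" using assms by simp
    have "x \<in> ?e k \<longleftrightarrow> i = k \<or> i = Suc k mod l"
      using inj_on_eq_iff[OF assms(2), of i k] inj_on_eq_iff[OF assms(2), of i "Suc k mod l"] i k m by simp
    also have "i = Suc k mod l \<longleftrightarrow> k = j"
      using inj_on_eq_iff[OF bij_betw_imp_inj_on[OF bij_betw_Suc_mod[of l]], of k j] j k by auto
    finally show ?thesis by auto
  qed
  then have "{e \<in> cycle_edges l c. x \<in> e} = ?e ` {i, j}"
    using i j unfolding cycle_edges_def by auto
  moreover have "card (?e ` {i, j}) = card {i, j}"
    using inj_on_cycle_edges[OF assms] i j by (intro card_image inj_on_subset[OF inj_on_cycle_edges[OF assms]]) auto
  ultimately show ?thesis using ji by simp
qed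

lemma even_card_sym_diff:
  assumes "finite A" "finite B" "even (card A)" "even (card B)"
  shows "even (card (sym_diff A B))"
proof -
  have "card (sym_diff A B) + card (A \<inter> B) + card (A \<inter> B) = card A + card B"
    using assms(1,2) card_Un_disjoint[of "A - B" "B - A"] card_Int_Diff[of A B] card_Int_Diff[of B A]
    by (auto simp: Int_commute)
  then show ?thesis using assms(3,4) by presburger
qed

text \<open>Two distinct cycles and a cycle in their symmetric difference cover every edge of their
  union at most twice.\<close>

lemma short_cycle_of_two_cycles:
  assumes fin: "finite E" and two: "\<And>e. e \<in> E \<Longrightarrow> card e = 2"
    and c: "is_cycle E l c" "is_cycle E m d" "cycle_edges l c \<noteq> cycle_edges m d"
  shows "\<exists>k b. is_cycle E k b \<and> 3 * k \<le> 2 * card E"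
proof -
  let ?C = "cycle_edges l c" and ?D = "cycle_edges m d"
  have CD: "?C \<subseteq> E" "?D \<subseteq> E" and lm: "3 \<le> l" "inj_on c {..<l}" "3 \<le> m" "inj_on d {..<m}"
    using c by (auto simp: is_cycle_iff_cycle_edges)
  have f: "finite ?C" "finite ?D" using CD fin finite_subset by auto
  let ?S = "sym_diff ?C ?D"
  have SE: "?S \<subseteq> E" using CD by blast
  have "?S \<noteq> {}" using c(3) by blast
  then obtain e where e: "e \<in> ?S" by blast
  then obtain u where u: "u \<in> \<Union>?S" using two SE
    by (metis UnionI card.empty ex_in_conv subsetD zero_neq_numeral)
  \<comment> \<open>All degrees in the symmetric difference are even, so no vertex has degree
    1.\<close>
  have deg: "\<exists>e'\<in>?S. x \<in> e' \<and> e' \<noteq> e" if "x \<in> e" "e \<in> ?S" for x e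
  proof (rule ccontr)
    assume "\<not> ?thesis"
    then have "{e \<in> ?S. x \<in> e} = {e}" using that by blast
    also have "{e \<in> ?S. x \<in> e} = sym_diff {e \<in> ?C. x \<in> e} {e \<in> ?D. x \<in> e}" by blast
    finally have "card (sym_diff {e \<in> ?C. x \<in> e} {e \<in> ?D. x \<in> e}) = 1"
      by (metis is_singletonI is_singleton_altdef)
    then show False
      using even_card_sym_diff[of "{e \<in> ?C. x \<in> e}" "{e \<in> ?D. x \<in> e}"] f
        cycle_edges_degree[OF lm(1,2), of x] cycle_edges_degree[OF lm(3,4), of x] by simp
  qed
  have "\<exists>k b. is_cycle ?S k b"
    by (rule exists_cycle[OF finite_subset[OF SE fin] _ u]) (use two SE deg in auto)
  then obtain k b where kb: "is_cycle ?S k b" by blast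
  then have bS: "cycle_edges k b \<subseteq> ?S" and k: "card (cycle_edges k b) = k"
    using card_cycle_edges by (auto simp: is_cycle_iff_cycle_edges)
  have "k \<le> card ?S" using k card_mono[OF finite_subset[OF SE fin] bS] by simp
  moreover have "card ?S + card (?C \<inter> ?D) + card (?C \<inter> ?D) = card ?C + card ?D"
    using f card_Un_disjoint[of "?C - ?D" "?D - ?C"] card_Int_Diff[of ?C ?D] card_Int_Diff[of ?D ?C]
    by (auto simp: Int_commute)
  moreover have "card (?C \<union> ?D) + card (?C \<inter> ?D) = card ?C + card ?D"
    using card_Un_Int[OF f] by simp
  moreover have "card (?C \<union> ?D) \<le> card E" using CD fin by (intro card_mono) auto
  ultimately have "l + m + k \<le> 2 * card E"
    using card_cycle_edges[OF lm(1,2)] card_cycle_edges[OF lm(3,4)] by linarith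
  then consider "3 * l \<le> 2 * card E" | "3 * m \<le> 2 * card E" | "3 * k \<le> 2 * card E" by linarith
  then show ?thesis
    using c(1,2) is_cycle_mono[OF kb SE] by cases (intro exI conjI, assumption, assumption)+
qed

text \<open>The bound \<open>long\<close> excludes two distinct cycles. If there is one cycle,
  deleting one of its edges at \<open>c 0\<close> leaves a forest, which is oriented with
  \<open>c 0\<close> as a root; then \<open>c 0\<close> is free to be the head of the deleted
  edge.\<close>

lemma orientation_without_short_cycles:
  assumes fin: "finite E" and two: "\<And>e. e \<in> E \<Longrightarrow> card e = 2"
    and W: "\<Union>E \<subseteq> W" "finite W"
    and long: "\<And>l c. is_cycle E l c \<Longrightarrow> 2 * (card W + 1) < 3 * l"
  shows "\<exists>\<phi>. inj_on \<phi> E \<and> (\<forall>e\<in>E. \<phi> e \<in> e)"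
proof (cases "acyclic_edges E")
  case True
  then show ?thesis using acyclic_orientation[OF fin two] by blast
next
  case False
  then obtain l c where lc: "is_cycle E l c" unfolding acyclic_edges_def by blast
  have l: "3 \<le> l" "0 < l" using lc by (auto simp: is_cycle_def)
  have Wne: "W \<noteq> {}" using lc l W(1) unfolding is_cycle_def by blast
  define P where "P = (\<lambda>F. F \<subseteq> E \<and>
    (\<exists>l c m d. is_cycle F l c \<and> is_cycle F m d \<and> cycle_edges l c \<noteq> cycle_edges m d))"
  have unique: "\<not> P E"
  proof
    assume "P E"
    define F where "F = (ARG_MIN card F. P F)"
    have F: "P F" and min: "\<And>H. P H \<Longrightarrow> card F \<le> card H"
      using arg_min_nat_lemma[of P E card] \<open>P E\<close> unfolding F_def by auto
    from F obtain l c m d where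
      cd: "is_cycle F l c" "is_cycle F m d" "cycle_edges l c \<noteq> cycle_edges m d" and FE: "F \<subseteq> E"
      unfolding P_def by blast
    have finF: "finite F" using FE fin finite_subset by blast
    \<comment> \<open>After a possible exchange of the two cycles, some edge \<open>e\<close> of the
      first is not on the second.\<close>
    have "\<exists>l c m d. is_cycle F l c \<and> is_cycle F m d \<and> \<not> cycle_edges l c \<subseteq> cycle_edges m d"
      using cd by (metis subset_antisym)
    then obtain l c m d e where
      cd: "is_cycle F l c" "is_cycle F m d" "e \<in> cycle_edges l c" "e \<notin> cycle_edges m d" by blast
    obtain e' where e': "e' \<in> cycle_edges m d"
    proof -
      have "0 \<in> {..<m}" using cd(2) unfolding is_cycle_def by simp
      then show thesis using that unfolding cycle_edges_def by blast
    qed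
    have eF: "e \<in> F" using cd by (auto simp: is_cycle_iff_cycle_edges)
    have e'F: "e' \<in> F" using cd e' by (auto simp: is_cycle_iff_cycle_edges)
    have d': "is_cycle (F - {e}) m d" using cd by (auto simp: is_cycle_iff_cycle_edges)
    \<comment> \<open>Without \<open>e\<close> the second cycle survives and, by minimality of
      \<open>F\<close>, is the only one; without \<open>e'\<close> it is gone as well.\<close>
    have "acyclic_edges (F - {e} - {e'})"
      unfolding acyclic_edges_def
    proof
      assume "\<exists>l c. is_cycle (F - {e} - {e'}) l c"
      then obtain k b where kb: "is_cycle (F - {e} - {e'}) k b" by blast
      have "cycle_edges k b \<noteq> cycle_edges m d" using kb e' by (auto simp: is_cycle_iff_cycle_edges)
      moreover have "is_cycle (F - {e}) k b" using kb is_cycle_mono by blast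
      ultimately have "P (F - {e})" unfolding P_def using d' FE by blast
      then have "card F \<le> card (F - {e})" by (rule min)
      then show False using card_Diff1_less[OF finF eF] by linarith
    qed
    then have "card (F - {e} - {e'}) < card W"
      using finF two FE W Wne by (intro card_acyclic_edges) auto
    moreover have "card F \<le> card (F - {e} - {e'}) + 2"
      using card_Diff_singleton_if[of F e] card_Diff_singleton_if[of "F - {e}" e'] by auto
    ultimately have cF: "card F \<le> card W + 1" by linarith
    obtain k b where "is_cycle F k b" "3 * k \<le> 2 * card F"
      using short_cycle_of_two_cycles[OF finF _ \<open>is_cycle F l c\<close> cd(2)] two FE cd(3,4) by blast
    then show False using long[OF is_cycle_mono[OF _ FE]] cF by fastforce
  qed
  let ?e = "{c 0, c (Suc 0 mod l)}"
  have eE: "?e \<in> E" using lc l unfolding is_cycle_def by blast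
  have "?e \<in> cycle_edges l c" using l unfolding cycle_edges_def by blast
  then have "acyclic_edges (E - {?e})"
    using unique lc unfolding P_def acyclic_edges_def
    by (metis DiffD2 Diff_subset is_cycle_iff_cycle_edges is_cycle_mono singletonI subset_iff)
  then obtain \<phi> where \<phi>: "inj_on \<phi> (E - {?e})" "\<forall>e\<in>E - {?e}. \<phi> e \<in> e \<and> \<phi> e \<noteq> c 0"
    using acyclic_orientation[of "E - {?e}" "c 0"] fin two by auto
  have "inj_on (\<phi>(?e := c 0)) E"
    by (rule inj_on_fun_upd_Diff[OF \<phi>(1)]) (use \<phi>(2) in blast)
  moreover have "(\<phi>(?e := c 0)) e \<in> e" if "e \<in> E" for e
    using \<phi>(2) that by (cases "e = ?e") auto
  ultimately show ?thesis by blast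
qed

section \<open>Linear disjointness along a cycle\<close>

lemma (in comm_group) finprod_inv_multf:
  assumes "finite I" "x \<in> I \<rightarrow> carrier G" "y \<in> I \<rightarrow> carrier G"
  shows "finprod G (\<lambda>i. x i \<otimes> inv y i) I = finprod G x I \<otimes> inv finprod G y I"
proof -
  have "finprod G (\<lambda>i. x i \<otimes> inv y i) I \<otimes> finprod G y I = finprod G (\<lambda>i. (x i \<otimes> inv y i) \<otimes> y i) I"
    using assms by (subst finprod_multf) (auto simp: Pi_iff)
  also have "\<dots> = finprod G x I"
    using assms by (intro finprod_cong') (auto simp: Pi_iff m_assoc)
  finally have "finprod G x I = finprod G (\<lambda>i. x i \<otimes> inv y i) I \<otimes> finprod G y I" ..
  moreover have "finprod G x I \<in> carrier G" "finprod G y I \<in> carrier G"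
    "finprod G (\<lambda>i. x i \<otimes> inv y i) I \<in> carrier G"
    using assms by (auto intro!: finprod_closed simp: Pi_iff)
  ultimately show ?thesis
    using inv_solve_right by blast
qed

lemma is_cycle_complex_iso:
  assumes l: "3 \<le> l" and c: "inj_on c {..<l}"
  defines "Y \<equiv> {{}} \<union> (\<lambda>i. {c i}) ` {..<l} \<union> cycle_edges l c"
  shows "complex_iso (cycle_graph l) Y"
proof -
  have m: "Suc i mod l < l" for i using l by simp
  have U: "\<Union>(cycle_graph l) = {..<l}"
    using m unfolding cycle_graph_def by auto
  have U': "\<Union>Y = c ` {..<l}"
    using m unfolding Y_def cycle_edges_def by auto
  have "Y = (\<lambda>x. c ` x) ` cycle_graph l"
  proof -
    have "cycle_graph l = {{}} \<union> (\<lambda>i. {i}) ` {..<l} \<union> (\<lambda>i. {i, Suc i mod l}) ` {..<l}"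
      unfolding cycle_graph_def by auto
    then show ?thesis
      unfolding Y_def cycle_edges_def by (simp add: image_Un image_image)
  qed
  then show ?thesis
    unfolding complex_iso_def U U' using c by (auto simp: bij_betw_def intro!: exI[of _ c])
qed

text \<open>Translates a cyclic vertex sequence into the subcomplex to which the linear disjointness
  hypothesis applies.\<close>

lemma cycle_in_of_is_cycle:
  assumes X: "simplicial_complex X" and cyc: "is_cycle (faces X 1) l c"
  shows "cycle_in X l ({{}} \<union> (\<lambda>i. {c i}) ` {..<l} \<union> cycle_edges l c)" (is "cycle_in X l ?Y")
proof -
  have l: "3 \<le> l" and c: "inj_on c {..<l}" and E: "cycle_edges l c \<subseteq> faces X 1"
    using cyc by (auto simp: is_cycle_iff_cycle_edges)
  have m: "Suc i mod l < l" for i using l by simp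
  have EX: "{c i, c (Suc i mod l)} \<in> X" if "i < l" for i
    using that E unfolding cycle_edges_def faces_def by blast
  have sub: "y \<in> X" if "x \<in> X" "y \<subseteq> x" for x y
    using X that by (auto simp: simplicial_complex_def)
  have vX: "{c i} \<in> X" if "i < l" for i
    using sub[OF EX[OF that]] by simp
  then have eX: "{} \<in> X" using sub[of "{c 0}" "{}"] l by simp
  have YX: "?Y \<subseteq> X" using EX vX eX unfolding cycle_edges_def by auto
  have closed: "z \<in> ?Y" if "y \<in> ?Y" "z \<subseteq> y" for y z
  proof -
    consider "y = {}" | i where "i < l" "y = {c i}" | i where "i < l" "y = {c i, c (Suc i mod l)}"
      using \<open>y \<in> ?Y\<close> unfolding cycle_edges_def by blast
    then show ?thesis
    proof cases
      case 3
      then have "z = {} \<or> z = {c i} \<or> z = {c (Suc i mod l)} \<or> z = y" using \<open>z \<subseteq> y\<close> by blast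
      then show ?thesis using 3 m that(1) by auto
    qed (use that in auto)
  qed
  have dim: "simplex_dim y \<le> 1" if "y \<in> ?Y" for y
    using that unfolding cycle_edges_def simplex_dim_def by (auto simp: card_insert_if)
  have "simplicial_complex ?Y"
    using X YX closed unfolding simplicial_complex_def
    by (intro conjI ballI allI impI) (auto simp: cycle_edges_def)
  then have "subgraph X ?Y"
    unfolding subgraph_def using YX dim by blast
  then show ?thesis
    unfolding cycle_in_def using l is_cycle_complex_iso[OF l c] by simp
qed

text \<open>The product of all \<open>x i \<otimes> inv y i\<close> and all \<open>y i \<otimes> inv x (i + 1)\<close> telescopes around the cycle,
  so linear disjointness makes each of these factors trivial.\<close>

lemma cycle_common_element:
  assumes R: "comm_group R" and l: "3 \<le> l" and c: "inj_on c {..<l}"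
    and disj: "linearly_disjoint R ({{}} \<union> (\<lambda>i. {c i}) ` {..<l} \<union> cycle_edges l c) H"
    and sub: "\<And>z. z \<in> {{}} \<union> (\<lambda>i. {c i}) ` {..<l} \<union> cycle_edges l c \<Longrightarrow> subgroup (H z) R"
    and x: "\<And>i. i < l \<Longrightarrow> x i \<in> carrier R" and y: "\<And>i. i < l \<Longrightarrow> y i \<in> carrier R"
    and edge: "\<And>i. i < l \<Longrightarrow> x i \<otimes>\<^bsub>R\<^esub> inv\<^bsub>R\<^esub> y i \<in> H {c i, c (Suc i mod l)}"
    and vert: "\<And>i. i < l \<Longrightarrow> y i \<otimes>\<^bsub>R\<^esub> inv\<^bsub>R\<^esub> x (Suc i mod l) \<in> H {c (Suc i mod l)}"
    and i: "i < l"
  shows "x i = x 0"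
proof -
  interpret comm_group R by fact
  let ?I = "{..<l}" and ?s = "\<lambda>i. Suc i mod l"
  \<comment> \<open>The vertices are indexed with a shift, since the \<open>i\<close>-th vertex
    factor belongs to the far end of the \<open>i\<close>-th edge.\<close>
  let ?V = "(\<lambda>i. {c (?s i)}) ` ?I" and ?E = "cycle_edges l c"
  let ?e = "\<lambda>i. {c i, c (?s i)}" and ?v = "\<lambda>i. {c (?s i)}"
  have s: "bij_betw ?s ?I ?I" using bij_betw_Suc_mod l by simp
  then have sI: "?s ` ?I = ?I" by (rule bij_betw_imp_surj_on)
  have m: "?s i < l" for i using l by simp
  have V: "(\<lambda>i. {c i}) ` ?I = ?V"
    using sI by (metis (no_types, lifting) image_cong image_image)
  have injv: "inj_on ?v ?I"
    using s c m unfolding bij_betw_def inj_on_def by (metis lessThan_iff singleton_inject)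
  have inje: "inj_on ?e ?I" by (rule inj_on_cycle_edges[OF l c])
  let ?Y = "insert {} (?V \<union> ?E)"
  have Y: "{{}} \<union> (\<lambda>i. {c i}) ` {..<l} \<union> ?E = ?Y" unfolding V by simp
  have cardE: "card (?e i) = 2" if "i < l" for i
    using inj_on_eq_iff[OF c, of i "?s i"] that m l by (auto simp: Suc_mod_eq split: if_splits)
  then have VE: "?V \<inter> ?E = {}"
    unfolding cycle_edges_def by fastforce
  have neV: "{} \<notin> ?V \<union> ?E" unfolding cycle_edges_def by blast
  have fin: "finite ?V" "finite ?E" unfolding cycle_edges_def by auto
  define gv where "gv = (\<lambda>z. let i = the_inv_into ?I ?v z in y i \<otimes>\<^bsub>R\<^esub> inv\<^bsub>R\<^esub> x (?s i))"
  define ge where "ge = (\<lambda>z. let i = the_inv_into ?I ?e z in x i \<otimes>\<^bsub>R\<^esub> inv\<^bsub>R\<^esub> y i)"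
  have gv: "gv (?v i) = y i \<otimes>\<^bsub>R\<^esub> inv\<^bsub>R\<^esub> x (?s i)" if "i < l" for i
    using the_inv_into_f_f[OF injv] that unfolding gv_def by simp
  have ge: "ge (?e i) = x i \<otimes>\<^bsub>R\<^esub> inv\<^bsub>R\<^esub> y i" if "i < l" for i
    using the_inv_into_f_f[OF inje] that unfolding ge_def by simp
  \<comment> \<open>The family of all factors, indexed by the faces of the cycle; the empty face
    receives the neutral element.\<close>
  define g where "g = (\<lambda>z\<in>?Y. if z = {} then \<one>\<^bsub>R\<^esub> else if z \<in> ?V then gv z else ge z)"
  have gV: "g (?v i) = y i \<otimes>\<^bsub>R\<^esub> inv\<^bsub>R\<^esub> x (?s i)" if "i < l" for i
    using gv[OF that] that unfolding g_def by auto
  have gE: "g (?e i) = x i \<otimes>\<^bsub>R\<^esub> inv\<^bsub>R\<^esub> y i" if "i < l" for i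
  proof -
    have "?e i \<in> ?E" using that unfolding cycle_edges_def by blast
    then show ?thesis using VE ge[OF that] unfolding g_def by auto
  qed
  have car: "carrier (sum_group ?Y (\<lambda>i. R\<lparr>carrier := H i\<rparr>)) = Pi\<^sub>E ?Y H"
    using fin sub unfolding Y by (intro carrier_sum_group_subgroups) (auto intro: is_group)
  have inj: "inj_on (\<lambda>a. finprod R a ?Y) (Pi\<^sub>E ?Y H)"
    using disj unfolding Y linearly_disjoint_def car .
  have one: "(\<lambda>z\<in>?Y. \<one>\<^bsub>R\<^esub>) \<in> Pi\<^sub>E ?Y H"
    using sub unfolding Y by (auto simp: PiE_iff subgroup.one_closed)
  have gH: "g z \<in> H z" if "z \<in> ?Y" for z
  proof -
    consider "z = {}" | i where "i < l" "z = ?v i" | i where "i < l" "z = ?e i"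
      using \<open>z \<in> ?Y\<close> unfolding cycle_edges_def by blast
    then show ?thesis
    proof cases
      case 1
      then show ?thesis using subgroup.one_closed[OF sub[of "{}"]] unfolding g_def by simp
    next
      case 2
      then show ?thesis using gV vert by simp
    next
      case 3
      then show ?thesis using gE edge by simp
    qed
  qed
  moreover have "g \<in> extensional ?Y" unfolding g_def by simp
  ultimately have gPi: "g \<in> Pi\<^sub>E ?Y H" unfolding PiE_iff by blast
  have gc: "g \<in> ?Y \<rightarrow> carrier R"
  proof
    fix z assume "z \<in> ?Y"
    then show "g z \<in> carrier R"
      using subgroup.mem_carrier[OF sub[unfolded Y]] gH by simp
  qed
  have "finprod R g ?Y = g {} \<otimes>\<^bsub>R\<^esub> finprod R g (?V \<union> ?E)"
    using fin neV gc by (intro finprod_insert) (auto simp: Pi_iff)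
  also have "g {} = \<one>\<^bsub>R\<^esub>" unfolding g_def by simp
  also have "finprod R g (?V \<union> ?E) = finprod R g ?V \<otimes>\<^bsub>R\<^esub> finprod R g ?E"
    using fin VE gc by (intro finprod_Un_disjoint) (auto simp: Pi_iff)
  also have "finprod R g ?V = finprod R (\<lambda>i. g (?v i)) ?I"
    using gc injv by (intro finprod_reindex) (auto simp: Pi_iff)
  also have "\<dots> = finprod R (\<lambda>i. y i \<otimes>\<^bsub>R\<^esub> inv\<^bsub>R\<^esub> x (?s i)) ?I"
    using gV x y m by (intro finprod_cong') auto
  also have "\<dots> = finprod R y ?I \<otimes>\<^bsub>R\<^esub> inv\<^bsub>R\<^esub> finprod R (\<lambda>i. x (?s i)) ?I"
    using x y m by (intro finprod_inv_multf) auto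
  \<comment> \<open>The shift permutes the indices; this is where closing up of the cycle
    enters.\<close>
  also have "finprod R (\<lambda>i. x (?s i)) ?I = finprod R x (?s ` ?I)"
    using x m s by (intro finprod_reindex[symmetric]) (auto simp: bij_betw_def)
  also have "\<dots> = finprod R x ?I" unfolding sI ..
  also have "finprod R g ?E = finprod R (\<lambda>i. g (?e i)) ?I"
    unfolding cycle_edges_def using gc inje by (intro finprod_reindex) (auto simp: Pi_iff cycle_edges_def)
  also have "\<dots> = finprod R (\<lambda>i. x i \<otimes>\<^bsub>R\<^esub> inv\<^bsub>R\<^esub> y i) ?I"
    using gE x y by (intro finprod_cong') auto
  also have "\<dots> = finprod R x ?I \<otimes>\<^bsub>R\<^esub> inv\<^bsub>R\<^esub> finprod R y ?I"
    using x y by (intro finprod_inv_multf) auto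
  finally have "finprod R g ?Y = \<one>\<^bsub>R\<^esub> \<otimes>\<^bsub>R\<^esub> (finprod R y ?I \<otimes>\<^bsub>R\<^esub> inv\<^bsub>R\<^esub> finprod R x ?I
      \<otimes>\<^bsub>R\<^esub> (finprod R x ?I \<otimes>\<^bsub>R\<^esub> inv\<^bsub>R\<^esub> finprod R y ?I))" .
  moreover have "finprod R x ?I \<in> carrier R" "finprod R y ?I \<in> carrier R"
    using x y by (auto intro: finprod_closed)
  ultimately have "finprod R g ?Y = \<one>\<^bsub>R\<^esub>"
    by (simp add: m_assoc inv_solve_left' r_inv l_inv flip: m_assoc)
      (simp add: m_assoc l_inv r_inv)
  also have "\<dots> = finprod R (\<lambda>z\<in>?Y. \<one>\<^bsub>R\<^esub>) ?Y"
    by (rule finprod_one_eqI[symmetric]) simp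
  finally have g1: "g = (\<lambda>z\<in>?Y. \<one>\<^bsub>R\<^esub>)"
    using inj_onD[OF inj _ gPi one] by simp
  have "x k = y k" if "k < l" for k
  proof -
    have "?e k \<in> ?Y" using that unfolding cycle_edges_def by blast
    then have "x k \<otimes>\<^bsub>R\<^esub> inv\<^bsub>R\<^esub> y k = \<one>\<^bsub>R\<^esub>" using gE[OF that] g1 by simp
    then show ?thesis using x y that by (metis inv_closed inv_equality inv_inv)
  qed
  moreover have "y k = x (?s k)" if "k < l" for k
  proof -
    have "?v k \<in> ?Y" using that by blast
    then have "y k \<otimes>\<^bsub>R\<^esub> inv\<^bsub>R\<^esub> x (?s k) = \<one>\<^bsub>R\<^esub>" using gV[OF that] g1 by simp
    then show ?thesis using x[OF m] y that by (metis inv_closed inv_equality inv_inv)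
  qed
  ultimately have step: "x (?s k) = x k" if "k < l" for k using that by metis
  show ?thesis
    using i
  proof (induction i)
    case (Suc i)
    then show ?case using step[of i] by simp
  qed simp
qed

text \<open>The pairs of \<open>a\<close> with its inverse and of \<open>\<one>\<close> with
  \<open>\<one>\<close> have the same product.\<close>

lemma linearly_disjoint_pair:
  assumes R: "comm_group R" and sub: "subgroup (H i) R" "subgroup (H j) R" and "i \<noteq> j"
    and disj: "linearly_disjoint R {i, j} H"
    and a: "a \<in> H i" "a \<in> H j"
  shows "a = \<one>\<^bsub>R\<^esub>"
proof -
  interpret comm_group R by fact
  let ?Y = "{i, j}"
  have car: "carrier (sum_group ?Y (\<lambda>i. R\<lparr>carrier := H i\<rparr>)) = Pi\<^sub>E ?Y H"
    using sub by (intro carrier_sum_group_subgroups) (auto intro: is_group)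
  have inj: "inj_on (\<lambda>a. finprod R a ?Y) (Pi\<^sub>E ?Y H)"
    using disj unfolding linearly_disjoint_def car .
  let ?p = "\<lambda>z\<in>?Y. if z = i then a else inv\<^bsub>R\<^esub> a" and ?q = "\<lambda>z\<in>?Y. \<one>\<^bsub>R\<^esub>"
  have aR: "a \<in> carrier R" by (rule subgroup.mem_carrier[OF sub(1) a(1)])
  have p: "?p \<in> Pi\<^sub>E ?Y H" 
    using a \<open>i \<noteq> j\<close> subgroup.m_inv_closed[OF sub(2) a(2)] by (auto simp: PiE_iff)
  have q: "?q \<in> Pi\<^sub>E ?Y H" 
    using subgroup.one_closed[OF sub(1)] subgroup.one_closed[OF sub(2)] by (auto simp: PiE_iff)
  have "finprod R ?p ?Y = ?p i \<otimes>\<^bsub>R\<^esub> finprod R ?p {j}"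
    using aR \<open>i \<noteq> j\<close> by (intro finprod_insert) (auto simp: Pi_iff)
  also have "finprod R ?p {j} = ?p j"
    using aR \<open>i \<noteq> j\<close> finprod_insert[of "{}" j ?p] by (simp add: Pi_iff)
  finally have "finprod R ?p ?Y = \<one>\<^bsub>R\<^esub>" using aR \<open>i \<noteq> j\<close> by (simp add: r_inv)
  also have "\<dots> = finprod R ?q ?Y" by (rule finprod_one_eqI[symmetric]) simp
  finally have "?p = ?q" using inj_onD[OF inj _ p q] by simp
  from fun_cong[OF this, of i] show ?thesis by simp
qed

section \<open>The spectral bound\<close>

lemma faces_0_eq: "faces X 0 = {{v} | v. {v} \<in> X}"
proof -
  have "simplex_dim x = 0 \<longleftrightarrow> (\<exists>v. x = {v})" for x :: "'a set"
    unfolding simplex_dim_def using card_1_singleton_iff[of x] by auto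
  then show ?thesis unfolding faces_def by auto
qed

lemma faces_1_eq: "faces X 1 = {e \<in> X. card e = 2}"
  unfolding faces_def simplex_dim_def by auto

context partite_weighted_complex
begin

definition verts :: "'v set" where "verts = \<Union>X"

text \<open>Extending by 0 to all ordered pairs turns sums over edges into double sums over
  vertices.\<close>

definition edge_weight :: "'v \<Rightarrow> 'v \<Rightarrow> real" where
  "edge_weight u v = (if {u, v} \<in> faces X 1 then w {u, v} else 0)"

definition inner :: "('v \<Rightarrow> real) \<Rightarrow> ('v \<Rightarrow> real) \<Rightarrow> real" where
  "inner f g = (\<Sum>v\<in>verts. w {v} * (f v * g v))"

text \<open>The bilinear form of the adjacency operator; the factor one half compensates for the two
  orderings of each edge.\<close>

definition edge_form :: "('v \<Rightarrow> real) \<Rightarrow> ('v \<Rightarrow> real) \<Rightarrow> real" where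
  "edge_form f g = (\<Sum>v\<in>verts. \<Sum>u\<in>verts. edge_weight u v * (f u * g v)) / 2"

definition adj :: "('v \<Rightarrow> real) \<Rightarrow> 'v \<Rightarrow> real" where
  "adj f v = (\<Sum>u\<in>verts. edge_weight u v * f u) / (2 * w {v})"

text \<open>The space \<open>C0_diamond\<close>, written for functions on vertices: orthogonality to
  the span is tested on the part indicators.\<close>

definition balanced :: "('v \<Rightarrow> real) set" where
  "balanced = {f. \<forall>i\<le>r. (\<Sum>v\<in>V i. w {v} * f v) = 0}"

lemma finite_X: "finite X" and finite_face: "x \<in> X \<Longrightarrow> finite x"
  and face_subset: "x \<in> X \<Longrightarrow> y \<subseteq> x \<Longrightarrow> y \<in> X"
  using complex by (auto simp: simplicial_complex_def)

lemma finite_verts: "finite verts"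
  unfolding verts_def using finite_X finite_face by auto

lemma finite_faces: "finite (faces X i)"
  using finite_X unfolding faces_def by simp

lemma singleton_face: "v \<in> verts \<Longrightarrow> {v} \<in> X"
  unfolding verts_def using face_subset by blast

lemma faces_0_verts: "faces X 0 = (\<lambda>v. {v}) ` verts"
  unfolding faces_0_eq using singleton_face by (auto simp: verts_def)

lemma weight_pos: "v \<in> verts \<Longrightarrow> 0 < w {v}"
  using weight_vertex_pos faces_0_verts by blast

lemma part_subset: "i \<le> r \<Longrightarrow> V i \<subseteq> verts"
  using parts_cover unfolding verts_def by blast

lemma finite_part: "i \<le> r \<Longrightarrow> finite (V i)"
  using part_subset finite_verts finite_subset by blast

lemma sum_parts: "(\<Sum>v\<in>verts. f v) = (\<Sum>i\<le>r. \<Sum>v\<in>V i. f v)" for f :: "'v \<Rightarrow> real"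
proof -
  have "verts = (\<Union>i\<le>r. V i)" unfolding verts_def parts_cover ..
  then show ?thesis
    using finite_part parts_disjoint
    by (simp add: disjoint_family_on_def sum.UNION_disjoint)
qed

section \<open>Weights of the parts and of the edges between parts\<close>

lemma card_top: "y \<in> faces X (int r) \<Longrightarrow> card y = r + 1"
  unfolding faces_def simplex_dim_def by auto

lemma top_subset: "y \<in> faces X (int r) \<Longrightarrow> y \<subseteq> verts"
  unfolding faces_def verts_def by blast

text \<open>The \<open>r + 1\<close> vertices of \<open>y\<close> are distributed over
  \<open>r + 1\<close> parts with at most one in each.\<close>

lemma card_top_part:
  assumes y: "y \<in> faces X (int r)" and i: "i \<le> r"
  shows "card (y \<inter> V i) = 1"
proof -
  have yX: "y \<in> X" using y by (simp add: faces_def)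
  have "y = (\<Union>i\<le>r. y \<inter> V i)"
    using top_subset[OF y] parts_cover unfolding verts_def by blast
  then have "card y = card (\<Union>i\<le>r. y \<inter> V i)" by simp
  also have "\<dots> = (\<Sum>i\<le>r. card (y \<inter> V i))"
    using finite_face[OF yX] parts_disjoint
    by (intro card_UN_disjoint) (auto simp: disjoint_family_on_def)
  finally have sum: "(\<Sum>i\<le>r. card (y \<inter> V i)) = r + 1" using card_top[OF y] by simp
  have le: "card (y \<inter> V j) \<le> 1" if "j \<le> r" for j using partite[OF yX that] .
  show ?thesis
  proof (rule ccontr)
    assume "card (y \<inter> V i) \<noteq> 1"
    then have "card (y \<inter> V i) < 1" using le[OF i] by simp
    then have "(\<Sum>i\<le>r. card (y \<inter> V i)) < (\<Sum>i\<le>r. 1)"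
      using le i by (intro sum_strict_mono_ex1) auto
    then show False using sum by simp
  qed
qed

text \<open>In dimension \<open>r\<close> the only top face above \<open>x\<close> is
  \<open>x\<close>, and the binomial coefficient is 1.\<close>

lemma weight_eq:
  assumes x: "x \<in> X"
  shows "w x = inverse (real ((r + 1) choose (card x))) * (\<Sum>y | y \<in> faces X (int r) \<and> x \<subseteq> y. w y)"
proof (cases "simplex_dim x < int r")
  case True
  then show ?thesis using weight_lower[OF x] by simp
next
  case False
  obtain y where y: "y \<in> faces X (int r)" "x \<subseteq> y" using pure[OF x] by blast
  have yX: "y \<in> X" using y by (simp add: faces_def)
  have "card x \<ge> r + 1" using False by (simp add: simplex_dim_def)
  then have xy: "x = z" if "z \<in> faces X (int r)" "x \<subseteq> z" for z
    using that card_top finite_face by (intro card_seteq) (auto simp: faces_def)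
  then have "{y. y \<in> faces X (int r) \<and> x \<subseteq> y} = {x}" using y by auto
  moreover have "card x = r + 1" using xy[OF y] card_top[OF y(1)] by simp
  ultimately show ?thesis by simp
qed

text \<open>Double counting: every top face has exactly one vertex in \<open>V i\<close>.\<close>

lemma sum_weight_part: assumes i: "i \<le> r" shows "(\<Sum>v\<in>V i. w {v}) = 1 / (real r + 1)"
proof -
  let ?T = "faces X (int r)"
  have "(\<Sum>v\<in>V i. w {v}) = (\<Sum>v\<in>V i. inverse (real r + 1) * (\<Sum>y\<in>?T. if v \<in> y then w y else 0))"
  proof (rule sum.cong[OF refl])
    fix v assume "v \<in> V i"
    then have "{v} \<in> X" using part_subset[OF i] singleton_face by blast
    then show "w {v} = inverse (real r + 1) * (\<Sum>y\<in>?T. if v \<in> y then w y else 0)"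
      using weight_eq[of "{v}"] finite_faces
      by (simp add: sum.inter_filter add.commute)
  qed
  also have "\<dots> = inverse (real r + 1) * (\<Sum>y\<in>?T. \<Sum>v\<in>V i. if v \<in> y then w y else 0)"
    by (simp add: sum_distrib_left[symmetric] sum.swap[of _ ?T])
  also have "(\<Sum>y\<in>?T. \<Sum>v\<in>V i. if v \<in> y then w y else 0) = (\<Sum>y\<in>?T. w y)"
  proof (rule sum.cong[OF refl])
    fix y assume y: "y \<in> ?T"
    have "(\<Sum>v\<in>V i. if v \<in> y then w y else 0) = (\<Sum>v\<in>V i \<inter> y. w y)"
      using finite_part[OF i] by (simp add: sum.If_cases Int_def)
    then show "(\<Sum>v\<in>V i. if v \<in> y then w y else 0) = w y"
      using card_top_part[OF y i] by (simp add: Int_commute)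
  qed
  finally show ?thesis using weight_top by (simp add: field_simps)
qed

lemma edge_weight_commute: "edge_weight u v = edge_weight v u"
  unfolding edge_weight_def by (simp add: insert_commute)

lemma edge_weight_eq:
  assumes "u \<noteq> v"
  shows "edge_weight u v = inverse (real ((r + 1) choose 2))
    * (\<Sum>y\<in>faces X (int r). if v \<in> y \<and> u \<in> y then w y else 0)"
proof (cases "{u, v} \<in> X")
  case True
  moreover have "card {u, v} = 2" using assms by simp
  ultimately show ?thesis
    using weight_eq[of "{u, v}"] finite_faces
    by (simp add: edge_weight_def faces_1_eq sum.inter_filter conj_commute)
next
  case False
  then have "\<not> (v \<in> y \<and> u \<in> y)" if "y \<in> faces X (int r)" for y
    using face_subset[of y "{u, v}"] that by (auto simp: faces_def)
  then have "(\<Sum>y\<in>faces X (int r). if v \<in> y \<and> u \<in> y then w y else 0) = 0"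
    by (intro sum.neutral ballI) meson
  then show ?thesis using False by (simp add: edge_weight_def faces_1_eq)
qed

text \<open>Every top face through \<open>v\<close> has exactly one vertex in \<open>V i\<close>, so
  the edge weight at \<open>v\<close> is spread evenly over the other \<open>r\<close> parts. This
  makes the action of \<open>adj\<close> on functions constant on parts explicit.\<close>

lemma sum_edge_weight_part:
  assumes i: "i \<le> r" and v: "v \<in> verts" and r: "r \<ge> 1"
  shows "(\<Sum>u\<in>V i. edge_weight u v) = (if v \<in> V i then 0 else 2 * w {v} / real r)"
proof (cases "v \<in> V i")
  case True
  have "edge_weight u v = 0" if u: "u \<in> V i" for u
  proof -
    have "{u, v} \<notin> faces X 1"
    proof
      assume "{u, v} \<in> faces X 1"
      then have uv: "{u, v} \<in> X" "card {u, v} = 2" by (auto simp: faces_1_eq)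
      have "{u, v} \<inter> V i = {u, v}" using u True by blast
      then show False using partite[OF uv(1) i] uv(2) by simp
    qed
    then show ?thesis by (simp add: edge_weight_def)
  qed
  then show ?thesis using True by simp
next
  case False
  let ?T = "faces X (int r)"
  let ?c = "inverse (real ((r + 1) choose 2))"
  have "(\<Sum>u\<in>V i. edge_weight u v) = (\<Sum>u\<in>V i. ?c * (\<Sum>y\<in>?T. if v \<in> y \<and> u \<in> y then w y else 0))"
    by (rule sum.cong[OF refl], rule edge_weight_eq) (use False in auto)
  also have "\<dots> = ?c * (\<Sum>y\<in>?T. \<Sum>u\<in>V i. if v \<in> y \<and> u \<in> y then w y else 0)"
    by (simp add: sum_distrib_left[symmetric] sum.swap[of _ ?T])
  also have "(\<Sum>y\<in>?T. \<Sum>u\<in>V i. if v \<in> y \<and> u \<in> y then w y else 0) = (\<Sum>y\<in>?T. if v \<in> y then w y else 0)"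
  proof (rule sum.cong[OF refl])
    fix y assume y: "y \<in> ?T"
    show "(\<Sum>u\<in>V i. if v \<in> y \<and> u \<in> y then w y else 0) = (if v \<in> y then w y else 0)"
    proof (cases "v \<in> y")
      case True
      have "(\<Sum>u\<in>V i. if v \<in> y \<and> u \<in> y then w y else 0) = (\<Sum>u\<in>V i \<inter> y. w y)"
        using finite_part[OF i] True by (simp add: sum.If_cases Int_def)
      then show ?thesis
        using card_top_part[OF y i] True by (simp add: Int_commute)
    qed simp
  qed
  also have "(\<Sum>y\<in>?T. if v \<in> y then w y else 0) = (real r + 1) * w {v}"
    using weight_eq[OF singleton_face[OF v]] finite_faces
    by (simp add: sum.inter_filter add.commute field_simps)
  also have "real ((r + 1) choose 2) = (real r + 1) * real r / 2"
  proof -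
    have "2 * ((r + 1) choose 2) = (r + 1) * r"
      by (simp add: choose_two)
    then have "2 * real ((r + 1) choose 2) = real ((r + 1) * r)"
      by (metis of_nat_mult of_nat_numeral)
    then show ?thesis by (simp add: algebra_simps)
  qed
  also have "inverse ((real r + 1) * real r / 2) * ((real r + 1) * w {v}) = 2 * w {v} / real r"
  proof -
    have "inverse (a * real r / 2) * (a * w {v}) = 2 * w {v} / real r" if "a \<noteq> 0" for a
      using that r by (simp add: field_simps)
    then show ?thesis by simp
  qed
  finally show ?thesis using False by simp
qed

lemma part_index: "v \<in> verts \<Longrightarrow> \<exists>i\<le>r. v \<in> V i"
  using parts_cover unfolding verts_def by blast

lemma part_unique: "v \<in> V i \<Longrightarrow> v \<in> V j \<Longrightarrow> i \<le> r \<Longrightarrow> j \<le> r \<Longrightarrow> i = j"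
  using parts_disjoint unfolding disjoint_family_on_def by blast

lemma sum_weight: "(\<Sum>v\<in>verts. w {v}) = 1"
  by (simp add: sum_parts sum_weight_part field_simps)

lemma sum_edge_weight:
  assumes v: "v \<in> verts" and r: "r \<ge> 1"
  shows "(\<Sum>u\<in>verts. edge_weight u v) = 2 * w {v}"
proof -
  obtain j where j: "j \<le> r" "v \<in> V j" using part_index[OF v] by blast
  have "(\<Sum>u\<in>verts. edge_weight u v) = (\<Sum>i\<le>r. if v \<in> V i then 0 else 2 * w {v} / real r)"
    unfolding sum_parts by (intro sum.cong refl sum_edge_weight_part v r) simp
  also have "\<dots> = (\<Sum>i\<le>r. if i = j then 0 else 2 * w {v} / real r)"
  proof (rule sum.cong[OF refl])
    fix i assume "i \<in> {..r}"
    then have "v \<in> V i \<longleftrightarrow> i = j" using part_unique[of v i j] j by auto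
    then show "(if v \<in> V i then 0 else 2 * w {v} / real r) = (if i = j then 0 else 2 * w {v} / real r)"
      by simp
  qed
  also have "\<dots> = (\<Sum>i\<in>{..r} - {j}. 2 * w {v} / real r)"
    by (rule sum.mono_neutral_cong_right) auto
  finally show ?thesis using j r by simp
qed

section \<open>The two bilinear forms and the adjacency operator\<close>

lemma inner_commute: "inner f g = inner g f"
  unfolding inner_def by (simp add: mult.commute)

lemma inner_linear: "inner (\<lambda>v. a * f v + b * g v) h = a * inner f h + b * inner g h"
  unfolding inner_def by (simp add: sum.distrib sum_distrib_left algebra_simps)

lemma inner_linear_right: "inner h (\<lambda>v. a * f v + b * g v) = a * inner h f + b * inner h g"
  using inner_linear[of a f b g h] by (simp add: inner_commute)

lemma inner_nonneg: "0 \<le> inner f f"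
  unfolding inner_def using weight_pos by (intro sum_nonneg) (auto simp: less_imp_le)

lemma inner_eq_0: "inner f f = 0 \<longleftrightarrow> (\<forall>v\<in>verts. f v = 0)"
proof -
  have "0 \<le> w {v} * (f v * f v)" if "v \<in> verts" for v
    using weight_pos[OF that] by simp
  then show ?thesis
    unfolding inner_def using finite_verts weight_pos
    by (subst sum_nonneg_eq_0_iff) fastforce+
qed

lemma edge_form_linear:
  "edge_form (\<lambda>v. a * f v + b * g v) h = a * edge_form f h + b * edge_form g h"
  unfolding edge_form_def by (simp add: sum.distrib sum_distrib_left algebra_simps add_divide_distrib)

lemma edge_form_commute: "edge_form f g = edge_form g f"
  unfolding edge_form_def using sum.swap[of "\<lambda>v u. edge_weight u v * (f u * g v)" verts verts]
  by (simp add: mult.commute edge_weight_commute)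

lemma edge_form_linear_right:
  "edge_form h (\<lambda>v. a * f v + b * g v) = a * edge_form h f + b * edge_form h g"
  using edge_form_linear[of a f b g h] by (simp add: edge_form_commute)

lemma inner_adj: "inner (adj f) g = edge_form f g"
  unfolding inner_def edge_form_def
proof (subst sum_divide_distrib, rule sum.cong[OF refl])
  fix v assume "v \<in> verts"
  then have "w {v} \<noteq> 0" using weight_pos by fastforce
  then have "w {v} * (adj f v * g v) = (\<Sum>u\<in>verts. edge_weight u v * f u) * g v / 2"
    by (simp add: adj_def)
  then show "w {v} * (adj f v * g v) = (\<Sum>u\<in>verts. edge_weight u v * (f u * g v)) / 2"
    by (simp add: sum_distrib_right mult.assoc)
qed

text \<open>The edge weight from \<open>u\<close> into \<open>V i\<close> is the same multiple of
  \<open>w {u}\<close> for all \<open>u\<close> outside of \<open>V i\<close>, so the sum of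
  \<open>adj f\<close> over \<open>V i\<close> is a combination of part sums of
  \<open>f\<close>.\<close>

lemma adj_balanced:
  assumes r: "r \<ge> 1" and f: "f \<in> balanced"
  shows "adj f \<in> balanced"
  unfolding balanced_def mem_Collect_eq
proof (intro allI impI)
  fix i assume i: "i \<le> r"
  have z: "(\<Sum>v\<in>V j. w {v} * f v) = 0" if "j \<le> r" for j using f that by (simp add: balanced_def)
  have "(\<Sum>v\<in>V i. w {v} * adj f v) = (\<Sum>v\<in>V i. (\<Sum>u\<in>verts. edge_weight u v * f u) / 2)"
  proof (rule sum.cong[OF refl])
    fix v assume "v \<in> V i"
    then have "w {v} \<noteq> 0" using weight_pos part_subset[OF i] by fastforce
    then show "w {v} * adj f v = (\<Sum>u\<in>verts. edge_weight u v * f u) / 2"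
      by (simp add: adj_def)
  qed
  also have "\<dots> = (\<Sum>u\<in>verts. (\<Sum>v\<in>V i. edge_weight v u) * f u / 2)"
    by (simp add: sum_divide_distrib sum_distrib_right sum.swap[of _ verts] edge_weight_commute)
  also have "\<dots> = (\<Sum>u\<in>verts. (if u \<in> V i then 0 else w {u} * f u / real r))"
    using sum_edge_weight_part[OF i _ r] by (intro sum.cong) auto
  also have "\<dots> = (\<Sum>j\<le>r. \<Sum>u\<in>V j. (if u \<in> V i then 0 else w {u} * f u / real r))"
    by (rule sum_parts)
  also have "\<dots> = 0"
  proof (rule sum.neutral, rule ballI)
    fix j assume j: "j \<in> {..r}"
    show "(\<Sum>u\<in>V j. (if u \<in> V i then 0 else w {u} * f u / real r)) = 0"
    proof (cases "j = i")
      case False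
      have "(\<Sum>u\<in>V j. (if u \<in> V i then 0 else w {u} * f u / real r))
          = (\<Sum>u\<in>V j. w {u} * f u) / real r"
        unfolding sum_divide_distrib
      proof (rule sum.cong[OF refl])
        fix u assume "u \<in> V j"
        then have "u \<notin> V i" using part_unique[of u i j] i j False by auto
        then show "(if u \<in> V i then 0 else w {u} * f u / real r) = w {u} * f u / real r" by simp
      qed
      then show ?thesis using z j by simp
    qed simp
  qed
  finally show "(\<Sum>v\<in>V i. w {v} * adj f v) = 0" .
qed

lemma balanced_linear:
  assumes "f \<in> balanced" "g \<in> balanced"
  shows "(\<lambda>v. a * f v + b * g v) \<in> balanced"
proof -
  have "(\<Sum>v\<in>V i. w {v} * (a * f v + b * g v)) = a * (\<Sum>v\<in>V i. w {v} * f v) + b * (\<Sum>v\<in>V i. w {v} * g v)" for i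
    by (simp add: sum.distrib sum_distrib_left algebra_simps)
  then show ?thesis using assms unfolding balanced_def by simp
qed

lemma balanced_cong: "(\<And>v. v \<in> verts \<Longrightarrow> f v = g v) \<Longrightarrow> f \<in> balanced \<longleftrightarrow> g \<in> balanced"
  unfolding balanced_def using part_subset by (auto intro!: all_cong1 imp_cong simp: subset_iff cong: sum.cong)

lemma edge_form_cong:
  "(\<And>v. v \<in> verts \<Longrightarrow> f v = g v) \<Longrightarrow> (\<And>v. v \<in> verts \<Longrightarrow> f' v = g' v) \<Longrightarrow> edge_form f f' = edge_form g g'"
  unfolding edge_form_def by (auto intro!: sum.cong)

lemma inner_cong:
  "(\<And>v. v \<in> verts \<Longrightarrow> f v = g v) \<Longrightarrow> (\<And>v. v \<in> verts \<Longrightarrow> f' v = g' v) \<Longrightarrow> inner f f' = inner g g'"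
  unfolding inner_def by (auto intro!: sum.cong)

text \<open>Fixing the value 0 outside of \<open>verts\<close> makes the sphere a closed subset of a
  product of compact intervals, so Tychonoff applies even if the type \<open>'v\<close> is
  infinite.\<close>

lemma compact_unit_sphere:
  "compact {f \<in> balanced. (\<forall>v. v \<notin> verts \<longrightarrow> f v = 0) \<and> inner f f = 1}" (is "compact ?K")
proof -
  define I where "I = (\<lambda>v. if v \<in> verts then {- (1 / sqrt (w {v}))..1 / sqrt (w {v})} else {0})"
  have "compact (I v)" for v unfolding I_def by simp
  then have "compactin (product_topology (\<lambda>_. euclidean) UNIV) (PiE UNIV I)"
    unfolding compactin_PiE by simp
  then have cI: "compact (PiE UNIV I)" by (simp add: euclidean_product_topology)
  have cont: "continuous_on UNIV (\<lambda>f. inner f f)"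
    unfolding inner_def by (intro continuous_intros continuous_on_product_coordinates)
  have contp: "continuous_on UNIV (\<lambda>f. \<Sum>v\<in>V i. w {v} * f v)" for i
    by (intro continuous_intros continuous_on_product_coordinates)
  have "balanced = (\<Inter>i\<in>{..r}. {f. (\<Sum>v\<in>V i. w {v} * f v) = 0})"
    unfolding balanced_def by auto
  then have "closed balanced"
    using contp by (auto intro!: closed_INT closed_Collect_eq continuous_on_const)
  then have cl: "closed (balanced \<inter> {f. inner f f = 1})"
    using cont by (intro closed_Int closed_Collect_eq continuous_on_const)
  have "f v \<in> I v" if f: "f \<in> ?K" for f v
  proof (cases "v \<in> verts")
    case True
    have "w {v} * (f v * f v) \<le> inner f f"
      unfolding inner_def using finite_verts True weight_pos
      by (intro member_le_sum) (auto simp: less_imp_le)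
    then have "w {v} * (f v)\<^sup>2 \<le> 1" using f by (simp add: power2_eq_square)
    then have "sqrt (w {v} * (f v)\<^sup>2) \<le> 1" by simp
    then have "sqrt (w {v}) * \<bar>f v\<bar> \<le> 1" by (simp add: real_sqrt_mult)
    then have "\<bar>f v\<bar> \<le> 1 / sqrt (w {v})"
      using weight_pos[OF True] by (simp add: field_simps)
    then show ?thesis unfolding I_def using True by (simp add: abs_le_iff)
  next
    case False
    then show ?thesis using f unfolding I_def by simp
  qed
  then have "?K \<subseteq> PiE UNIV I \<inter> (balanced \<inter> {f. inner f f = 1})" by auto
  moreover have "PiE UNIV I \<inter> (balanced \<inter> {f. inner f f = 1}) \<subseteq> ?K"
    unfolding I_def by (auto simp: PiE_iff split: if_splits)
  ultimately have "?K = PiE UNIV I \<inter> (balanced \<inter> {f. inner f f = 1})" by blast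
  then show ?thesis using compact_Int_closed[OF cI cl] by simp
qed

text \<open>A maximizer of the Rayleigh quotient on the balanced functions is an eigenvector.\<close>

lemma exists_top_eigenvector:
  assumes r: "r \<ge> 1" and f0: "f0 \<in> balanced" "\<exists>v\<in>verts. f0 v \<noteq> 0"
  shows "\<exists>k g. g \<in> balanced \<and> (\<exists>v\<in>verts. g v \<noteq> 0) \<and> (\<forall>v\<in>verts. adj g v = k * g v)
    \<and> (\<forall>f\<in>balanced. edge_form f f \<le> k * inner f f)"
proof -
  let ?K = "{f \<in> balanced. (\<forall>v. v \<notin> verts \<longrightarrow> f v = 0) \<and> inner f f = 1}"
  define nrm where "nrm = (\<lambda>f v. if v \<in> verts then f v / sqrt (inner f f) else 0)"
  have nrm: "nrm f \<in> ?K \<and> edge_form f f = edge_form (nrm f) (nrm f) * inner f f"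
    if f: "f \<in> balanced" "inner f f \<noteq> 0" for f
  proof -
    have pos: "inner f f > 0" using f(2) inner_nonneg[of f] by simp
    let ?a = "1 / sqrt (inner f f)"
    let ?g = "\<lambda>v. ?a * f v + 0 * f v"
    have g: "nrm f v = ?g v" if "v \<in> verts" for v using that by (simp add: nrm_def)
    have a: "?a * ?a * inner f f = 1" using pos by (simp add: field_simps)
    have "nrm f \<in> balanced"
      using balanced_cong[OF g] balanced_linear[OF f(1) f(1), of ?a 0] by simp
    moreover have "inner (nrm f) (nrm f) = inner ?g ?g" by (rule inner_cong[OF g g])
    then have "inner (nrm f) (nrm f) = 1"
      unfolding inner_linear inner_linear_right using a by (simp add: mult.assoc)
    moreover have "edge_form (nrm f) (nrm f) = edge_form ?g ?g" by (rule edge_form_cong[OF g g])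
    then have "edge_form (nrm f) (nrm f) = ?a * ?a * edge_form f f"
      unfolding edge_form_linear edge_form_linear_right by simp
    then have "edge_form (nrm f) (nrm f) * inner f f = (?a * ?a * inner f f) * edge_form f f" by simp
    ultimately show ?thesis unfolding a by (simp add: nrm_def)
  qed
  have "inner f0 f0 \<noteq> 0" using f0(2) inner_eq_0[of f0] by blast
  then have "?K \<noteq> {}" using nrm[OF f0(1)] by blast
  moreover have "continuous_on ?K (\<lambda>f. edge_form f f)"
    unfolding edge_form_def divide_inverse
    by (intro continuous_intros continuous_on_subset[OF continuous_on_product_coordinates]) auto
  ultimately have "\<exists>g\<in>?K. \<forall>f\<in>?K. edge_form f f \<le> edge_form g g"
    by (rule continuous_attains_sup[OF compact_unit_sphere])
  then obtain g where g: "g \<in> ?K" and max: "\<And>f. f \<in> ?K \<Longrightarrow> edge_form f f \<le> edge_form g g"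
    by (elim bexE) (metis (no_types, lifting))
  define k where "k = edge_form g g"
  have le: "edge_form f f \<le> k * inner f f" if f: "f \<in> balanced" for f
  proof (cases "inner f f = 0")
    case True
    then have z: "f v = 0" if "v \<in> verts" for v using that inner_eq_0 by blast
    have "edge_form f f = 0" unfolding edge_form_def using z by simp
    then show ?thesis using True by simp
  next
    case False
    then show ?thesis
      using nrm[OF f False] max[of "nrm f"] inner_nonneg[of f] unfolding k_def
      by (metis mult_right_mono)
  qed
  have gb: "g \<in> balanced" and g1: "inner g g = 1" using g by auto
  \<comment> \<open>First variation in direction \<open>h\<close>: the polynomial
    \<open>2 x b + x\<^sup>2 c\<close> is nonnegative for all \<open>x\<close>, which forces
    \<open>b = 0\<close>. The test point has denominator \<open>c + 1\<close> rather than
    \<open>c\<close> because \<open>c\<close> may vanish.\<close>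
  have orth: "k * inner g h = edge_form g h" if h: "h \<in> balanced" for h
  proof (rule ccontr)
    define b where "b = k * inner g h - edge_form g h"
    define c where "c = k * inner h h - edge_form h h"
    assume "\<not> ?thesis"
    then have b: "b \<noteq> 0" by (simp add: b_def)
    have q: "0 \<le> 2 * x * b + x * x * c" for x
    proof -
      have "edge_form (\<lambda>v. 1 * g v + x * h v) (\<lambda>v. 1 * g v + x * h v)
          \<le> k * inner (\<lambda>v. 1 * g v + x * h v) (\<lambda>v. 1 * g v + x * h v)"
        by (rule le[OF balanced_linear[OF gb h]])
      then show ?thesis
        unfolding edge_form_linear edge_form_linear_right inner_linear inner_linear_right
          edge_form_commute[of h g] inner_commute[of h g] g1 b_def c_def
        by (simp add: k_def algebra_simps)
    qed
    have c: "0 \<le> c" using le[OF h] by (simp add: c_def)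
    define x where "x = - (b / (c + 1))"
    have xb: "b = - (x * (c + 1))" using c by (simp add: x_def)
    then have "x \<noteq> 0" using b by auto
    have "0 \<le> 2 * x * b + x * x * c" by (rule q)
    also have "\<dots> = - ((x * x) * (c + 2))" unfolding xb by (simp add: algebra_simps)
    also have "\<dots> < 0"
    proof -
      have "0 < x * x" using \<open>x \<noteq> 0\<close> by (metis not_real_square_gt_zero)
      then have "0 < x * x * (c + 2)" by (rule mult_pos_pos) (use c in simp)
      then show ?thesis by (simp only: neg_less_0_iff_less)
    qed
    finally show False by simp
  qed
  \<comment> \<open>The defect of the eigenvalue equation is itself balanced, so by
    \<open>orth\<close> it is orthogonal to itself.\<close>
  define h where "h = (\<lambda>v. k * g v + (- 1) * adj g v)"
  have hb: "h \<in> balanced" unfolding h_def by (rule balanced_linear[OF gb adj_balanced[OF r gb]])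
  have "inner h h = k * inner g h + (- 1) * inner (adj g) h"
    by (subst (1) h_def) (rule inner_linear)
  then have "inner h h = 0" using orth[OF hb] inner_adj by simp
  then have "h v = 0" if "v \<in> verts" for v using that inner_eq_0 by blast
  then have "adj g v = k * g v" if "v \<in> verts" for v using that by (simp add: h_def)
  moreover have "\<exists>v\<in>verts. g v \<noteq> 0" using g1 inner_eq_0[of g] by (metis zero_neq_one)
  ultimately show ?thesis using gb le by blast
qed

end

section \<open>From forms to edge sets, and the spectral hypothesis\<close>

lemma sum_ordered_pairs:
  fixes h :: "'v set \<Rightarrow> real"
  assumes fin: "finite F" and two: "\<And>e. e \<in> F \<Longrightarrow> card e = 2"
  shows "(\<Sum>p | {fst p, snd p} \<in> F. h {fst p, snd p}) = 2 * (\<Sum>e\<in>F. h e)"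
proof -
  let ?p = "\<lambda>e. {p. {fst p, snd p} = e}"
  have fiber: "\<exists>a b. a \<noteq> b \<and> ?p e = {(a, b), (b, a)}" if "e \<in> F" for e
  proof -
    obtain a b where ab: "e = {a, b}" "a \<noteq> b" using two[OF \<open>e \<in> F\<close>] by (auto simp: card_2_iff)
    then have "?p e = {(a, b), (b, a)}" by (auto simp: doubleton_eq_iff)
    then show ?thesis using ab by blast
  qed
  have "{p. {fst p, snd p} \<in> F} = (\<Union>e\<in>F. ?p e)" by auto
  then have "(\<Sum>p | {fst p, snd p} \<in> F. h {fst p, snd p}) = (\<Sum>e\<in>F. \<Sum>p\<in>?p e. h {fst p, snd p})"
  proof (simp only:, intro sum.UNION_disjoint fin ballI impI)
    show "finite (?p e)" if "e \<in> F" for e using fiber[OF that] by (metis finite.emptyI finite_insert)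
  qed auto
  also have "\<dots> = (\<Sum>e\<in>F. 2 * h e)"
  proof (rule sum.cong[OF refl])
    fix e assume "e \<in> F"
    then obtain a b where ab: "a \<noteq> b" "?p e = {(a, b), (b, a)}" using fiber by blast
    have "(\<Sum>p\<in>?p e. h {fst p, snd p}) = (\<Sum>p\<in>?p e. h e)" by (rule sum.cong) auto
    also have "\<dots> = 2 * h e" unfolding ab(2) using ab(1) by simp
    finally show "(\<Sum>p\<in>?p e. h {fst p, snd p}) = 2 * h e" .
  qed
  finally show ?thesis by (simp add: sum_distrib_left)
qed

context partite_weighted_complex
begin

lemma edge_form_indicator:
  assumes S: "S \<subseteq> verts"
  shows "edge_form (indicator S) (indicator S) = (\<Sum>e | e \<in> faces X 1 \<and> e \<subseteq> S. w e)"
proof -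
  let ?F = "{e \<in> faces X 1. e \<subseteq> S}"
  have "(\<Sum>v\<in>verts. \<Sum>u\<in>verts. edge_weight u v * (indicator S u * indicator S v))
      = (\<Sum>p\<in>verts \<times> verts. if {fst p, snd p} \<in> ?F then w {fst p, snd p} else 0)"
    unfolding sum.cartesian_product
    by (rule sum.cong[OF refl]) (auto simp: edge_weight_def indicator_def insert_commute)
  also have "\<dots> = (\<Sum>p | p \<in> verts \<times> verts \<and> {fst p, snd p} \<in> ?F. w {fst p, snd p})"
    using finite_verts by (intro sum.inter_filter[symmetric]) simp
  also have "{p. p \<in> verts \<times> verts \<and> {fst p, snd p} \<in> ?F} = {p. {fst p, snd p} \<in> ?F}"
    using S by (auto simp: mem_Times_iff)
  also have "(\<Sum>p | {fst p, snd p} \<in> ?F. w {fst p, snd p}) = 2 * (\<Sum>e\<in>?F. w e)"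
    by (rule sum_ordered_pairs[OF finite_subset[OF _ finite_faces[of 1]]]) (auto simp: faces_1_eq)
  finally show ?thesis unfolding edge_form_def by simp
qed

lemma edge_subset_verts: "e \<in> faces X 1 \<Longrightarrow> e \<subseteq> verts"
  unfolding faces_def verts_def by blast

lemma sum_edges: assumes r: "r \<ge> 1" shows "(\<Sum>e\<in>faces X 1. w e) = 1"
proof -
  have "{e. e \<in> faces X 1 \<and> e \<subseteq> verts} = faces X 1" using edge_subset_verts by blast
  then have "(\<Sum>e\<in>faces X 1. w e) = edge_form (indicator verts) (indicator verts)"
    using edge_form_indicator[of verts] by simp
  also have "\<dots> = (\<Sum>v\<in>verts. \<Sum>u\<in>verts. edge_weight u v) / 2"
    unfolding edge_form_def by (simp cong: sum.cong)
  also have "\<dots> = (\<Sum>v\<in>verts. 2 * w {v}) / 2"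
    using sum_edge_weight[OF _ r] by (simp cong: sum.cong)
  finally show ?thesis using sum_weight by (simp add: sum_distrib_left[symmetric])
qed

lemma adjacency_eq_adj:
  assumes v: "v \<in> verts"
  shows "adjacency X w F {v} = adj (\<lambda>u. F {u}) v"
proof -
  let ?N = "{u \<in> verts. {u, v} \<in> faces X 1}"
  have ne: "u \<noteq> v" if "u \<in> ?N" for u using that by (auto simp: faces_1_eq)
  have inj: "inj_on (\<lambda>u. {u, v}) ?N"
    by (auto simp: inj_on_def doubleton_eq_iff)
  have "{e. e \<in> faces X 1 \<and> {v} \<subseteq> e} = (\<lambda>u. {u, v}) ` ?N"
  proof (intro subset_antisym subsetI)
    fix e assume e: "e \<in> {e. e \<in> faces X 1 \<and> {v} \<subseteq> e}"
    then obtain u where "e = {u, v}"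
      by (auto simp: faces_1_eq card_2_iff)
    then show "e \<in> (\<lambda>u. {u, v}) ` ?N" using e edge_subset_verts[of e] by auto
  qed auto
  then have "adjacency X w F {v} = (\<Sum>u\<in>?N. w {u, v} / (2 * w {v}) * F ({u, v} - {v}))"
    unfolding adjacency_def using inj by (simp add: sum.reindex)
  also have "\<dots> = (\<Sum>u\<in>?N. w {u, v} / (2 * w {v}) * F {u})"
    using ne by (intro sum.cong refl) (auto simp: insert_Diff_if)
  also have "\<dots> = (\<Sum>u\<in>verts. if {u, v} \<in> faces X 1 then w {u, v} / (2 * w {v}) * F {u} else 0)"
    using finite_verts by (rule sum.inter_filter)
  also have "\<dots> = (\<Sum>u\<in>verts. edge_weight u v * F {u} / (2 * w {v}))"
    by (rule sum.cong) (auto simp: edge_weight_def)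
  finally show ?thesis unfolding adj_def by (simp add: sum_divide_distrib)
qed

lemma sum_part_indicator:
  fixes c :: "nat \<Rightarrow> real"
  assumes "i \<le> r" "v \<in> V i"
  shows "(\<Sum>j\<le>r. if v \<in> V j then c j else 0) = c i"
proof -
  have "(\<Sum>j\<le>r. if v \<in> V j then c j else 0) = (\<Sum>j\<le>r. if j = i then c j else 0)"
  proof (rule sum.cong[OF refl])
    fix j assume "j \<in> {..r}"
    then have "v \<in> V j \<longleftrightarrow> j = i" using part_unique[of v j i] assms by auto
    then show "(if v \<in> V j then c j else 0) = (if j = i then c j else 0)" by simp
  qed
  then show ?thesis using assms by simp
qed

lemma balanced_C0_diamond:
  assumes g: "g \<in> balanced"
  shows "(\<lambda>x. g (the_elem x)) \<in> C0_diamond r X V w"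
  unfolding C0_diamond_def part_span_def
proof (intro CollectI ballI)
  fix G :: "'v set \<Rightarrow> real"
  assume "G \<in> {(\<lambda>v. \<Sum>i\<le>r. c i * indicator (part_faces X V i) v) |c. True}"
  then obtain c where G: "G = (\<lambda>v. \<Sum>i\<le>r. c i * indicator (part_faces X V i) v)" by blast
  have GV: "G {v} = c i" if "v \<in> V i" "i \<le> r" for v i
  proof -
    have "{v} \<in> faces X 0" using that part_subset faces_0_verts by blast
    then have "G {v} = (\<Sum>j\<le>r. if v \<in> V j then c j else 0)"
      unfolding G part_faces_def by (intro sum.cong) (auto simp: indicator_def)
    then show ?thesis using sum_part_indicator[OF that(2,1)] by simp
  qed
  have "weighted_inner X w (\<lambda>x. g (the_elem x)) G = (\<Sum>v\<in>verts. w {v} * g v * G {v})"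
    unfolding weighted_inner_def faces_0_verts by (subst sum.reindex) (auto simp: inj_on_def)
  also have "\<dots> = (\<Sum>i\<le>r. \<Sum>v\<in>V i. w {v} * g v * G {v})" by (rule sum_parts)
  also have "\<dots> = (\<Sum>i\<le>r. (\<Sum>v\<in>V i. w {v} * g v) * c i)"
    unfolding sum_distrib_right using GV by (intro sum.cong) auto
  also have "\<dots> = 0" using g unfolding balanced_def by simp
  finally show "weighted_inner X w (\<lambda>x. g (the_elem x)) G = 0" .
qed

text \<open>The maximal Rayleigh quotient \<open>k\<close> is an eigenvalue on
  \<open>C0_diamond\<close>, so the expansion hypothesis bounds it.\<close>

lemma edge_form_le:
  assumes r: "r \<ge> 1" and exp: "partite_expander r X V w mu lam" and f: "f \<in> balanced"
  shows "edge_form f f \<le> lam * inner f f"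
proof (cases "\<exists>v\<in>verts. f v \<noteq> 0")
  case True
  obtain k g where g: "g \<in> balanced" "\<exists>v\<in>verts. g v \<noteq> 0" "\<forall>v\<in>verts. adj g v = k * g v"
    and le: "\<forall>f\<in>balanced. edge_form f f \<le> k * inner f f"
    using exists_top_eigenvector[OF r f True] by blast
  have "diamond_eigenvalue r X V w k"
    unfolding diamond_eigenvalue_def
  proof (intro bexI[OF _ balanced_C0_diamond[OF g(1)]] conjI)
    show "\<exists>v\<in>faces X 0. g (the_elem v) \<noteq> 0" using g(2) unfolding faces_0_verts by auto
    show "\<forall>v\<in>faces X 0. adjacency X w (\<lambda>x. g (the_elem x)) v = k * g (the_elem v)"
      unfolding faces_0_verts using g(3) adjacency_eq_adj[of _ "\<lambda>x. g (the_elem x)"] by auto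
  qed
  then have "k \<le> lam" using exp unfolding partite_expander_def by blast
  then show ?thesis using le f inner_nonneg[of f] mult_right_mono[of k lam "inner f f"]
    by (meson order_trans)
next
  case False
  then have "inner f f = 0" "edge_form f f = 0" using inner_eq_0 by (auto simp: edge_form_def)
  then show ?thesis by simp
qed

text \<open>Split the indicator function into its projection \<open>h\<close> to the span of the part indicators and a
  balanced rest: \<open>h\<close> contributes \<open>((r + 1) p\<^sup>2 - \<langle>h, h\<rangle>) / r\<close>, where
  \<open>\<langle>h, h\<rangle> \<ge> p\<^sup>2\<close>.\<close>

lemma edges_inside_le:
  assumes r: "r \<ge> 1" and exp: "partite_expander r X V w mu lam" and S: "S \<subseteq> verts"
    and L: "lam \<le> L" "0 \<le> L"
  defines "p \<equiv> (\<Sum>v\<in>S. w {v})"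
  shows "(\<Sum>e | e \<in> faces X 1 \<and> e \<subseteq> S. w e) \<le> p * ((1 - L) * p + L)"
proof -
  define q where "q = (\<lambda>i. \<Sum>v\<in>V i. w {v} * indicator S v)"
  \<comment> \<open>On \<open>V i\<close> this is the mean of the indicator function of
    \<open>S\<close>, as \<open>V i\<close> has weight \<open>1 / (r + 1)\<close>.\<close>
  define h where "h = (\<lambda>v. \<Sum>i\<le>r. if v \<in> V i then (real r + 1) * q i else 0)"
  define g where "g = (\<lambda>v. 1 * indicator S v + (- 1) * h v)"
  define s where "s = (indicator S :: 'v \<Rightarrow> real)"
  have hV: "h v = (real r + 1) * q i" if "v \<in> V i" "i \<le> r" for v i
    unfolding h_def by (rule sum_part_indicator[OF that(2,1)])
  have p: "p = (\<Sum>i\<le>r. q i)"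
  proof -
    have "p = (\<Sum>v\<in>verts. w {v} * indicator S v)"
      unfolding p_def using S finite_verts by (simp add: indicator_def sum.If_cases Int_absorb1)
    then show ?thesis unfolding q_def sum_parts .
  qed
  have hsum: "(\<Sum>v\<in>V i. w {v} * h v) = q i" if "i \<le> r" for i
  proof -
    have "(\<Sum>v\<in>V i. w {v} * h v) = (\<Sum>v\<in>V i. w {v}) * ((real r + 1) * q i)"
      unfolding sum_distrib_right using hV[OF _ that] by (intro sum.cong) auto
    then show ?thesis using sum_weight_part[OF that] by simp
  qed
  have gb: "g \<in> balanced"
    unfolding balanced_def
  proof (intro CollectI allI impI)
    fix i assume i: "i \<le> r"
    have "(\<Sum>v\<in>V i. w {v} * g v) = q i - (\<Sum>v\<in>V i. w {v} * h v)"
      unfolding g_def q_def by (simp add: sum_subtractf algebra_simps)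
    then show "(\<Sum>v\<in>V i. w {v} * g v) = 0" using hsum[OF i] by simp
  qed
  have one: "inner (\<lambda>_. 1) f = (\<Sum>i\<le>r. \<Sum>v\<in>V i. w {v} * f v)" for f
    unfolding inner_def by (simp add: sum_parts)
  have one_g: "inner (\<lambda>_. 1) g = 0" unfolding one using gb by (simp add: balanced_def)
  have one_h: "inner (\<lambda>_. 1) h = p" unfolding one p using hsum by simp
  have one_one: "inner (\<lambda>_. 1) (\<lambda>_. 1) = 1" unfolding inner_def using sum_weight by simp
  have h_g: "inner h g = 0"
  proof -
    have "inner h g = (\<Sum>i\<le>r. (\<Sum>v\<in>V i. w {v} * g v) * ((real r + 1) * q i))"
      unfolding inner_def sum_parts sum_distrib_right using hV by (intro sum.cong) auto
    then show ?thesis using gb by (simp add: balanced_def)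
  qed
  have sgh: "s = (\<lambda>v. 1 * h v + 1 * g v)" unfolding s_def g_def by auto
  have form_h: "edge_form h f = ((real r + 1) * p * inner (\<lambda>_. 1) f - inner h f) / real r" for f
  proof -
    have "(\<Sum>u\<in>verts. edge_weight u v * h u) = 2 * w {v} / real r * ((real r + 1) * p - h v)"
      if v: "v \<in> verts" for v
    proof -
      obtain j where j: "j \<le> r" "v \<in> V j" using part_index[OF v] by blast
      have "(\<Sum>u\<in>verts. edge_weight u v * h u)
          = (\<Sum>i\<le>r. (\<Sum>u\<in>V i. edge_weight u v) * ((real r + 1) * q i))"
        unfolding sum_parts sum_distrib_right using hV by (intro sum.cong) auto
      also have "\<dots> = (\<Sum>i\<le>r. (if v \<in> V i then 0 else 2 * w {v} / real r) * ((real r + 1) * q i))"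
        using sum_edge_weight_part[OF _ v r] by (intro sum.cong) auto
      also have "\<dots> = (\<Sum>i\<le>r. 2 * w {v} / real r * ((real r + 1) * q i
          - (if v \<in> V i then (real r + 1) * q i else 0)))"
        by (intro sum.cong) auto
      also have "\<dots> = 2 * w {v} / real r * ((real r + 1) * p - h v)"
        unfolding sum_distrib_left[symmetric] sum_subtractf p h_def ..
      finally show ?thesis .
    qed
    then have "edge_form h f = (\<Sum>v\<in>verts. (2 * w {v} / real r * ((real r + 1) * p - h v)) * f v) / 2"
      unfolding edge_form_def
      by (intro arg_cong[where f = "\<lambda>x. x / 2"] sum.cong) (simp_all add: sum_distrib_right[symmetric] mult.assoc[symmetric])
    also have "\<dots> = (\<Sum>v\<in>verts. ((real r + 1) * p * (w {v} * (1 * f v)) - w {v} * (h v * f v))) / real r"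
      unfolding sum_divide_distrib using r by (intro sum.cong) (simp_all add: field_simps)
    also have "\<dots> = ((real r + 1) * p * inner (\<lambda>_. 1) f - inner h f) / real r"
      unfolding inner_def sum_subtractf sum_distrib_left ..
    finally show ?thesis .
  qed
  let ?Q = "inner h h"
  have hs: "inner s s = ?Q + inner g g"
    unfolding sgh inner_linear inner_linear_right using h_g inner_commute[of g h] by simp
  have "inner s s = (\<Sum>v\<in>verts. w {v} * indicator S v)"
    unfolding inner_def s_def by (rule sum.cong) (auto simp: indicator_def)
  then have ss: "inner s s = p"
    unfolding p_def using S finite_verts by (simp add: indicator_def sum.If_cases Int_absorb1)
  \<comment> \<open>The variance of \<open>h\<close> around its mean \<open>p\<close>.\<close>
  have "0 \<le> inner (\<lambda>v. 1 * h v + (- p) * 1) (\<lambda>v. 1 * h v + (- p) * 1)" by (rule inner_nonneg)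
  also have "\<dots> = ?Q - p * p"
    unfolding inner_linear inner_linear_right one_h one_one inner_commute[of h "\<lambda>_. 1"] by simp
  finally have Q: "p * p \<le> ?Q" by simp
  have "edge_form s s = edge_form h h + edge_form g g"
    unfolding sgh edge_form_linear edge_form_linear_right edge_form_commute[of g h]
    using form_h[of g] one_g h_g by simp
  also have "\<dots> \<le> ((real r + 1) * p * p - ?Q) / real r + L * (p - ?Q)"
  proof -
    have "edge_form g g \<le> lam * inner g g" by (rule edge_form_le[OF r exp gb])
    also have "\<dots> \<le> L * inner g g" using L inner_nonneg by (intro mult_right_mono) auto
    finally show ?thesis using form_h[of h] one_h hs ss by simp
  qed
  \<comment> \<open>\<open>?Q\<close> occurs with the coefficient \<open>- (1 / r + L)\<close>,
    which is not positive, so its lower bound may replace it.\<close>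
  also have "\<dots> \<le> ((real r + 1) * p * p - p * p) / real r + L * (p - p * p)"
    using Q L by (intro add_mono divide_right_mono mult_left_mono) auto
  also have "\<dots> = p * ((1 - L) * p + L)"
    using r by (simp add: field_simps)
  finally show ?thesis using edge_form_indicator[OF S] unfolding s_def by simp
qed

end

section \<open>Cochains of the quotient sheaf\<close>

lemma (in comm_group) subgroup_sum_eq:
  assumes "finite I" and "\<And>i. i \<in> I \<Longrightarrow> subgroup (H i) G"
  shows "subgroup_sum G I H = (\<lambda>a. finprod G a I) ` Pi\<^sub>E I H"
  using assms is_group by (simp add: subgroup_sum_def carrier_sum_group_subgroups)

lemma (in comm_group) subgroup_sum_empty: "subgroup_sum G {} H = {\<one>}"
  using subgroup_sum_eq[of "{}" H] by simp

lemma (in comm_group) subgroup_sum_insert: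
  assumes "finite I" "i \<notin> I" and sub: "\<And>j. j \<in> insert i I \<Longrightarrow> subgroup (H j) G"
  shows "subgroup_sum G (insert i I) H = H i <#> subgroup_sum G I H"
proof -
  have car: "a \<in> J \<rightarrow> carrier G" if "a \<in> Pi\<^sub>E J H" "J \<subseteq> insert i I" for a J
  proof
    fix j assume j: "j \<in> J"
    then show "a j \<in> carrier G" using subgroup.mem_carrier[OF sub, of j "a j"] that by (auto simp: PiE_iff)
  qed
  have eqI: "subgroup_sum G I H = (\<lambda>a. finprod G a I) ` Pi\<^sub>E I H"
    and eqJ: "subgroup_sum G (insert i I) H = (\<lambda>a. finprod G a (insert i I)) ` Pi\<^sub>E (insert i I) H"
    using assms by (auto intro!: subgroup_sum_eq)
  show ?thesis
  proof (intro subset_antisym subsetI)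
    fix g assume "g \<in> subgroup_sum G (insert i I) H"
    then obtain a where a: "a \<in> Pi\<^sub>E (insert i I) H" "g = finprod G a (insert i I)"
      unfolding eqJ by blast
    have "g = a i \<otimes> finprod G a I"
      unfolding a(2) using assms(1,2) car[OF a(1)] by (intro finprod_insert) auto
    also have "finprod G a I = finprod G (restrict a I) I"
      using car[OF a(1)] by (intro finprod_cong') auto
    finally show "g \<in> H i <#> subgroup_sum G I H"
      unfolding set_mult_def eqI using a(1) by (auto simp: PiE_iff intro!: bexI)
  next
    fix g assume "g \<in> H i <#> subgroup_sum G I H"
    then obtain b a where b: "b \<in> H i" and a: "a \<in> Pi\<^sub>E I H" and g: "g = b \<otimes> finprod G a I"
      unfolding set_mult_def eqI by blast
    have a': "a(i := b) \<in> Pi\<^sub>E (insert i I) H"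
      using a b by (auto simp: PiE_iff extensional_def)
    have "finprod G (a(i := b)) (insert i I) = (a(i := b)) i \<otimes> finprod G (a(i := b)) I"
      using assms(1,2) car[OF a'] by (intro finprod_insert) auto
    also have "finprod G (a(i := b)) I = finprod G a I"
      using car[OF a] assms(2) by (intro finprod_cong') auto
    finally have "g = finprod G (a(i := b)) (insert i I)" using g by (simp only: fun_upd_same)
    then show "g \<in> subgroup_sum G (insert i I) H"
      unfolding eqJ using a' by blast
  qed
qed

lemma (in comm_group) subgroup_sum_singleton:
  assumes "subgroup (H i) G"
  shows "subgroup_sum G {i} H = H i"
proof -
  have "H i <#> {\<one>} = H i"
    using subgroup.mem_carrier[OF assms] by (force simp: set_mult_def)
  then show ?thesis
    using subgroup_sum_insert[of "{}" i H] assms by (simp add: subgroup_sum_empty)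
qed

locale vertex_edge_subgroups = comm_group R for R :: "'a monoid" (structure) +
  fixes X :: "'v set set" and Rs :: "'v set \<Rightarrow> 'a set"
  assumes X: "simplicial_complex X"
    and sub: "\<And>x. x \<in> X \<Longrightarrow> x \<noteq> {} \<Longrightarrow> subgroup (Rs x) R"
    and Rs_empty: "Rs {} = {\<one>}"
begin

abbreviation "F \<equiv> quotient_sheaf (constant_sheaf R) (sum_subsheaf R Rs)"

lemma subgroup_Rs: "x \<in> X \<Longrightarrow> subgroup (Rs x) R"
  using sub Rs_empty triv_subgroup by (cases "x = {}") auto

lemma sub_face: "x \<in> X \<Longrightarrow> y \<subseteq> x \<Longrightarrow> y \<in> X"
  using X by (auto simp: simplicial_complex_def)

lemma empty_face: "{} \<in> X"
  using X by (auto simp: simplicial_complex_def)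

lemma subsheaf: "subsheaf_on X (constant_sheaf R) (sum_subsheaf R Rs)"
  using subsheaf_on_sum_subsheaf[OF comm_group_axioms X subgroup_Rs] .

lemma subgroup_G: "x \<in> X \<Longrightarrow> subgroup (sum_subsheaf R Rs x) R"
  using subsheaf by (auto simp: subsheaf_on_def constant_sheaf_def)

text \<open>The empty face contributes the trivial group. Hence a cochain value at a vertex is a
  coset of \<open>Rs {v}\<close>, whose elements are the possible colours.\<close>

lemma sum_subsheaf_vertex: assumes "{v} \<in> X" shows "sum_subsheaf R Rs {v} = Rs {v}"
proof -
  have "Rs {v} <#> {\<one>} = Rs {v}"
    using subgroup.mem_carrier[OF subgroup_Rs[OF assms]] by (force simp: set_mult_def)
  moreover have "Pow {v} = insert {v} {{}}" by blast
  moreover have "subgroup_sum R (insert {v} {{}}) Rs = Rs {v} <#> subgroup_sum R {{}} Rs"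
    by (rule subgroup_sum_insert) (use subgroup_Rs assms empty_face in auto)
  moreover have "subgroup_sum R {{}} Rs = {\<one>}"
    using subgroup_sum_singleton[of Rs "{}"] subgroup_Rs[OF empty_face] Rs_empty by simp
  ultimately show ?thesis
    unfolding sum_subsheaf_def by simp
qed

lemma sum_subsheaf_edge:
  assumes "{u, v} \<in> X" "u \<noteq> v"
  shows "sum_subsheaf R Rs {u, v} = Rs {u, v} <#> (Rs {u} <#> Rs {v})"
proof -
  have f: "{u} \<in> X" "{v} \<in> X" using sub_face[OF assms(1)] by auto
  have "Pow {u, v} = insert {u, v} (insert {u} (Pow {v}))" by blast
  moreover have "subgroup_sum R (Pow {v}) Rs = Rs {v}"
    using sum_subsheaf_vertex[OF f(2)] by (simp add: sum_subsheaf_def)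
  moreover have "{u, v} \<notin> insert {u} (Pow {v})" "{u} \<notin> Pow {v}" using assms(2) by auto
  moreover have "subgroup (Rs j) R" if "j \<in> insert {u, v} (insert {u} (Pow {v}))" for j
    using that f assms empty_face subgroup_Rs by (auto dest!: subset_singletonD)
  ultimately show ?thesis
    unfolding sum_subsheaf_def
    using subgroup_sum_insert[of "insert {u} (Pow {v})" "{u, v}" Rs]
      subgroup_sum_insert[of "Pow {v}" "{u}" Rs] by simp
qed

section \<open>Cosets as values of cochains\<close>

lemma stalk_F: "stalk F x = R Mod sum_subsheaf R Rs x"
  by (simp add: quotient_sheaf_def constant_sheaf_def)

lemma carrier_stalk_F: "carrier (stalk F x) = {sum_subsheaf R Rs x #> a | a. a \<in> carrier R}"
  unfolding stalk_F by (auto simp: FactGroup_def RCOSETS_def)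

lemma one_stalk_F: "\<one>\<^bsub>stalk F x\<^esub> = sum_subsheaf R Rs x"
  unfolding stalk_F by (simp add: FactGroup_def)

lemma comm_group_stalk: "x \<in> X \<Longrightarrow> comm_group (stalk F x)"
  unfolding stalk_F by (rule abelian_FactGroup[OF subgroup_G])

lemma coset_quotient:
  assumes x: "x \<in> X" and a: "a \<in> carrier R" "b \<in> carrier R"
  shows "(sum_subsheaf R Rs x #> a) \<otimes>\<^bsub>stalk F x\<^esub> inv\<^bsub>stalk F x\<^esub> (sum_subsheaf R Rs x #> b)
    = sum_subsheaf R Rs x #> (a \<otimes> inv b)"
proof -
  let ?H = "sum_subsheaf R Rs x"
  have N: "?H \<lhd> R" by (rule subgroup_imp_normal[OF subgroup_G[OF x]])
  have "inv\<^bsub>R Mod ?H\<^esub> (?H #> b) = ?H #> inv b"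
    using normal.inv_FactGroup[OF N, of "?H #> b"] normal.rcos_inv[OF N a(2)] a(2)
    by (auto simp: FactGroup_def RCOSETS_def)
  then show ?thesis
    unfolding stalk_F using normal.rcos_sum[OF N a(1), of "inv b"] a by (simp add: FactGroup_def)
qed

lemma coset_eq_one_iff:
  assumes "x \<in> X" "a \<in> carrier R"
  shows "sum_subsheaf R Rs x #> a = \<one>\<^bsub>stalk F x\<^esub> \<longleftrightarrow> a \<in> sum_subsheaf R Rs x"
  unfolding one_stalk_F using subgroup_G[OF assms(1)] assms(2)
  by (metis coset_join1 coset_join2 subgroup.subset)

lemma cochain_0_coset:
  assumes f: "f \<in> carrier (cochains X F 0)" and v: "{v} \<in> X"
  shows "f {v} \<in> carrier (stalk F {v})"
proof -
  have "{v} \<in> faces X 0" using v by (simp add: faces_def simplex_dim_def)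
  then show ?thesis using f by (auto simp: cochains_def PiE_iff)
qed

lemma cochain_0_rep:
  assumes f: "f \<in> carrier (cochains X F 0)" and v: "{v} \<in> X" and a: "a \<in> f {v}"
  shows "a \<in> carrier R" "f {v} = sum_subsheaf R Rs {v} #> a"
proof -
  obtain b where b: "b \<in> carrier R" "f {v} = sum_subsheaf R Rs {v} #> b"
    using cochain_0_coset[OF f v] unfolding carrier_stalk_F by blast
  show "a \<in> carrier R"
    using a b subgroup.subset[OF subgroup_G[OF v]] r_coset_subset_G by blast
  show "f {v} = sum_subsheaf R Rs {v} #> a"
    using repr_independence[of a "sum_subsheaf R Rs {v}" b] a b subgroup_G[OF v] by simp
qed

lemma cochain_0_nonempty:
  assumes f: "f \<in> carrier (cochains X F 0)" and v: "{v} \<in> X"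
  shows "\<exists>a. a \<in> f {v}"
  using cochain_0_coset[OF f v] rcos_self[OF _ subgroup_G[OF v]] unfolding carrier_stalk_F by blast

lemma cochain_0_diff:
  assumes f: "f \<in> carrier (cochains X F 0)" and v: "{v} \<in> X" and ab: "a \<in> f {v}" "b \<in> f {v}"
  shows "a \<otimes> inv b \<in> Rs {v}"
proof -
  have "a \<in> Rs {v} #> b" "b \<in> carrier R"
    using cochain_0_rep[OF f v ab(2)] ab(1) sum_subsheaf_vertex[OF v] by auto
  then show ?thesis
    using subgroup.rcos_module_imp[OF subgroup_Rs[OF v] is_group, of b a] by simp
qed

lemma larger_smaller_vertex:
  assumes ord: "linear_order_on (\<Union>X) ord" and e: "e \<in> faces X 1"
  shows "\<exists>u v. e = {u, v} \<and> u \<noteq> v \<and> larger_vertex ord e = u \<and> smaller_vertex ord e = v"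
proof -
  have "e \<in> X" "card e = 2" using e by (auto simp: faces_def simplex_dim_def)
  then obtain a b where ab: "e = {a, b}" "a \<noteq> b" by (auto simp: card_2_iff)
  then have "a \<in> \<Union>X" "b \<in> \<Union>X" using \<open>e \<in> X\<close> by auto
  have L: "refl_on (\<Union>X) ord" "antisym ord" "total_on (\<Union>X) ord"
    using ord by (auto simp: linear_order_on_def partial_order_on_def preorder_on_def)
  have rr: "(a, a) \<in> ord" "(b, b) \<in> ord"
    using L(1) \<open>a \<in> \<Union>X\<close> \<open>b \<in> \<Union>X\<close> by (auto simp: refl_on_def)
  have tot: "(a, b) \<in> ord \<or> (b, a) \<in> ord"
    using L(3) ab(2) \<open>a \<in> \<Union>X\<close> \<open>b \<in> \<Union>X\<close> by (auto simp: total_on_def)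
  have key: "larger_vertex ord {x, y} = y \<and> smaller_vertex ord {x, y} = x"
    if "(x, y) \<in> ord" "(x, x) \<in> ord" "(y, y) \<in> ord" for x y
  proof
    show "larger_vertex ord {x, y} = y"
      unfolding larger_vertex_def using that antisymD[OF L(2), of x y] by (intro the_equality) auto
    show "smaller_vertex ord {x, y} = x"
      unfolding smaller_vertex_def using that antisymD[OF L(2), of x y] by (intro the_equality) auto
  qed
  show ?thesis
    using tot
  proof
    assume "(a, b) \<in> ord"
    then have "larger_vertex ord e = b \<and> smaller_vertex ord e = a"
      using key[of a b] rr ab(1) by simp
    moreover have "e = {b, a}" using ab(1) by blast
    ultimately show ?thesis using ab(2) by metis
  next
    assume "(b, a) \<in> ord"
    then have "larger_vertex ord {b, a} = a \<and> smaller_vertex ord {b, a} = b"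
      using key[of b a] rr by simp
    moreover have "{b, a} = e" using ab(1) by blast
    ultimately show ?thesis using ab by metis
  qed
qed

text \<open>Restriction sends a coset to the coset of the same representative. The vertex order is
  hidden in the existential quantifier; \<open>coboundary_0_split\<close> then removes it.\<close>

lemma coboundary_0_eq_one_iff:
  assumes ord: "linear_order_on (\<Union>X) ord" and f: "f \<in> carrier (cochains X F 0)"
    and e: "e \<in> faces X 1"
  shows "\<exists>u v. e = {u, v} \<and> u \<noteq> v \<and> (\<forall>a\<in>f {u}. \<forall>b\<in>f {v}.
    coboundary_0 ord X F f e = \<one>\<^bsub>stalk F e\<^esub> \<longleftrightarrow> a \<otimes> inv b \<in> sum_subsheaf R Rs e)"
proof -
  obtain u v where uv: "e = {u, v}" "u \<noteq> v" "larger_vertex ord e = u" "smaller_vertex ord e = v"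
    using larger_smaller_vertex[OF ord e] by blast
  have eX: "e \<in> X" using e by (simp add: faces_def)
  have X': "{u} \<in> X" "{v} \<in> X" using sub_face[OF eX] uv(1) by auto
  have ss: "{u} \<subset> e" "{v} \<subset> e" using uv by auto
  have "coboundary_0 ord X F f e = \<one>\<^bsub>stalk F e\<^esub> \<longleftrightarrow> a \<otimes> inv b \<in> sum_subsheaf R Rs e"
    if a: "a \<in> f {u}" and b: "b \<in> f {v}" for a b
  proof -
    note ra = cochain_0_rep[OF f X'(1) a] and rb = cochain_0_rep[OF f X'(2) b]
    have "coboundary_0 ord X F f e = res F e {u} (f {u}) \<otimes>\<^bsub>stalk F e\<^esub>
        inv\<^bsub>stalk F e\<^esub> (res F e {v} (f {v}))"
      using e by (simp add: coboundary_0_def uv(3,4))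
    also have "res F e {u} (f {u}) = sum_subsheaf R Rs e #> a"
      unfolding ra(2) by (rule res_quotient_constant_sheaf[OF comm_group_axioms subsheaf X'(1) eX ss(1) ra(1)])
    also have "res F e {v} (f {v}) = sum_subsheaf R Rs e #> b"
      unfolding rb(2) by (rule res_quotient_constant_sheaf[OF comm_group_axioms subsheaf X'(2) eX ss(2) rb(1)])
    finally show ?thesis
      using coset_quotient[OF eX ra(1) rb(1)] coset_eq_one_iff[OF eX] ra(1) rb(1) by simp
  qed
  then show ?thesis using uv by blast
qed

text \<open>The vertex components of the difference can be absorbed into the representatives, which
  leaves only the edge component. The other order of the ends is obtained by inversion.\<close>

lemma coboundary_0_split:
  assumes ord: "linear_order_on (\<Union>X) ord" and f: "f \<in> carrier (cochains X F 0)"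
    and e: "{p, q} \<in> faces X 1" and z: "coboundary_0 ord X F f {p, q} = \<one>\<^bsub>stalk F {p, q}\<^esub>"
  shows "\<exists>a\<in>f {p}. \<exists>b\<in>f {q}. a \<otimes> inv b \<in> Rs {p, q}"
proof -
  obtain u v where uv: "{p, q} = {u, v}" "u \<noteq> v" "\<forall>a\<in>f {u}. \<forall>b\<in>f {v}.
    coboundary_0 ord X F f {p, q} = \<one>\<^bsub>stalk F {p, q}\<^esub> \<longleftrightarrow> a \<otimes> inv b \<in> sum_subsheaf R Rs {p, q}"
    using coboundary_0_eq_one_iff[OF ord f e] by blast
  have eX: "{u, v} \<in> X" using e uv(1) by (simp add: faces_def)
  have X': "{u} \<in> X" "{v} \<in> X" using sub_face[OF eX] by auto
  obtain a b where ab: "a \<in> f {u}" "b \<in> f {v}"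
    using cochain_0_nonempty[OF f] X' by blast
  note ra = cochain_0_rep[OF f X'(1) ab(1)] and rb = cochain_0_rep[OF f X'(2) ab(2)]
  have "a \<otimes> inv b \<in> Rs {u, v} <#> (Rs {u} <#> Rs {v})"
    using uv z ab sum_subsheaf_edge[OF eX uv(2)] by auto
  then obtain c x y where cxy: "c \<in> Rs {u, v}" "x \<in> Rs {u}" "y \<in> Rs {v}"
    and eq: "a \<otimes> inv b = c \<otimes> (x \<otimes> y)"
    unfolding set_mult_def by blast
  have car: "c \<in> carrier R" "x \<in> carrier R" "y \<in> carrier R"
    using subgroup.mem_carrier[OF subgroup_Rs[OF eX] cxy(1)]
      subgroup.mem_carrier[OF subgroup_Rs[OF X'(1)] cxy(2)]
      subgroup.mem_carrier[OF subgroup_Rs[OF X'(2)] cxy(3)] by auto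
  \<comment> \<open>With \<open>a \<otimes> inv b = c \<otimes> (x \<otimes> y)\<close>, moving
    \<open>a\<close> by \<open>inv x\<close> and \<open>b\<close> by \<open>y\<close> stays in the
    cosets and leaves the difference \<open>c\<close>.\<close>
  define a' where "a' = inv x \<otimes> a"
  define b' where "b' = y \<otimes> b"
  have a': "a' \<in> f {u}"
    unfolding ra(2) sum_subsheaf_vertex[OF X'(1)] a'_def r_coset_def
    using subgroup.m_inv_closed[OF subgroup_Rs[OF X'(1)] cxy(2)] by blast
  have b': "b' \<in> f {v}"
    unfolding rb(2) sum_subsheaf_vertex[OF X'(2)] b'_def r_coset_def using cxy(3) by blast
  have "a' \<otimes> inv b' = inv x \<otimes> (a \<otimes> inv b) \<otimes> inv y"
    unfolding a'_def b'_def using ra(1) rb(1) car by (simp add: inv_mult m_ac)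
  also have "\<dots> = (inv x \<otimes> x) \<otimes> (y \<otimes> inv y) \<otimes> c"
    unfolding eq using car by (simp only: m_ac m_closed inv_closed)
  also have "\<dots> = c" using car by simp
  finally have c: "a' \<otimes> inv b' = c" .
  have c': "b' \<otimes> inv a' = inv c"
    unfolding c[symmetric] a'_def b'_def using ra(1) rb(1) car by (simp add: inv_mult m_ac)
  have ci: "inv c \<in> Rs {u, v}" by (rule subgroup.m_inv_closed[OF subgroup_Rs[OF eX] cxy(1)])
  consider "p = u" "q = v" | "p = v" "q = u" using uv(1) by (auto simp: doubleton_eq_iff)
  then show ?thesis
  proof cases
    case 1
    then show ?thesis using a' b' c cxy(1) by auto
  next
    case 2
    have "b' \<otimes> inv a' \<in> Rs {p, q}" using c' ci uv(1) by simp
    then show ?thesis using a' b' 2 by blast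
  qed
qed

text \<open>The coset of \<open>a\<close> at the empty face has as its coboundary the constant
  cochain of \<open>a\<close>, which agrees with \<open>f\<close> at every vertex whose coset
  contains \<open>a\<close>.\<close>

lemma dist_B0_le:
  assumes f: "f \<in> carrier (cochains X F 0)" and a: "a \<in> carrier R"
    and w: "\<And>x. x \<in> X \<Longrightarrow> 0 \<le> w x"
  shows "dist_B0 X w F f \<le> sum w {x \<in> faces X 0. a \<notin> f x}"
proof -
  let ?C = "cochains X F 0"
  have finX: "finite X" using X by (simp add: simplicial_complex_def)
  have F0: "\<exists>v. x = {v} \<and> {v} \<in> X" if "x \<in> faces X 0" for x
    using that by (auto simp: faces_def simplex_dim_def card_1_singleton_iff)
  have gr: "group (stalk F x)" if "x \<in> faces X 0" for x
    using comm_group_stalk[of x] that by (simp add: faces_def comm_group.axioms)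
  define h where "h = (\<lambda>x\<in>faces X (- 1). sum_subsheaf R Rs x #> a)"
  have h: "h \<in> carrier (cochains X F (- 1))"
    unfolding h_def cochains_def using a by (auto simp: carrier_stalk_F)
  define g where "g = coboundary_minus1 X F h"
  have gB: "g \<in> coboundaries_0 X F" unfolding g_def coboundaries_0_def using h by blast
  have em: "{} \<in> faces X (- 1)" using empty_face by (simp add: faces_def simplex_dim_def)
  have gx: "g {v} = sum_subsheaf R Rs {v} #> a" if v: "{v} \<in> X" for v
  proof -
    have "{v} \<in> faces X 0" using v by (simp add: faces_def simplex_dim_def)
    then have "g {v} = res F {v} {} (sum_subsheaf R Rs {} #> a)"
      unfolding g_def coboundary_minus1_def h_def using em by simp
    also have "\<dots> = sum_subsheaf R Rs {v} #> a"
      by (rule res_quotient_constant_sheaf[OF comm_group_axioms subsheaf empty_face v _ a]) auto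
    finally show ?thesis .
  qed
  have gC: "g \<in> carrier ?C"
  proof -
    have "g x \<in> carrier (stalk F x)" if "x \<in> faces X 0" for x
      using F0[OF that] gx a carrier_stalk_F by blast
    moreover have "g \<in> extensional (faces X 0)" unfolding g_def coboundary_minus1_def by simp
    ultimately show ?thesis unfolding cochains_def by (auto simp: PiE_iff)
  qed
  have inv: "(inv\<^bsub>?C\<^esub> g) x = inv\<^bsub>stalk F x\<^esub> (g x)" if "x \<in> faces X 0" for x
  proof -
    have "g \<in> (\<Pi>\<^sub>E x\<in>faces X 0. carrier (stalk F x))"
      using gC by (simp add: cochains_def)
    then show ?thesis
      using inv_product_group[of g "faces X 0" "stalk F", OF _ gr] that unfolding cochains_def by simp
  qed
  have "{x \<in> faces X 0. (f \<otimes>\<^bsub>?C\<^esub> inv\<^bsub>?C\<^esub> g) x \<noteq> \<one>\<^bsub>stalk F x\<^esub>} \<subseteq> {x \<in> faces X 0. a \<notin> f x}"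
  proof (intro subsetI CollectI conjI notI)
    fix x assume x: "x \<in> {x \<in> faces X 0. (f \<otimes>\<^bsub>?C\<^esub> inv\<^bsub>?C\<^esub> g) x \<noteq> \<one>\<^bsub>stalk F x\<^esub>}"
      and ax: "a \<in> f x"
    then obtain v where v: "x = {v}" "{v} \<in> X" using F0 by blast
    have "(f \<otimes>\<^bsub>?C\<^esub> inv\<^bsub>?C\<^esub> g) x = f x \<otimes>\<^bsub>stalk F x\<^esub> inv\<^bsub>stalk F x\<^esub> (g x)"
      using inv[of x] x by (simp add: cochains_def)
    also have "\<dots> = sum_subsheaf R Rs x #> (a \<otimes> inv a)"
      using cochain_0_rep(2)[OF f v(2)] ax gx[OF v(2)] coset_quotient[OF v(2) a a] v(1) by simp
    also have "\<dots> = \<one>\<^bsub>stalk F x\<^esub>"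
      using coset_eq_one_iff[of x \<one>] v a subgroup.one_closed[OF subgroup_G[OF v(2)]]
      by (simp add: r_inv)
    finally show False using x by simp
  qed auto
  then have "cochain_norm X w F 0 (f \<otimes>\<^bsub>?C\<^esub> inv\<^bsub>?C\<^esub> g) \<le> sum w {x \<in> faces X 0. a \<notin> f x}"
    unfolding cochain_norm_def using finX w by (intro sum_mono2) (auto simp: faces_def)
  moreover have "dist_B0 X w F f \<le> cochain_norm X w F 0 (f \<otimes>\<^bsub>?C\<^esub> inv\<^bsub>?C\<^esub> g)"
    unfolding dist_B0_def
  proof (rule Min_le)
    have "(\<lambda>g. cochain_norm X w F 0 (f \<otimes>\<^bsub>?C\<^esub> inv\<^bsub>?C\<^esub> g)) ` coboundaries_0 X F
        \<subseteq> sum w ` Pow (faces X 0)"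
      unfolding cochain_norm_def by auto
    then show "finite ((\<lambda>g. cochain_norm X w F 0 (f \<otimes>\<^bsub>?C\<^esub> inv\<^bsub>?C\<^esub> g)) ` coboundaries_0 X F)"
      by (rule finite_subset) (use finX in \<open>simp add: faces_def\<close>)
  qed (use gB in blast)
  ultimately show ?thesis by linarith
qed

end

section \<open>Monochromatic components\<close>

definition colour_link :: "('v \<Rightarrow> 'a set) \<Rightarrow> 'v set set \<Rightarrow> 'a \<Rightarrow> 'v rel" where
  "colour_link f T a = {(x, y). {x, y} \<in> T \<and> a \<in> f x \<and> a \<in> f y}"

lemma sym_colour_link: "sym (colour_link f T a)"
  unfolding colour_link_def sym_def by (auto simp: insert_commute)

lemma colour_link_mono: "S \<subseteq> T \<Longrightarrow> colour_link f S a \<subseteq> colour_link f T a"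
  unfolding colour_link_def by auto

text \<open>An edge set that is minimal among those with the same monochromatic components contains no
  monochromatic cycle, since the closing edge of such a cycle could be dropped.\<close>

lemma exists_colour_spanning_subset:
  assumes fin: "finite E" and two: "\<And>e. e \<in> E \<Longrightarrow> card e = 2"
    and uniq: "\<And>u v a b. {u, v} \<in> E \<Longrightarrow> a \<in> f u \<inter> f v \<Longrightarrow> b \<in> f u \<inter> f v \<Longrightarrow> a = b"
  obtains T where "T \<subseteq> E" "{e \<in> E. \<nexists>a. \<forall>v\<in>e. a \<in> f v} \<subseteq> T"
    "\<And>a. (colour_link f T a)\<^sup>* = (colour_link f E a)\<^sup>*"
    "\<And>l c a. is_cycle T l c \<Longrightarrow> \<exists>i<l. a \<notin> f (c i)"
proof -
  define P where "P = (\<lambda>T. T \<subseteq> E \<and> {e \<in> E. \<nexists>a. \<forall>v\<in>e. a \<in> f v} \<subseteq> T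
    \<and> (\<forall>a. (colour_link f T a)\<^sup>* = (colour_link f E a)\<^sup>*))"
  define T where "T = (ARG_MIN card T. P T)"
  have "P E" unfolding P_def by auto
  then have PT: "P T" and min: "\<And>S. P S \<Longrightarrow> card T \<le> card S"
    using arg_min_nat_lemma[of P E card] unfolding T_def by auto
  have TE: "T \<subseteq> E" using PT by (simp add: P_def)
  have nomono: "\<exists>i<l. a \<notin> f (c i)" if cyc: "is_cycle T l c" for l c a
  proof (rule ccontr)
    assume "\<not> ?thesis"
    then have mono: "a \<in> f (c i)" if "i < l" for i using that by blast
    have l: "3 \<le> l" "inj_on c {..<l}" using cyc by (auto simp: is_cycle_def)
    have cE: "{c i, c (Suc i mod l)} \<in> T" if "i < l" for i using cyc that by (simp add: is_cycle_def)
    let ?e = "{c (l - 1), c 0}"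
    have e: "?e = {c (l - 1), c (Suc (l - 1) mod l)}" using l by simp
    have eT: "?e \<in> T" unfolding e using cE[of "l - 1"] l by simp
    let ?S = "T - {?e}"
    \<comment> \<open>The remaining edges of the cycle connect the ends of the dropped edge.\<close>
    have path: "(c 0, c k) \<in> (colour_link f ?S a)\<^sup>*" if "k < l" for k
      using that
    proof (induction k)
      case (Suc k)
      have "{c k, c (Suc k mod l)} \<noteq> {c (l - 1), c (Suc (l - 1) mod l)}"
        using inj_onD[OF inj_on_cycle_edges[OF l], of k "l - 1"] Suc.prems l by auto
      then have "{c k, c (Suc k)} \<in> ?S" using cE[of k] Suc.prems e by simp
      then have "(c k, c (Suc k)) \<in> colour_link f ?S a"
        unfolding colour_link_def using mono Suc.prems by auto
      then show ?case using Suc by (meson Suc_lessD rtrancl.rtrancl_into_rtrancl)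
    qed simp
    have symS: "sym ((colour_link f ?S b)\<^sup>*)" for b
      by (rule sym_rtrancl[OF sym_colour_link])
    have closed: "(x, y) \<in> (colour_link f ?S b)\<^sup>*" if xy: "(x, y) \<in> colour_link f T b" for x y b
    proof (cases "{x, y} = ?e")
      case False
      then have "(x, y) \<in> colour_link f ?S b" using xy by (simp add: colour_link_def)
      then show ?thesis by blast
    next
      case True
      then have or: "x = c (l - 1) \<and> y = c 0 \<or> x = c 0 \<and> y = c (l - 1)" by (simp add: doubleton_eq_iff)
      have "{x, y} \<in> E" "b \<in> f x \<inter> f y" using xy TE by (auto simp: colour_link_def)
      moreover have "a \<in> f x \<inter> f y" using mono[of 0] mono[of "l - 1"] or l by auto
      \<comment> \<open>The dropped edge links its ends in no colour but \<open>a\<close>, so the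
        components of all other colours are untouched.\<close>
      ultimately have "b = a" using uniq by blast
      moreover have "(c 0, c (l - 1)) \<in> (colour_link f ?S a)\<^sup>*" using path l by simp
      ultimately show ?thesis using or symD[OF symS] by blast
    qed
    have "(colour_link f ?S b)\<^sup>* = (colour_link f T b)\<^sup>*" for b
    proof
      show "(colour_link f ?S b)\<^sup>* \<subseteq> (colour_link f T b)\<^sup>*"
        by (rule rtrancl_mono[OF colour_link_mono]) blast
      have "colour_link f T b \<subseteq> (colour_link f ?S b)\<^sup>*" using closed by auto
      then show "(colour_link f T b)\<^sup>* \<subseteq> (colour_link f ?S b)\<^sup>*"
        using rtrancl_subset_rtrancl by blast
    qed
    \<comment> \<open>The dropped edge has a colour, so it is not one of the colourless edges that
      have to stay.\<close>
    moreover have "\<exists>a. \<forall>v\<in>?e. a \<in> f v" using mono l by (intro exI[of _ a]) auto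
    then have "{e \<in> E. \<nexists>a. \<forall>v\<in>e. a \<in> f v} \<subseteq> ?S" using PT unfolding P_def by blast
    ultimately have "P ?S" using PT unfolding P_def by auto
    then have "card T \<le> card ?S" by (rule min)
    moreover have "card ?S < card T" using eT finite_subset[OF TE fin] by (metis card_Diff1_less)
    ultimately show False by simp
  qed
  show thesis
  proof (rule that[OF TE _ _ nomono])
    show "{e \<in> E. \<nexists>a. \<forall>v\<in>e. a \<in> f v} \<subseteq> T" using PT by (simp add: P_def)
    show "(colour_link f T a)\<^sup>* = (colour_link f E a)\<^sup>*" for a using PT by (simp add: P_def)
  qed
qed

text \<open>Following the orientation backwards: a vertex \<open>u\<close> that is the head of no edge of a connected
  set is the only one.\<close>

lemma reachable_is_head:
  assumes inj: "inj_on \<phi> T" and head: "\<And>e. e \<in> T \<Longrightarrow> \<phi> e \<in> e"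
    and L: "\<And>x y. (x, y) \<in> L \<Longrightarrow> {x, y} \<in> T"
    and P: "\<And>x. (u, x) \<in> L\<^sup>* \<Longrightarrow> x \<in> P" and u: "u \<notin> \<phi> ` {e \<in> T. e \<subseteq> P}"
    and x: "(u, x) \<in> L\<^sup>*"
  shows "x \<in> insert u (\<phi> ` {e \<in> T. e \<subseteq> P})"
proof -
  define D where "D = {(x, y). {x, y} \<in> T \<and> {x, y} \<subseteq> P \<and> \<phi> {x, y} = y}"
  have "(u, x) \<in> D\<^sup>*"
    using x
  proof (induction rule: rtrancl_induct)
    case (step x y)
    have e: "{x, y} \<in> T" using L step(2) by blast
    have "(u, y) \<in> L\<^sup>*" using step(1,2) by (rule rtrancl.rtrancl_into_rtrancl)
    then have xyP: "{x, y} \<subseteq> P" using P step(1) by blast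
    have "\<phi> {x, y} = x \<or> \<phi> {x, y} = y" using head[OF e] by blast
    then show ?case
    proof
      assume "\<phi> {x, y} = y"
      then have "(x, y) \<in> D" unfolding D_def using e xyP by blast
      with step(3) show ?thesis by (rule rtrancl.rtrancl_into_rtrancl)
    next
      \<comment> \<open>As \<open>x\<close> differs from \<open>u\<close>, it was reached along an
        edge with head \<open>x\<close>. By injectivity this is \<open>{x, y}\<close>, so
        \<open>y\<close> was reached before.\<close>
      assume hx: "\<phi> {x, y} = x"
      then have "x \<noteq> u" using u e xyP by (metis (mono_tags, lifting) CollectI image_eqI)
      with step(3) obtain x' where x': "(u, x') \<in> D\<^sup>*" "(x', x) \<in> D" by (metis rtranclE)
      then have "\<phi> {x', x} = \<phi> {x, y}" "{x', x} \<in> T" using hx by (auto simp: D_def)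
      then have "{x', x} = {x, y}" using inj_onD[OF inj] e by blast
      then have "x' = y" by (auto simp: doubleton_eq_iff)
      then show ?thesis using x' by simp
    qed
  qed simp
  then show ?thesis
  proof (cases rule: rtranclE)
    case (step y)
    then show ?thesis unfolding D_def by (metis (mono_tags, lifting) CollectD CollectI case_prodD image_eqI insertI2)
  qed simp
qed

text \<open>Colourless edges and monochromatic components form \<open>\<P>\<close>, and
  \<open>C P\<close> collects the heads of the chosen edges inside \<open>P\<close>. Sharing at most
  one vertex means that no edge lies in two blobs, so injectivity of the orientation makes the sets
  \<open>C P\<close> disjoint. Connectedness within the chosen edges leaves at most one vertex of a
  component outside of \<open>C P\<close>.\<close>

lemma blob_decomposition:
  assumes finW: "finite W" and two: "\<And>e. e \<in> E \<Longrightarrow> card e = 2" and EW: "\<Union>E \<subseteq> W"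
    and uniq: "\<And>u v a b. u \<in> W \<Longrightarrow> v \<in> W \<Longrightarrow> u \<noteq> v \<Longrightarrow> a \<in> f u \<inter> f v \<Longrightarrow> b \<in> f u \<inter> f v \<Longrightarrow> a = b"
    and short: "\<And>l c. is_cycle E l c \<Longrightarrow> 3 * l \<le> 2 * (card W + 1) \<Longrightarrow> \<exists>a. \<forall>i<l. a \<in> f (c i)"
  obtains \<P> C rt where
    "\<And>P. P \<in> \<P> \<Longrightarrow> P \<subseteq> W"
    "\<And>P. P \<in> \<P> \<Longrightarrow> C P \<subseteq> P"
    "\<And>P. P \<in> \<P> \<Longrightarrow> P \<subseteq> insert (rt P) (C P)"
    "\<And>P Q. P \<in> \<P> \<Longrightarrow> Q \<in> \<P> \<Longrightarrow> P \<noteq> Q \<Longrightarrow> C P \<inter> C Q = {}"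
    "\<And>P Q x y. P \<in> \<P> \<Longrightarrow> Q \<in> \<P> \<Longrightarrow> P \<noteq> Q \<Longrightarrow> x \<in> P \<inter> Q \<Longrightarrow> y \<in> P \<inter> Q \<Longrightarrow> x = y"
    "\<And>e. e \<in> E \<Longrightarrow> \<exists>P\<in>\<P>. e \<subseteq> P"
    "\<And>P. P \<in> \<P> \<Longrightarrow> (\<exists>a. \<forall>v\<in>P. a \<in> f v) \<or> card (C P) \<le> 1"
proof -
  have finE: "finite E" using EW finW by (metis finite_UnionD finite_subset)
  have uniqE: "a = b" if "{u, v} \<in> E" "a \<in> f u \<inter> f v" "b \<in> f u \<inter> f v" for u v a b
  proof (rule uniq)
    show "u \<in> W" "v \<in> W" using that(1) EW by auto
    show "u \<noteq> v" using two[OF that(1)] by auto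
  qed (use that in auto)
  let ?bad = "{e \<in> E. \<nexists>a. \<forall>v\<in>e. a \<in> f v}"
  obtain T where T: "T \<subseteq> E" "?bad \<subseteq> T" "\<And>a. (colour_link f T a)\<^sup>* = (colour_link f E a)\<^sup>*"
    and nomono: "\<And>l c a. is_cycle T l c \<Longrightarrow> \<exists>i<l. a \<notin> f (c i)"
  proof (rule exists_colour_spanning_subset[of E f, OF finE])
    show "card e = 2" if "e \<in> E" for e by (rule two[OF that])
    show "a = b" if "{u, v} \<in> E" "a \<in> f u \<inter> f v" "b \<in> f u \<inter> f v" for u v a b
      by (rule uniqE[OF that])
  qed (rule that)
  have finT: "finite T" using T(1) finE finite_subset by blast
  have long: "2 * (card W + 1) < 3 * l" if c: "is_cycle T l c" for l c
  proof (rule ccontr)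
    assume "\<not> ?thesis"
    then obtain a where "\<forall>i<l. a \<in> f (c i)"
      using short[OF is_cycle_mono[OF c T(1)]] by auto
    then show False using nomono[OF c] by blast
  qed
  have "\<exists>\<phi>. inj_on \<phi> T \<and> (\<forall>e\<in>T. \<phi> e \<in> e)"
  proof (rule orientation_without_short_cycles[OF finT _ _ finW])
    show "card e = 2" if "e \<in> T" for e using two T(1) that by blast
    show "\<Union>T \<subseteq> W" using T(1) EW by blast
    show "2 * (card W + 1) < 3 * l" if "is_cycle T l c" for l c by (rule long[OF that])
  qed
  then obtain \<phi> where \<phi>: "inj_on \<phi> T" "\<And>e. e \<in> T \<Longrightarrow> \<phi> e \<in> e" by blast
  let ?comp = "\<lambda>a x. (colour_link f E a)\<^sup>* `` {x}"
  define K where "K = {?comp a x | a x. x \<in> W \<and> a \<in> f x}"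
  define \<P> where "\<P> = ?bad \<union> K"
  define C where "C = (\<lambda>P. \<phi> ` {e \<in> T. e \<subseteq> P})"
  have reach: "y \<in> W \<and> a \<in> f y" if "(x, y) \<in> (colour_link f E a)\<^sup>*" "x \<in> W" "a \<in> f x" for x y a
    using that
  proof (induction rule: rtrancl_induct)
    case (step y z)
    then show ?case using EW unfolding colour_link_def by auto
  qed simp
  have Kcol: "P \<subseteq> W \<and> (\<exists>a. \<forall>v\<in>P. a \<in> f v)" if "P \<in> K" for P
    using that reach unfolding K_def by blast
  have symE: "sym ((colour_link f E a)\<^sup>*)" for a by (rule sym_rtrancl[OF sym_colour_link])
  \<comment> \<open>Two distinct vertices determine the colour, and then each of them determines the
    whole component.\<close>
  have comp_eq: "P = ?comp a x" if P: "P \<in> K" and a: "\<And>v. v \<in> P \<Longrightarrow> a \<in> f v" and x: "x \<in> P" and y: "y \<in> P" "x \<noteq> y" for P a x y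
  proof -
    obtain b z where bz: "P = ?comp b z" "z \<in> W" "b \<in> f z" using P unfolding K_def by blast
    have "b \<in> f x \<inter> f y" "x \<in> W" "y \<in> W" using reach[OF _ bz(2,3)] x y(1) unfolding bz(1) by auto
    then have "b = a" using uniq[of x y b a] a[OF x] a[OF y(1)] y(2) by blast
    have zx: "(z, x) \<in> (colour_link f E b)\<^sup>*" using x unfolding bz(1) by simp
    then have "(x, z) \<in> (colour_link f E b)\<^sup>*" by (rule symD[OF symE])
    then have "?comp b z = ?comp b x" using zx by (auto intro: rtrancl_trans)
    then show ?thesis using bz(1) \<open>b = a\<close> by simp
  qed
  have PW: "P \<subseteq> W" if "P \<in> \<P>" for P
    using that Kcol EW unfolding \<P>_def by blast
  have inter: "x = y" if P: "P \<in> \<P>" and Q: "Q \<in> \<P>" and "P \<noteq> Q" and xy: "x \<in> P \<inter> Q" "y \<in> P \<inter> Q" for P Q x y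
  proof (rule ccontr)
    assume "x \<noteq> y"
    have bad_eq: "B = {x, y}" if "B \<in> ?bad" "x \<in> B" "y \<in> B" for B
      using two[of B] that \<open>x \<noteq> y\<close> by (auto simp: card_2_iff)
    have not_bad: False if "B \<in> ?bad" "x \<in> B" "y \<in> B" "D \<in> K" "x \<in> D" "y \<in> D" for B D
    proof -
      obtain a where "\<forall>v\<in>D. a \<in> f v" using Kcol[OF \<open>D \<in> K\<close>] by blast
      then have "\<forall>v\<in>B. a \<in> f v" using bad_eq[OF that(1-3)] that(5,6) by blast
      then show False using \<open>B \<in> ?bad\<close> by blast
    qed
    consider "P \<in> ?bad" "Q \<in> ?bad" | "P \<in> ?bad" "Q \<in> K" | "P \<in> K" "Q \<in> ?bad" | "P \<in> K" "Q \<in> K"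
      using P Q unfolding \<P>_def by blast
    then show False
    proof cases
      case 1
      have "P = {x, y}" "Q = {x, y}" using bad_eq[OF 1(1)] bad_eq[OF 1(2)] xy by auto
      then show False using \<open>P \<noteq> Q\<close> by simp
    next
      case 2
      then show False using not_bad[OF 2(1) _ _ 2(2)] xy by blast
    next
      case 3
      then show False using not_bad[OF 3(2) _ _ 3(1)] xy by blast
    next
      case 4
      obtain a where a: "\<forall>v\<in>P. a \<in> f v" using Kcol[OF 4(1)] by blast
      obtain b where b: "\<forall>v\<in>Q. b \<in> f v" using Kcol[OF 4(2)] by blast
      have "x \<in> W" "y \<in> W" using PW[OF P] xy by auto
      then have "a = b" using uniq[of x y a b] a b xy \<open>x \<noteq> y\<close> by blast
      then have "P = ?comp a x" "Q = ?comp a x"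
        using comp_eq[OF 4(1), of a x y] comp_eq[OF 4(2), of a x y] a b xy \<open>x \<noteq> y\<close> by auto
      then show False using \<open>P \<noteq> Q\<close> by simp
    qed
  qed
  have CP: "C P \<subseteq> P" for P unfolding C_def using \<phi>(2) by blast
  have disj: "C P \<inter> C Q = {}" if "P \<in> \<P>" "Q \<in> \<P>" "P \<noteq> Q" for P Q
  proof (rule ccontr)
    assume "C P \<inter> C Q \<noteq> {}"
    then obtain e e' where e: "e \<in> T" "e \<subseteq> P" "e' \<in> T" "e' \<subseteq> Q" "\<phi> e = \<phi> e'"
      unfolding C_def by blast
    then have "e' = e" using inj_onD[OF \<phi>(1)] by metis
    moreover obtain x y where "e = {x, y}" "x \<noteq> y" using two[of e] e(1) T(1) by (auto simp: card_2_iff)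
    ultimately show False using inter[OF that, of x y] e by blast
  qed
  have bad_C: "C P = {\<phi> P}" if "P \<in> ?bad" for P
  proof -
    have "{e \<in> T. e \<subseteq> P} = {P}"
    proof (intro subset_antisym subsetI)
      fix e assume e: "e \<in> {e \<in> T. e \<subseteq> P}"
      then have "card e = 2" "card P = 2" using two T(1) that by auto
      then have "e = P" using e by (intro card_subset_eq) (auto intro: card_ge_0_finite)
      then show "e \<in> {P}" by simp
    qed (use that T(2) in auto)
    then show ?thesis unfolding C_def by simp
  qed
  have root: "\<exists>u. P \<subseteq> insert u (C P)" if P: "P \<in> \<P>" for P
  proof (cases "P \<in> ?bad")
    case True
    then obtain x y where xy: "P = {x, y}" using two[of P] by (auto simp: card_2_iff)
    define p where "p = \<phi> P"
    have "p \<in> P" unfolding p_def using \<phi>(2)[of P] T(2) True by blast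
    then have "P \<subseteq> insert x {p} \<or> P \<subseteq> insert y {p}" unfolding xy by blast
    then have "P \<subseteq> insert x {\<phi> P} \<or> P \<subseteq> insert y {\<phi> P}" unfolding p_def .
    then show ?thesis using bad_C[OF True] by metis
  next
    case False
    then have PK: "P \<in> K" using P unfolding \<P>_def by blast
    then obtain a z where az: "P = ?comp a z" "z \<in> W" "a \<in> f z" unfolding K_def by blast
    show ?thesis
    \<comment> \<open>Any vertex that is not a head can serve as root; if there is none, the root is
      arbitrary.\<close>
    proof (cases "P \<subseteq> C P")
      case False
      then obtain u where u: "u \<in> P" "u \<notin> C P" by blast
      have zu: "(z, u) \<in> (colour_link f E a)\<^sup>*" using u(1) unfolding az(1) by simp
      then have uz: "(u, z) \<in> (colour_link f E a)\<^sup>*" by (rule symD[OF symE])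
      have "x \<in> insert u (C P)" if "x \<in> P" for x
        unfolding C_def
      proof (rule reachable_is_head[OF \<phi>])
        show "{p, q} \<in> T" if "(p, q) \<in> colour_link f T a" for p q
          using that by (simp add: colour_link_def)
        show "p \<in> P" if "(u, p) \<in> (colour_link f T a)\<^sup>*" for p
          using that zu unfolding T(3) az(1) by (auto intro: rtrancl_trans)
        show "u \<notin> \<phi> ` {e \<in> T. e \<subseteq> P}" using u(2) unfolding C_def .
        show "(u, x) \<in> (colour_link f T a)\<^sup>*"
          using \<open>x \<in> P\<close> uz unfolding T(3) az(1) by (auto intro: rtrancl_trans)
      qed
      then show ?thesis by blast
    qed blast
  qed
  then obtain rt where rt: "\<And>P. P \<in> \<P> \<Longrightarrow> P \<subseteq> insert (rt P) (C P)" by metis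
  have cover: "\<exists>P\<in>\<P>. e \<subseteq> P" if e: "e \<in> E" for e
  proof (cases "e \<in> ?bad")
    case True
    then show ?thesis unfolding \<P>_def by blast
  next
    case False
    then obtain a where a: "\<forall>v\<in>e. a \<in> f v" using e by blast
    obtain x y where xy: "e = {x, y}" using two[OF e] by (auto simp: card_2_iff)
    then have "(x, y) \<in> colour_link f E a" using a e by (simp add: colour_link_def)
    then have "e \<subseteq> ?comp a x" using xy by blast
    moreover have "x \<in> W" using xy e EW by blast
    then have "?comp a x \<in> K" unfolding K_def using a xy by blast
    ultimately show ?thesis unfolding \<P>_def by blast
  qed
  have col: "(\<exists>a. \<forall>v\<in>P. a \<in> f v) \<or> card (C P) \<le> 1" if "P \<in> \<P>" for P
  proof (cases "P \<in> ?bad")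
    case True
    then show ?thesis using bad_C[OF True] by simp
  next
    case False
    then have "P \<in> K" using that unfolding \<P>_def by blast
    then show ?thesis using Kcol by blast
  qed
  show thesis
  proof (rule that[of \<P> C rt])
    show "P \<subseteq> W" if "P \<in> \<P>" for P by (rule PW[OF that])
    show "C P \<subseteq> P" for P by (rule CP)
    show "P \<subseteq> insert (rt P) (C P)" if "P \<in> \<P>" for P by (rule rt[OF that])
    show "C P \<inter> C Q = {}" if "P \<in> \<P>" "Q \<in> \<P>" "P \<noteq> Q" for P Q by (rule disj[OF that])
    show "x = y" if "P \<in> \<P>" "Q \<in> \<P>" "P \<noteq> Q" "x \<in> P \<inter> Q" "y \<in> P \<inter> Q" for P Q x y
      by (rule inter[OF that])
    show "\<exists>P\<in>\<P>. e \<subseteq> P" if "e \<in> E" for e by (rule cover[OF that])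
    show "(\<exists>a. \<forall>v\<in>P. a \<in> f v) \<or> card (C P) \<le> 1" if "P \<in> \<P>" for P by (rule col[OF that])
  qed
qed

section \<open>Weights of edges with vanishing coboundary\<close>

text \<open>Choosing one preimage for each element of \<open>B\<close> avoids any injectivity
  assumption on \<open>f\<close>; the remaining values of \<open>h\<close> are nonnegative.\<close>

lemma sum_le_sum_image:
  fixes g :: "'b \<Rightarrow> real"
  assumes "finite A" "B \<subseteq> f ` A" "\<And>a. a \<in> A \<Longrightarrow> f a \<in> B \<Longrightarrow> g (f a) \<le> h a"
    and "\<And>a. a \<in> A \<Longrightarrow> 0 \<le> h a"
  shows "sum g B \<le> sum h A"
proof -
  have "\<exists>a\<in>A. f a = b" if "b \<in> B" for b using assms(2) that by blast
  then obtain s where s: "\<And>b. b \<in> B \<Longrightarrow> s b \<in> A \<and> f (s b) = b" by metis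
  have "inj_on s B" using s by (metis inj_onI)
  have "sum g B \<le> (\<Sum>b\<in>B. h (s b))"
    using s assms(3) by (intro sum_mono) metis
  also have "\<dots> = sum h (s ` B)" using \<open>inj_on s B\<close> by (simp add: sum.reindex)
  also have "\<dots> \<le> sum h A" using s assms by (intro sum_mono2) auto
  finally show ?thesis .
qed

text \<open>Pure arithmetic that converts the stated fraction into the bound needed to balance the
  two cases. For \<open>lam \<ge> 0\<close> the spectral terms are at least \<open>8 r lam\<close>,
  so positivity of \<open>N\<close> gives \<open>lam < 1 / 4\<close>. For \<open>lam < 0\<close>
  they are nonnegative and \<open>Q\<close> is at least \<open>5 r + 2\<close>.\<close>

lemma edge_threshold:
  fixes r t lam L N Q :: real
  assumes r: "1 \<le> r" and t: "0 \<le> t" and L: "L = max lam 0" and m: "\<bar>lam\<bar> \<le> m"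
    and N: "N \<le> 2 * r - 4 * r * lam - 4 * r\<^sup>2 * m - (5 * r + 2) * t" "0 < N"
    and Q: "Q = 5 * r + 2 - 2 * r * lam" "0 < Q"
  shows "L < 1 \<and> N / Q \<le> 2 / 3 * (1 - L) - 4 / 3 * t"
proof -
  have rr: "r \<le> r\<^sup>2" using r by (simp add: power2_eq_square)
  have "r * \<bar>lam\<bar> \<le> r\<^sup>2 * m" using rr m r by (intro mult_mono) auto
  then have N1: "N \<le> 2 * r - 4 * (r * lam) - 4 * (r * \<bar>lam\<bar>) - (5 * r + 2) * t" using N(1) by simp
  show ?thesis
  proof (cases "0 \<le> lam")
    case True
    then have [simp]: "L = lam" using L by simp
    have N2: "N \<le> 2 * r - 8 * (r * lam) - (5 * r + 2) * t" using N1 unfolding abs_of_nonneg[OF True] by linarith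
    have "0 \<le> (5 * r + 2) * t" using r t by simp
    then have "0 < 2 * r - 8 * (r * lam)" using N2 N(2) by linarith
    then have "0 < r * (1 - 4 * lam)" by (simp add: algebra_simps)
    then have lam: "lam < 1 / 4" using r by (simp add: zero_less_mult_iff)
    \<comment> \<open>Positivity of \<open>N\<close> limits \<open>t\<close>, which absorbs the
      larger multiple of \<open>t\<close> in the target.\<close>
    have h: "(5 * r + 2) * t \<le> 2 * r" using N2 N(2) True r mult_nonneg_nonneg[of r lam] by linarith
    have "0 \<le> r * lam * t" using r True t by simp
    have "0 \<le> r * lam * lam" using r True by simp
    have "0 \<le> (r - 1) * lam" using r True by simp
    then have "lam \<le> r * lam" by (simp add: algebra_simps)
    have "3 * N \<le> 6 * r - 24 * (r * lam) - 3 * ((5 * r + 2) * t)" using N2 by simp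
    also have "\<dots> \<le> (2 * (1 - lam) - 4 * t) * Q"
    proof -
      have "(2 * (1 - lam) - 4 * t) * Q = 10 * r + 4 - 4 * (r * lam) - 10 * (r * lam) - 4 * lam
          + 4 * (r * lam * lam) - 4 * ((5 * r + 2) * t) + 8 * (r * lam * t)"
        unfolding Q(1) by (simp add: algebra_simps)
      then show ?thesis
        using h \<open>0 \<le> r * lam * t\<close> \<open>0 \<le> r * lam * lam\<close> \<open>lam \<le> r * lam\<close> r True by linarith
    qed
    finally have "N \<le> (2 / 3 * (1 - lam) - 4 / 3 * t) * Q" by (simp add: algebra_simps)
    then show ?thesis using Q(2) lam by (simp add: pos_divide_le_eq)
  next
    case False
    then have [simp]: "L = 0" using L by simp
    have N2: "N \<le> 2 * r - (5 * r + 2) * t" using N1 False by simp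
    have Q2: "5 * r + 2 \<le> Q" unfolding Q(1) using False r by (simp add: mult_nonneg_nonpos)
    have "N / Q \<le> N / (5 * r + 2)"
      using N(2) Q2 r by (intro divide_left_mono) auto
    also have "\<dots> \<le> (2 * r - (5 * r + 2) * t) / (5 * r + 2)"
      using N2 r by (intro divide_right_mono) auto
    also have "\<dots> = 2 * r / (5 * r + 2) - t" using r by (simp add: diff_divide_distrib)
    also have "\<dots> \<le> 2 / 3 - 4 / 3 * t"
    proof -
      have "(5 * r + 2) * t \<le> 2 * r" using N2 N(2) by linarith
      then have "t \<le> 2 * r / (5 * r + 2)" using r by (simp add: pos_le_divide_eq mult.commute)
      moreover have "2 * r / (5 * r + 2) \<le> 1 / 2" using r by (simp add: divide_le_eq)
      ultimately show ?thesis by linarith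
    qed
    finally show ?thesis by simp
  qed
qed

context partite_weighted_complex
begin

lemma sum_weight_le_1: "S \<subseteq> verts \<Longrightarrow> (\<Sum>v\<in>S. w {v}) \<le> 1"
  using sum_mono2[of verts S "\<lambda>v. w {v}"] finite_verts weight_pos sum_weight by (force simp: less_imp_le)

lemma edge_weight_ge_0: "e \<in> faces X 1 \<Longrightarrow> 0 \<le> w e"
  using weight_nonneg by (simp add: faces_def)

text \<open>Each edge is assigned to one blob containing it. Inside \<open>C P\<close> the
  hypothesis \<open>inner\<close> applies; every other edge of the blob contains \<open>rt P\<close>
  and is charged to its end in \<open>C P\<close> at rate \<open>t\<close>. Disjointness bounds the
  total weight by 1.\<close>

lemma sum_edges_by_blobs:
  assumes E: "E \<subseteq> faces X 1" and cover: "\<And>e. e \<in> E \<Longrightarrow> \<exists>P\<in>\<P>. e \<subseteq> P"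
    and PW: "\<And>P. P \<in> \<P> \<Longrightarrow> P \<subseteq> verts" and CP: "\<And>P. P \<in> \<P> \<Longrightarrow> C P \<subseteq> P"
    and rt: "\<And>P. P \<in> \<P> \<Longrightarrow> P \<subseteq> insert (rt P) (C P)"
    and disj: "\<And>P Q. P \<in> \<P> \<Longrightarrow> Q \<in> \<P> \<Longrightarrow> P \<noteq> Q \<Longrightarrow> C P \<inter> C Q = {}"
    and t: "\<And>e v. e \<in> faces X 1 \<Longrightarrow> v \<in> e \<Longrightarrow> w e \<le> t * w {v}" and t0: "0 \<le> t" and k0: "0 \<le> k"
    and inner: "\<And>P. P \<in> \<P> \<Longrightarrow> (\<Sum>e | e \<in> faces X 1 \<and> e \<subseteq> C P. w e) \<le> k * (\<Sum>v\<in>C P. w {v})"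
  shows "(\<Sum>e\<in>E. w e) \<le> k + t"
proof -
  have fin\<P>: "finite \<P>" 
  proof (rule finite_subset)
    show "\<P> \<subseteq> Pow verts" using PW by blast
  qed (simp add: finite_verts)
  have finE: "finite E" by (rule finite_subset[OF E finite_faces])
  have "\<exists>P. P \<in> \<P> \<and> e \<subseteq> P" if "e \<in> E" for e using cover[OF that] by blast
  then obtain pr where pr: "\<And>e. e \<in> E \<Longrightarrow> pr e \<in> \<P> \<and> e \<subseteq> pr e" by metis
  have blob: "(\<Sum>e | e \<in> faces X 1 \<and> e \<subseteq> P. w e) \<le> (k + t) * (\<Sum>v\<in>C P. w {v})" if P: "P \<in> \<P>" for P
  proof -
    let ?I = "{e. e \<in> faces X 1 \<and> e \<subseteq> C P}" and ?A = "{e. e \<in> faces X 1 \<and> e \<subseteq> P}"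
    let ?R = "?A - ?I"
    have f: "finite ?A" using finite_faces[of 1] by simp
    have CW: "C P \<subseteq> verts" using CP[OF P] PW[OF P] by blast
    then have fC: "finite (C P)" using finite_verts by (rule finite_subset)
    have posC: "0 \<le> w {v}" if "v \<in> C P" for v
      using weight_pos[of v] CW that by auto
    have "?R \<subseteq> (\<lambda>v. {rt P, v}) ` C P"
    proof
      fix e assume e: "e \<in> ?R"
      then obtain a b where ab: "e = {a, b}" "a \<noteq> b" by (auto simp: faces_1_eq card_2_iff)
      have "a \<in> insert (rt P) (C P)" "b \<in> insert (rt P) (C P)" using e ab rt[OF P] by auto
      moreover have "a \<notin> C P \<or> b \<notin> C P" using e ab by auto
      ultimately have "a = rt P \<and> b \<in> C P \<or> b = rt P \<and> a \<in> C P" using ab(2) by auto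
      then show "e \<in> (\<lambda>v. {rt P, v}) ` C P" using ab(1) by (auto simp: insert_commute)
    qed
    then have "sum w ?R \<le> (\<Sum>v\<in>C P. if {rt P, v} \<in> faces X 1 then w {rt P, v} else 0)"
    proof -
      assume sub: "?R \<subseteq> (\<lambda>v. {rt P, v}) ` C P"
      have "sum w ?R = (\<Sum>e\<in>?R. if e \<in> faces X 1 then w e else 0)" by (rule sum.cong) auto
      also have "\<dots> \<le> (\<Sum>v\<in>C P. if {rt P, v} \<in> faces X 1 then w {rt P, v} else 0)"
        by (rule sum_le_sum_image[OF fC sub]) (auto simp: edge_weight_ge_0)
      finally show ?thesis .
    qed
    also have "\<dots> \<le> (\<Sum>v\<in>C P. t * w {v})"
      using t t0 posC by (intro sum_mono) auto
    finally have R: "sum w ?R \<le> t * (\<Sum>v\<in>C P. w {v})" by (simp add: sum_distrib_left)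
    have "?I \<subseteq> ?A" using CP[OF P] by auto
    then have "sum w ?A = sum w ?R + sum w ?I" using f by (rule sum.subset_diff)
    then show ?thesis using R inner[OF P] by (simp add: distrib_right)
  qed
  have "(\<Sum>e\<in>E. w e) = (\<Sum>P\<in>\<P>. \<Sum>e | e \<in> E \<and> pr e = P. w e)"
    using pr by (intro sum.group[OF finE fin\<P>, symmetric]) auto
  also have "\<dots> \<le> (\<Sum>P\<in>\<P>. \<Sum>e | e \<in> faces X 1 \<and> e \<subseteq> P. w e)"
  proof (rule sum_mono, rule sum_mono2)
    fix P
    show "finite {e. e \<in> faces X 1 \<and> e \<subseteq> P}" using finite_faces[of 1] by simp
    show "{e. e \<in> E \<and> pr e = P} \<subseteq> {e. e \<in> faces X 1 \<and> e \<subseteq> P}" using E pr by blast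
  qed (simp add: edge_weight_ge_0)
  also have "\<dots> \<le> (\<Sum>P\<in>\<P>. (k + t) * (\<Sum>v\<in>C P. w {v}))"
    by (rule sum_mono) (rule blob)
  also have "\<dots> = (k + t) * (\<Sum>v\<in>(\<Union>P\<in>\<P>. C P). w {v})"
  proof -
    have "(\<Sum>v\<in>(\<Union>P\<in>\<P>. C P). w {v}) = (\<Sum>P\<in>\<P>. \<Sum>v\<in>C P. w {v})"
    proof (rule sum.UNION_disjoint[OF fin\<P>]; intro ballI impI)
      show "finite (C P)" if "P \<in> \<P>" for P
        using finite_subset[OF subset_trans[OF CP[OF that] PW[OF that]] finite_verts] .
      show "C P \<inter> C Q = {}" if "P \<in> \<P>" "Q \<in> \<P>" "P \<noteq> Q" for P Q
        by (rule disj[OF that])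
    qed
    then show ?thesis by (simp add: sum_distrib_left)
  qed
  also have "\<dots> \<le> (k + t) * 1"
  proof (rule mult_left_mono)
    have "(\<Union>P\<in>\<P>. C P) \<subseteq> verts" using CP PW by blast
    then show "(\<Sum>v\<in>(\<Union>P\<in>\<P>. C P). w {v}) \<le> 1" by (rule sum_weight_le_1)
  qed (use k0 t0 in simp)
  finally show ?thesis by simp
qed

text \<open>A blob other than \<open>P\<close> meets \<open>P\<close> in a single vertex. An edge leaving \<open>P\<close> is charged to its
  end outside of \<open>P\<close>; this is injective for the edges whose outer end is not a root, and there is at
  most one other edge, since its inner end can only be the root of \<open>P\<close>.\<close>

lemma sum_leaving_edges:
  assumes E: "E \<subseteq> faces X 1" and cover: "\<And>e. e \<in> E \<Longrightarrow> \<exists>P\<in>\<P>. e \<subseteq> P"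
    and rt: "\<And>P. P \<in> \<P> \<Longrightarrow> P \<subseteq> insert (rt P) (C P)"
    and disj: "\<And>P Q. P \<in> \<P> \<Longrightarrow> Q \<in> \<P> \<Longrightarrow> P \<noteq> Q \<Longrightarrow> C P \<inter> C Q = {}"
    and inter: "\<And>P Q x y. P \<in> \<P> \<Longrightarrow> Q \<in> \<P> \<Longrightarrow> P \<noteq> Q \<Longrightarrow> x \<in> P \<inter> Q \<Longrightarrow> y \<in> P \<inter> Q \<Longrightarrow> x = y"
    and t: "\<And>e v. e \<in> faces X 1 \<Longrightarrow> v \<in> e \<Longrightarrow> w e \<le> t * w {v}" and t0: "0 \<le> t"
    and P: "P \<in> \<P>" and K: "K \<subseteq> E" "\<And>e. e \<in> K \<Longrightarrow> e \<inter> P \<noteq> {} \<and> \<not> e \<subseteq> P"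
  shows "(\<Sum>e\<in>K. w e) \<le> 2 * t * (\<Sum>v\<in>verts - P. w {v})"
proof -
  let ?b = "\<Sum>v\<in>verts - P. w {v}"
  have ends: "\<exists>x y. e = {x, y} \<and> x \<in> P \<and> y \<in> verts - P" if e: "e \<in> K" for e
  proof -
    have "e \<in> faces X 1" using e K(1) E by blast
    then obtain a b where "e = {a, b}" by (auto simp: faces_1_eq card_2_iff)
    then show ?thesis using K(2)[OF e] edge_subset_verts[OF \<open>e \<in> faces X 1\<close>] by blast
  qed
  \<comment> \<open>Here \<open>i e\<close> is the end inside \<open>P\<close>, \<open>j e\<close>
    the end outside, and \<open>pr e\<close> a blob containing \<open>e\<close>. As
    \<open>pr e\<close> meets \<open>P\<close> only in \<open>i e\<close>, equal blobs give equal
    inner ends.\<close>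
  then obtain i where "\<And>e. e \<in> K \<Longrightarrow> \<exists>y. e = {i e, y} \<and> i e \<in> P \<and> y \<in> verts - P" by metis
  then obtain j where ij: "\<And>e. e \<in> K \<Longrightarrow> e = {i e, j e} \<and> i e \<in> P \<and> j e \<in> verts - P" by metis
  have "\<exists>Q. Q \<in> \<P> \<and> e \<subseteq> Q" if "e \<in> K" for e using cover[of e] K(1) that by blast
  then obtain pr where pr: "\<And>e. e \<in> K \<Longrightarrow> pr e \<in> \<P> \<and> e \<subseteq> pr e" by metis
  have ipr: "i e \<in> P \<inter> pr e" and jpr: "j e \<in> pr e" if "e \<in> K" for e
    using ij[OF that] pr[OF that] by auto
  have neP: "pr e \<noteq> P" if "e \<in> K" for e using K(2)[OF that] pr[OF that] by auto
  have i_eq: "i e = i e'" if "e \<in> K" "e' \<in> K" "pr e = pr e'" for e e'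
    using inter[OF P _ _ ipr[OF that(1)], of "i e'"] pr[OF that(1)] neP[OF that(1)] ipr[OF that(2)] that(3)
    by auto
  have bound: "w e \<le> t * w {j e}" if "e \<in> K" for e
  proof (rule t)
    show "e \<in> faces X 1" using that K(1) E by blast
    show "j e \<in> e" using ij[OF that] by blast
  qed
  have finK: "finite K" by (rule finite_subset[OF subset_trans[OF K(1) E] finite_faces])
  have pos: "0 \<le> w {v}" if "v \<in> verts" for v using weight_pos[OF that] by simp
  let ?K1 = "{e \<in> K. j e \<in> C (pr e)}" and ?K2 = "{e \<in> K. j e \<notin> C (pr e)}"
  have inj1: "inj_on j ?K1"
  proof (rule inj_onI)
    fix e e' assume e: "e \<in> ?K1" "e' \<in> ?K1" and jj: "j e = j e'"
    then have "C (pr e) \<inter> C (pr e') \<noteq> {}" by auto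
    then have "pr e = pr e'" using disj[of "pr e" "pr e'"] pr[of e] pr[of e'] e by blast
    then have "i e = i e'" using i_eq e by blast
    then show "e = e'" using ij[of e] ij[of e'] e jj by (metis (no_types, lifting) mem_Collect_eq)
  qed
  have K1: "sum w ?K1 \<le> t * ?b"
  proof -
    have "sum w ?K1 \<le> (\<Sum>e\<in>?K1. t * w {j e})" using bound by (intro sum_mono) auto
    also have "\<dots> = (\<Sum>v\<in>j ` ?K1. t * w {v})" using inj1 by (simp add: sum.reindex)
    also have "\<dots> \<le> (\<Sum>v\<in>verts - P. t * w {v})"
      using finite_verts ij t0 pos by (intro sum_mono2) auto
    finally show ?thesis by (simp add: sum_distrib_left)
  qed
  have K2: "sum w ?K2 \<le> t * ?b"
  proof (cases "?K2 = {}")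
    case True
    have "0 \<le> ?b" using pos by (intro sum_nonneg) auto
    then show ?thesis unfolding True using t0 by simp
  next
    case False
    then obtain e where e: "e \<in> ?K2" by blast
    \<comment> \<open>The outer end is the root of its blob, so the inner end lies in
      \<open>C (pr a)\<close>. It is therefore not in \<open>C P\<close>, and only
      \<open>rt P\<close> remains.\<close>
    have root: "i a = rt P \<and> j a = rt (pr a) \<and> i a \<in> C (pr a)" if a: "a \<in> ?K2" for a
    proof -
      have aK: "a \<in> K" using a by simp
      have ja: "j a = rt (pr a)" using rt[of "pr a"] pr[OF aK] jpr[OF aK] a by auto
      have "i a \<noteq> j a" using ij[OF aK] by auto
      then have ia: "i a \<in> C (pr a)" using rt[of "pr a"] pr[OF aK] ipr[OF aK] ja by auto
      then have "i a \<notin> C P" using disj[OF P, of "pr a"] pr[OF aK] neP[OF aK] by auto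
      then show ?thesis using rt[OF P] ipr[OF aK] ia ja by auto
    qed
    have "a = e" if a: "a \<in> ?K2" for a
    proof -
      have "i a = i e" using root[OF a] root[OF e] by simp
      then have "C (pr a) \<inter> C (pr e) \<noteq> {}" using root[OF a] root[OF e] by auto
      then have "pr a = pr e" using disj[of "pr a" "pr e"] pr[of a] pr[of e] a e by blast
      then have "j a = j e" using root[OF a] root[OF e] by simp
      then show ?thesis using ij[of a] ij[of e] a e \<open>i a = i e\<close> by (metis (no_types, lifting) mem_Collect_eq)
    qed
    then have "?K2 = {e}" using e by blast
    then have "sum w ?K2 = w e" by simp
    also have "\<dots> \<le> t * w {j e}" using bound e by simp
    also have "\<dots> \<le> t * ?b"
      using ij[of e] e finite_verts pos t0 by (intro mult_left_mono member_le_sum) auto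
    finally show ?thesis .
  qed
  have "sum w K = sum w (?K1 \<union> ?K2)" by (rule arg_cong[where f = "sum w"]) blast
  also have "\<dots> = sum w ?K1 + sum w ?K2" using finK by (intro sum.union_disjoint) auto
  finally show ?thesis using K1 K2 by simp
qed

end

section \<open>Coboundary expansion\<close>

context vertex_edge_subgroups
begin

text \<open>Each edge supplies a representative at either end whose difference lies in the edge
  group. At a vertex, the representatives from its two edges differ by an element of the vertex
  group. This is the input of \<open>cycle_common_element\<close>.\<close>

lemma short_cycle_monochromatic:
  assumes ord: "linear_order_on (\<Union>X) ord" and f: "f \<in> carrier (cochains X F 0)"
    and cyc: "is_cycle {e \<in> faces X 1. coboundary_0 ord X F f e = \<one>\<^bsub>stalk F e\<^esub>} l c"
    and disj: "\<And>Y. cycle_in X l Y \<Longrightarrow> linearly_disjoint R Y Rs"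
  shows "\<exists>a. \<forall>i<l. a \<in> f {c i}"
proof -
  let ?Y = "{{}} \<union> (\<lambda>i. {c i}) ` {..<l} \<union> cycle_edges l c"
  have l: "3 \<le> l" "inj_on c {..<l}" using cyc by (auto simp: is_cycle_def)
  have m: "Suc i mod l < l" for i using l by simp
  have "is_cycle (faces X 1) l c" by (rule is_cycle_mono[OF cyc]) blast
  then have Y: "cycle_in X l ?Y" by (rule cycle_in_of_is_cycle[OF X])
  then have YX: "?Y \<subseteq> X" by (simp only: cycle_in_def subgraph_def)
  have e: "{c i, c (Suc i mod l)} \<in> faces X 1"
    "coboundary_0 ord X F f {c i, c (Suc i mod l)} = \<one>\<^bsub>stalk F {c i, c (Suc i mod l)}\<^esub>" if "i < l" for i
    using cyc that unfolding is_cycle_def by auto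
  have vX: "{c i} \<in> X" if "i < l" for i using YX that by auto
  have "\<exists>a b. a \<in> f {c i} \<and> b \<in> f {c (Suc i mod l)} \<and> a \<otimes> inv b \<in> Rs {c i, c (Suc i mod l)}"
    if "i < l" for i
    using coboundary_0_split[OF ord f e[OF that]] by blast
  then obtain x where "\<And>i. i < l \<Longrightarrow> \<exists>b. x i \<in> f {c i} \<and> b \<in> f {c (Suc i mod l)}
      \<and> x i \<otimes> inv b \<in> Rs {c i, c (Suc i mod l)}"
    by metis
  then obtain y where xy: "\<And>i. i < l \<Longrightarrow> x i \<in> f {c i} \<and> y i \<in> f {c (Suc i mod l)}
      \<and> x i \<otimes> inv y i \<in> Rs {c i, c (Suc i mod l)}"
    by metis
  have "x i = x 0" if i: "i < l" for i
  proof (rule cycle_common_element[OF comm_group_axioms l disj[OF Y] _ _ _ _ _ i])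
    show "subgroup (Rs z) R" if "z \<in> ?Y" for z using subgroup_Rs YX that by blast
    show "x i \<in> carrier R" if "i < l" for i
      using cochain_0_rep(1)[OF f vX[OF that], of "x i"] xy[OF that] by blast
    show "y i \<in> carrier R" if "i < l" for i
      using cochain_0_rep(1)[OF f vX[OF m], of "y i"] xy[OF that] by blast
    show "x i \<otimes> inv y i \<in> Rs {c i, c (Suc i mod l)}" if "i < l" for i
      using xy[OF that] by blast
    show "y i \<otimes> inv x (Suc i mod l) \<in> Rs {c (Suc i mod l)}" if "i < l" for i
      using cochain_0_diff[OF f vX[OF m], of "y i" i "x (Suc i mod l)"] xy[OF that] xy[OF m] by blast
  qed
  then show ?thesis using xy by metis
qed

text \<open>Two common elements differ by an element of both vertex groups.\<close>

lemma common_element_unique: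
  assumes f: "f \<in> carrier (cochains X F 0)" and uv: "{u} \<in> X" "{v} \<in> X" "u \<noteq> v"
    and disj: "linearly_disjoint R {{u}, {v}} Rs"
    and ab: "a \<in> f {u} \<inter> f {v}" "b \<in> f {u} \<inter> f {v}"
  shows "a = b"
proof -
  have "a \<otimes> inv b \<in> Rs {u}" "a \<otimes> inv b \<in> Rs {v}"
    using cochain_0_diff[OF f uv(1)] cochain_0_diff[OF f uv(2)] ab by auto
  then have "a \<otimes> inv b = \<one>"
    using linearly_disjoint_pair[OF comm_group_axioms subgroup_Rs[OF uv(1)] subgroup_Rs[OF uv(2)] _ disj]
      uv(3) by auto
  moreover have "a \<in> carrier R" "b \<in> carrier R" using cochain_0_rep(1)[OF f uv(1)] ab by auto
  ultimately show ?thesis by (metis inv_closed inv_equality inv_inv)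
qed

end

theorem theorem6p2:
  fixes r n :: nat and X :: "'v set set" and V :: "nat \<Rightarrow> 'v set" and w :: "'v set \<Rightarrow> real"
    and ord :: "'v rel" and R :: "'a monoid" and Rs :: "'v set \<Rightarrow> 'a set"
    and t s mu lam :: real
  assumes "partite_weighted_complex r X V w"
    and "r \<ge> 1"
    and "n = card (faces X 0)"
    and "linear_order_on (\<Union>X) ord"
    and "comm_group R"
    and "\<And>x. x \<in> X \<Longrightarrow> x \<noteq> {} \<Longrightarrow> subgroup (Rs x) R"
    and "Rs {} = {\<one>\<^bsub>R\<^esub>}"
    and "t = Max {w e / w x | x e. x \<in> faces X 0 \<and> e \<in> faces X 1 \<and> x \<subseteq> e}"
    and "s = Max {w e | e. e \<in> faces X 1}"
    and "\<And>Y l. cycle_in X l Y \<Longrightarrow> int l \<le> \<lceil>2 / 3 * real n\<rceil> \<Longrightarrow> linearly_disjoint R Y Rs"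
    and "\<And>Y l. path_in X l Y \<Longrightarrow> l \<le> 2 \<Longrightarrow> linearly_disjoint R Y Rs"
    and "\<And>u v. u \<in> faces X 0 \<Longrightarrow> v \<in> faces X 0 \<Longrightarrow> u \<noteq> v \<Longrightarrow> linearly_disjoint R {u, v} Rs"
    and "mu \<le> lam"
    and "partite_expander r X V w mu lam"
    and "lam \<ge> - 1 / real r"
    and "5 * real r + 2 - 2 * real r * lam > 0"
  shows "cbe0 ord X w (quotient_sheaf (constant_sheaf R) (sum_subsheaf R Rs)) \<ge>
    ereal ((2 * real r - 4 * real r * lam - 4 * (real r)\<^sup>2 * max \<bar>lam\<bar> \<bar>mu\<bar>
              - (5 * real r + 2) * t - 2 * real r * s)
           / (5 * real r + 2 - 2 * real r * lam))"
proof -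
  interpret partite_weighted_complex r X V w by fact
  interpret vertex_edge_subgroups R X Rs
    using assms(5-7) complex by (simp add: vertex_edge_subgroups_def vertex_edge_subgroups_axioms_def)
  let ?N = "2 * real r - 4 * real r * lam - 4 * (real r)\<^sup>2 * max \<bar>lam\<bar> \<bar>mu\<bar>
              - (5 * real r + 2) * t - 2 * real r * s"
  let ?Q = "5 * real r + 2 - 2 * real r * lam"
  let ?S = "{c :: real. 0 \<le> c \<and> (\<forall>f\<in>carrier (cochains X F 0).
           cochain_norm X w F 1 (coboundary_0 ord X F f) \<ge> c * dist_B0 X w F f)}"
  define c where "c = ?N / ?Q"
  have wnn: "0 \<le> w x" if "x \<in> X" for x using weight_nonneg that .
  have norm_nn: "0 \<le> cochain_norm X w F 1 g" for g
    unfolding cochain_norm_def using wnn by (intro sum_nonneg) (auto simp: faces_def)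
  \<comment> \<open>A bound that is not positive follows from the admissible constant 0, so only
    \<open>c > 0\<close> needs an argument.\<close>
  have "c \<le> 0 \<or> c \<in> ?S"
  proof (rule disjCI)
    assume "\<not> c \<in> ?S"
    show "c \<le> 0"
    proof (rule ccontr)
      assume "\<not> c \<le> 0"
      then have c0: "0 < c" by simp
      have N0: "0 < ?N" using c0 assms(16) by (simp add: c_def zero_less_divide_iff)
      have verts0: "{v} \<in> faces X 0" if "v \<in> verts" for v using that faces_0_verts by blast
      have t: "w e \<le> t * w {v}" if e: "e \<in> faces X 1" and v: "v \<in> e" for e v
      proof -
        let ?A = "{w e / w x | x e. x \<in> faces X 0 \<and> e \<in> faces X 1 \<and> x \<subseteq> e}"
        have "?A \<subseteq> (\<lambda>(x, e). w e / w x) ` (faces X 0 \<times> faces X 1)" by auto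
        then have "finite ?A" by (rule finite_subset) (simp add: finite_faces)
        moreover have "v \<in> verts" using edge_subset_verts[OF e] v by blast
        then have "w e / w {v} \<in> ?A" using verts0 e v by blast
        ultimately have "w e / w {v} \<le> t" unfolding assms(8) by (rule Max_ge)
        then show ?thesis using weight_pos[OF \<open>v \<in> verts\<close>] by (simp add: pos_divide_le_eq)
      qed
      have "faces X 1 \<noteq> {}" using sum_edges[OF assms(2)] by auto
      then obtain e0 where e0: "e0 \<in> faces X 1" by blast
      then obtain v0 where v0: "v0 \<in> e0" by (auto simp: faces_1_eq card_2_iff)
      have "0 \<le> t * w {v0}" using t[OF e0 v0] edge_weight_ge_0[OF e0] by linarith
      then have t0: "0 \<le> t"
        using weight_pos[of v0] edge_subset_verts[OF e0] v0 by (auto simp: zero_le_mult_iff)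
      have "{w e | e. e \<in> faces X 1} = w ` faces X 1" by blast
      then have "w e0 \<le> s" unfolding assms(9) using finite_faces[of 1] e0 by (intro Max_ge) auto
      then have s0: "0 \<le> s" using edge_weight_ge_0[OF e0] by linarith
      define L where "L = max lam 0"
      have "L < 1 \<and> ?N / ?Q \<le> 2 / 3 * (1 - L) - 4 / 3 * t"
      proof (rule edge_threshold[OF _ t0 L_def _ _ N0 refl assms(16)])
        show "1 \<le> real r" using assms(2) by simp
        show "\<bar>lam\<bar> \<le> max \<bar>lam\<bar> \<bar>mu\<bar>" by simp
        have "0 \<le> 2 * real r * s" using s0 by simp
        then show "?N \<le> 2 * real r - 4 * real r * lam - 4 * (real r)\<^sup>2 * max \<bar>lam\<bar> \<bar>mu\<bar>
              - (5 * real r + 2) * t" by linarith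
      qed
      then have L1: "L < 1" and cL: "c \<le> 2 / 3 * (1 - L) - 4 / 3 * t" by (simp_all add: c_def)
      have L0: "0 \<le> L" "lam \<le> L" by (simp_all add: L_def)
      have inside: "(\<Sum>e | e \<in> faces X 1 \<and> e \<subseteq> U. w e) \<le> (\<Sum>v\<in>U. w {v}) * ((1 - L) * (\<Sum>v\<in>U. w {v}) + L)"
        if "U \<subseteq> verts" for U
        by (rule edges_inside_le[OF assms(2,14) that L0(2,1)])
      \<comment> \<open>The least weight of a monochromatic blob for which the estimate for its
        leaving edges gives the factor \<open>c\<close>.\<close>
      define p0 where "p0 = (c + 2 * t) / (2 * (1 - L))"
      have "2 * (q * (x / (2 * q))) = x" if "q \<noteq> 0" for q x :: real using that by simp
      from this[of "1 - L" "c + 2 * t"] have p0: "2 * ((1 - L) * p0) = c + 2 * t"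
        using L1 by (simp only: p0_def)
      have p0_pos: "0 < p0" using c0 t0 L1 by (simp add: p0_def)
      have "c \<in> ?S"
      proof (intro CollectI conjI ballI)
        fix f assume f: "f \<in> carrier (cochains X F 0)"
        let ?d = "dist_B0 X w F f"
        define E where "E = {e \<in> faces X 1. coboundary_0 ord X F f e = \<one>\<^bsub>stalk F e\<^esub>}"
        have EF: "E \<subseteq> faces X 1" by (auto simp: E_def)
        have norm: "cochain_norm X w F 1 (coboundary_0 ord X F f) = 1 - sum w E"
        proof -
          have "{x \<in> faces X 1. coboundary_0 ord X F f x \<noteq> \<one>\<^bsub>stalk F x\<^esub>} = faces X 1 - E"
            by (auto simp: E_def)
          then show ?thesis
            unfolding cochain_norm_def using sum_diff[OF finite_faces EF, of w] sum_edges[OF assms(2)] by simp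
        qed
        have uniq: "a = b" if "u \<in> verts" "v \<in> verts" "u \<noteq> v" "a \<in> f {u} \<inter> f {v}" "b \<in> f {u} \<inter> f {v}"
          for u v a b
        proof (rule common_element_unique[OF f singleton_face[OF that(1)] singleton_face[OF that(2)] that(3) _ that(4,5)])
          show "linearly_disjoint R {{u}, {v}} Rs"
            using assms(12) verts0 that(1-3) by simp
        qed
        have nverts: "n = card verts"
          unfolding assms(3) faces_0_verts by (rule card_image) (auto simp: inj_on_def)
        have short: "\<exists>a. \<forall>i<l. a \<in> f {d i}" if cyc: "is_cycle E l d" and l: "3 * l \<le> 2 * (card verts + 1)" for l d
        proof (rule short_cycle_monochromatic[OF assms(4) f cyc[unfolded E_def]])
          have "real (3 * l) \<le> real (2 * (card verts + 1))" using l by (simp only: of_nat_le_iff)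
          \<comment> \<open>The ceiling provides the off-by-one: \<open>3 l \<le> 2 n + 2\<close>
            implies \<open>l - 1 < 2 n / 3\<close>.\<close>
          then have "real_of_int (int l) - 1 < 2 / 3 * real n" unfolding nverts by simp
          then have "int l \<le> \<lceil>2 / 3 * real n\<rceil>" by (simp only: le_ceiling_iff)
          then show "linearly_disjoint R Y Rs" if "cycle_in X l Y" for Y using assms(10) that by blast
        qed
        have two: "card e = 2" if "e \<in> E" for e using EF that by (auto simp: faces_1_eq)
        have EW: "\<Union>E \<subseteq> verts" using EF edge_subset_verts by blast
        obtain \<P> C rt where
          PW: "\<And>P. P \<in> \<P> \<Longrightarrow> P \<subseteq> verts" and CP: "\<And>P. P \<in> \<P> \<Longrightarrow> C P \<subseteq> P"
          and rt: "\<And>P. P \<in> \<P> \<Longrightarrow> P \<subseteq> insert (rt P) (C P)"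
          and disj: "\<And>P Q. P \<in> \<P> \<Longrightarrow> Q \<in> \<P> \<Longrightarrow> P \<noteq> Q \<Longrightarrow> C P \<inter> C Q = {}"
          and inter: "\<And>P Q x y. P \<in> \<P> \<Longrightarrow> Q \<in> \<P> \<Longrightarrow> P \<noteq> Q \<Longrightarrow> x \<in> P \<inter> Q \<Longrightarrow> y \<in> P \<inter> Q \<Longrightarrow> x = y"
          and cover: "\<And>e. e \<in> E \<Longrightarrow> \<exists>P\<in>\<P>. e \<subseteq> P"
          and col: "\<And>P. P \<in> \<P> \<Longrightarrow> (\<exists>a. \<forall>v\<in>P. a \<in> f {v}) \<or> card (C P) \<le> 1"
        proof (rule blob_decomposition[of verts E "\<lambda>v. f {v}", OF finite_verts])
          show "card e = 2" if "e \<in> E" for e by (rule two[OF that])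
          show "\<Union>E \<subseteq> verts" by (rule EW)
          show "a = b" if "u \<in> verts" "v \<in> verts" "u \<noteq> v" "a \<in> f {u} \<inter> f {v}" "b \<in> f {u} \<inter> f {v}"
            for u v a b by (rule uniq[OF that])
          show "\<exists>a. \<forall>i<l. a \<in> f {d i}" if "is_cycle E l d" "3 * l \<le> 2 * (card verts + 1)" for l d
            by (rule short[OF that])
        qed (rule that)
        have dist: "?d \<le> (\<Sum>v | v \<in> verts \<and> a \<notin> f {v}. w {v})" if a: "a \<in> carrier R" for a
        proof -
          have "{x \<in> faces X 0. a \<notin> f x} = (\<lambda>v. {v}) ` {v. v \<in> verts \<and> a \<notin> f {v}}"
            unfolding faces_0_verts by auto
          then have "sum w {x \<in> faces X 0. a \<notin> f x} = (\<Sum>v | v \<in> verts \<and> a \<notin> f {v}. w {v})"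
            by (simp add: sum.reindex)
          then show ?thesis using dist_B0_le[of f a w, OF f a] wnn by simp
        qed
        show "c * ?d \<le> cochain_norm X w F 1 (coboundary_0 ord X F f)"
        proof (cases "\<exists>P\<in>\<P>. (\<exists>a. \<forall>v\<in>P. a \<in> f {v}) \<and> p0 \<le> (\<Sum>v\<in>P. w {v})")
          case True
          then obtain P a where P: "P \<in> \<P>" and a: "\<And>v. v \<in> P \<Longrightarrow> a \<in> f {v}"
            and large: "p0 \<le> (\<Sum>v\<in>P. w {v})" by blast
          define p where "p = (\<Sum>v\<in>P. w {v})"
          define b where "b = (\<Sum>v\<in>verts - P. w {v})"
          have pb: "p + b = 1"
            unfolding p_def b_def using sum.subset_diff[OF PW[OF P] finite_verts, of "\<lambda>v. w {v}"] sum_weight by simp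
          have b0: "0 \<le> b" unfolding b_def using weight_pos by (intro sum_nonneg) (auto simp: less_imp_le)
          have "P \<noteq> {}" using large p0_pos by auto
          then obtain v where v: "v \<in> P" by blast
          have aR: "a \<in> carrier R"
            using cochain_0_rep(1)[OF f singleton_face a[OF v]] PW[OF P] v by blast
          have "?d \<le> b"
          proof -
            have "{v. v \<in> verts \<and> a \<notin> f {v}} \<subseteq> verts - P" using a by blast
            then have "(\<Sum>v | v \<in> verts \<and> a \<notin> f {v}. w {v}) \<le> b"
              unfolding b_def using finite_verts weight_pos by (intro sum_mono2) (auto simp: less_imp_le)
            then show ?thesis using dist[OF aR] by linarith
          qed
          let ?I = "{e. e \<in> faces X 1 \<and> e \<subseteq> P}" and ?O = "{e. e \<in> faces X 1 \<and> e \<subseteq> verts - P}"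
          let ?K = "{e \<in> E. e \<inter> P \<noteq> {} \<and> \<not> e \<subseteq> P}"
          have K: "sum w ?K \<le> 2 * t * b"
            unfolding b_def
          proof (rule sum_leaving_edges[OF EF])
            show "\<exists>P\<in>\<P>. e \<subseteq> P" if "e \<in> E" for e by (rule cover[OF that])
            show "P \<subseteq> insert (rt P) (C P)" if "P \<in> \<P>" for P by (rule rt[OF that])
            show "C P \<inter> C Q = {}" if "P \<in> \<P>" "Q \<in> \<P>" "P \<noteq> Q" for P Q by (rule disj[OF that])
            show "x = y" if "P \<in> \<P>" "Q \<in> \<P>" "P \<noteq> Q" "x \<in> P \<inter> Q" "y \<in> P \<inter> Q" for P Q x y
              by (rule inter[OF that])
            show "w e \<le> t * w {v}" if "e \<in> faces X 1" "v \<in> e" for e v by (rule t[OF that])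
          qed (use t0 P in auto)
          \<comment> \<open>The spectral bound is applied to \<open>P\<close> and to its complement;
            only the edges between them need the blob structure.\<close>
          have "E \<subseteq> ?I \<union> (?O \<union> ?K)" using EF edge_subset_verts by blast
          then have "sum w E \<le> sum w (?I \<union> (?O \<union> ?K))"
            using finite_faces[of 1] EF edge_weight_ge_0 by (intro sum_mono2) (auto intro: finite_subset)
          also have "\<dots> \<le> sum w ?I + (sum w ?O + sum w ?K)"
          proof -
            have f1: "finite ?I" "finite ?O" "finite ?K"
              using finite_faces[of 1] finite_subset[OF EF] by auto
            have nn: "0 \<le> sum w (?I \<inter> (?O \<union> ?K))" "0 \<le> sum w (?O \<inter> ?K)"
              using edge_weight_ge_0 by (auto intro!: sum_nonneg)
            show ?thesis
              using sum_Un[OF f1(1), of "?O \<union> ?K" w] sum_Un[OF f1(2,3), of w] f1 nn by simp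
          qed
          also have "\<dots> \<le> p * ((1 - L) * p + L) + (b * ((1 - L) * b + L) + 2 * t * b)"
            using inside[OF PW[OF P]] inside[of "verts - P"] K unfolding p_def b_def
            by (intro add_mono) auto
          finally have "1 - sum w E \<ge> 1 - (p * ((1 - L) * p + L) + (b * ((1 - L) * b + L) + 2 * t * b))"
            by simp
          moreover have "1 - (p * ((1 - L) * p + L) + (b * ((1 - L) * b + L) + 2 * t * b))
              = b * (2 * ((1 - L) * p) - 2 * t)"
          proof -
            have peq: "p = 1 - b" using pb by simp
            show ?thesis unfolding peq by (simp add: algebra_simps)
          qed
          moreover have "b * c \<le> b * (2 * ((1 - L) * p) - 2 * t)"
          proof -
            have "(1 - L) * p0 \<le> (1 - L) * p" using large L1 unfolding p_def by (intro mult_left_mono) auto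
            then show ?thesis using p0 b0 by (intro mult_left_mono) auto
          qed
          moreover have "c * ?d \<le> c * b" using \<open>?d \<le> b\<close> c0 by (intro mult_left_mono) auto
          ultimately show ?thesis unfolding norm by (simp add: mult.commute)
        next
          case False
          \<comment> \<open>The spectral bound per unit of weight for a vertex set of weight
            \<open>p0\<close>.\<close>
          define k where "k = (1 - L) * p0 + L"
          have k0: "0 \<le> k" unfolding k_def using L0 L1 p0_pos by simp
          have "sum w E \<le> k + t"
          proof (rule sum_edges_by_blobs[OF EF])
            show "\<exists>P\<in>\<P>. e \<subseteq> P" if "e \<in> E" for e by (rule cover[OF that])
            show "P \<subseteq> verts" if "P \<in> \<P>" for P by (rule PW[OF that])
            show "C P \<subseteq> P" if "P \<in> \<P>" for P by (rule CP[OF that])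
            show "P \<subseteq> insert (rt P) (C P)" if "P \<in> \<P>" for P by (rule rt[OF that])
            show "C P \<inter> C Q = {}" if "P \<in> \<P>" "Q \<in> \<P>" "P \<noteq> Q" for P Q by (rule disj[OF that])
            show "w e \<le> t * w {v}" if "e \<in> faces X 1" "v \<in> e" for e v by (rule t[OF that])
            show "(\<Sum>e | e \<in> faces X 1 \<and> e \<subseteq> C P. w e) \<le> k * (\<Sum>v\<in>C P. w {v})" if P: "P \<in> \<P>" for P
            proof -
              let ?q = "\<Sum>v\<in>C P. w {v}"
              have CW: "C P \<subseteq> verts" using CP[OF P] PW[OF P] by blast
              have finC: "finite (C P)" using CW finite_verts by (rule finite_subset)
              have q0: "0 \<le> ?q" using CW weight_pos by (intro sum_nonneg) (auto simp: less_imp_le subset_iff)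
              show ?thesis
              proof (cases "card (C P) \<le> 1")
                \<comment> \<open>A colourless blob has no weight restriction, but at most one
                  vertex besides the root, so no edge avoids the root.\<close>
                case True
                have "\<not> e \<subseteq> C P" if "e \<in> faces X 1" for e
                  using card_mono[OF finC, of e] True that by (auto simp: faces_1_eq)
                then have "{e. e \<in> faces X 1 \<and> e \<subseteq> C P} = {}" by blast
                then show ?thesis using k0 q0 by (simp only: sum.empty mult_nonneg_nonneg)
              next
                case False
                then have "\<exists>a. \<forall>v\<in>P. a \<in> f {v}" using col[OF P] by blast
                then have "(\<Sum>v\<in>P. w {v}) < p0"
                  using \<open>\<not> (\<exists>P\<in>\<P>. (\<exists>a. \<forall>v\<in>P. a \<in> f {v}) \<and> p0 \<le> (\<Sum>v\<in>P. w {v}))\<close> P by force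
                moreover have "?q \<le> (\<Sum>v\<in>P. w {v})"
                  using CP[OF P] PW[OF P] weight_pos finite_subset[OF PW[OF P] finite_verts]
                  by (intro sum_mono2) (auto simp: less_imp_le subset_iff)
                ultimately have "(1 - L) * ?q + L \<le> k"
                  unfolding k_def using L1 by (intro add_right_mono mult_left_mono) auto
                then have "?q * ((1 - L) * ?q + L) \<le> ?q * k" using q0 by (rule mult_left_mono)
                then show ?thesis using inside[OF CW] by (simp add: mult.commute)
              qed
            qed
          qed (use t0 k0 in auto)
          \<comment> \<open>Since \<open>(1 - L) p0 = c / 2 + t\<close>, this is exactly the
            inequality \<open>cL\<close>.\<close>
          moreover have "c \<le> 1 - (k + t)" unfolding k_def using p0 cL by (simp add: field_simps)
          \<comment> \<open>Without a large blob there is no distinguished colour; the distance to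
            the neutral constant cochain is at most the total weight 1.\<close>
          moreover have "?d \<le> 1"
            using dist[OF one_closed] sum_weight_le_1[of "{v. v \<in> verts \<and> \<one>\<^bsub>R\<^esub> \<notin> f {v}}"] by force
          then have "c * ?d \<le> c * 1" using c0 by (intro mult_left_mono) auto
          ultimately show ?thesis unfolding norm by linarith
        qed
      qed (use c0 in simp)
      then show False using \<open>\<not> c \<in> ?S\<close> by blast
    qed
  qed
  moreover have "0 \<in> ?S" using norm_nn by simp
  ultimately obtain c' where "c \<le> c'" "c' \<in> ?S" by blast
  then have "ereal c \<le> ereal c'" "ereal c' \<le> cbe0 ord X w F"
    unfolding cbe0_def by (auto intro!: SUP_upper)
  then have "ereal c \<le> cbe0 ord X w F" by (rule order_trans)
  then show ?thesis unfolding c_def .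
qed

end
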